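(* Let $u\in\{\mathrm{I},\mathrm{II}\}$, let Scheme $u$ be used, and suppose Assumptions 1, 2 and 3 (stated in the context) hold. Suppose the learning rate is $\eta_t=\frac{1}{\varpi_u\sqrt{T}}$. Then the convergence at the $T$-th round is bounded by $$\frac1T\sum_{t=0}^{T-1}\mathbb{E}\left[\|\nabla F(\mathbf{w}_t)\|^2\right]\le\frac{2\varpi_u}{\sqrt T}\left(F(\mathbf{w}_0)-\mathbb{E}[F(\mathbf{w}^* )]+\frac{\varepsilon_u}{2\varpi_u^2}\right),$$ where the scaling factor $\varpi_u$ and the bias term $\varepsilon_u$ are $$\varpi_{\mathrm{I}}=\left(\frac{(16-\pi^2)\xi^2}{\pi^2N}+1\right)L,\qquad \varepsilon_{\mathrm{I}}=\left(\frac{8(K+1)+\pi^2(N-1)}{\pi^2NK}\chi^2+\Delta_{1,2}+\Delta_{1,3}\right)L,$$ $$\varpi_{\mathrm{II}}=\left(\frac{\frac{8}{K^2}\sum_{k\in\mathcal{K}}\alpha_k^2\sum_{i\in\mathcal{K}}\alpha_i^{-2}+8-\pi^2}{\pi^2N}\xi^2+1\right)L,$$ $$\varepsilon_{\mathrm{II}}=\left(\frac{\frac8K\sum_{k\in\mathcal{K}}\alpha_k^2\sum_{i\in\mathcal{K}}\alpha_i^{-2}+8+\pi^2(N-1)}{\pi^2NK}\chi^2+\Delta_{2,2}+\Delta_{2,3}\right)L,$$ with $\alpha_i=\beta_i\sqrt{P_i}$ for $i\in\mathcal{K}\cup\mathcal{M}$ and $$\Delta_{1,2}=\sum_{m\in\mathcal{M}}\frac{8G^2\alpha_m^2}{\pi^2NK\min_{k\in\mathcal{K}}\alpha_k^2},\qquad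 \Delta_{1,3}=\frac{8G^2\sigma^2D}{\pi^2N^2K\min_{k\in\mathcal{K}}\alpha_k^2},$$ $$\Delta_{2,2}=\sum_{m\in\mathcal{M}}\frac{8G^2\sum_{i\in\mathcal{K}}\alpha_i^{-2}}{\pi^2NK^2\alpha_m^{-2}},\qquad \Delta_{2,3}=\frac{8G^2\sigma^2D\sum_{i\in\mathcal{K}}\alpha_i^{-2}}{\pi^2N^2K^2}.$$
   Context: Let $\mathcal{K}=\{1,\dots,K\}$ be the set of target devices and $\mathcal{M}=\{K+1,\dots,K+M\}$ the set of interferers; $N$ is the number of reflecting elements of a reconfigurable intelligent surface (RIS), $D$ the model dimension, $T$ the number of training rounds. Learning model. Each device $k\in\mathcal{K}$ has a local loss $F_k:\mathbb{R}^D\to\mathbb{R}$, the average of a sample-wise loss over its local dataset (all local datasets have the same size); the global loss is $F=\frac1K\sum_{k\in\mathcal{K}}F_k$, and $\mathbf{w}^*$ denotes its minimizer. Starting from an initial model $\mathbf{w}_0$, in round $t$ each device $k$ computes the local gradient $\mathbf{g}_{t,k}\in\mathbb{R}^D$, the average of the sample-wise loss gradients at $\mathbf{w}_t$ over a mini-batch selected from its local dataset, with $\|\mathbf{g}_{t,k}\|\le G$ for a finite constant $G$. The server updates $\mathbf{w}_{t+1}=\mathbf{w}_t-\eta_t\hat{\mathbf{g}}_t$ with the estimate $\hat{\mathbf{g}}_t$ (given below) of $\mathbf{g}_t=\frac1K\sum_{k\in\mathcal{K}}\mathbf{g}_{t,k}$. Assumption 1: the $F_k$ are differentiable with $L$-Lipschitz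 gradients, which gives $F_k(\mathbf{w})\le F_k(\mathbf{v})+\nabla F_k(\mathbf{v})^T(\mathbf{w}-\mathbf{v})+\frac L2\|\mathbf{w}-\mathbf{v}\|^2$. Assumption 2: the stochastic gradient is unbiased and variance-bounded, i.e. $\mathbb{E}[\mathbf{g}_{t,k}]=\nabla F_k(\mathbf{w}_t)$ and $\mathbb{V}[\mathbf{g}_{t,k}]\le\chi^2$, where $\mathbb{V}$ denotes variance (expected squared Euclidean distance to the mean). Assumption 3: there is a finite $\xi$ with $\|\nabla F_k(\mathbf{w})\|\le\xi\|\nabla F(\mathbf{w})\|$. Communication model. The channel vectors $\mathbf{h}_p$ (RIS to server) and $\mathbf{h}_{r,i}$ (device $i$ to RIS), $i\in\mathcal{K}\cup\mathcal{M}$, with entries $h_{p,n},h_{r,i,n}$, are independent, each distributed as $\mathcal{CN}(\mathbf{0},\mathbf{I}_N)$ (circularly symmetric complex Gaussian with identity covariance); the noise is $\mathbf{z}_t\sim\mathcal{CN}(\mathbf{0},\sigma^2\mathbf{I}_D)$. The constants $\beta_i$ are large-scale fading coefficients and $P_i$ maximum transmit powers. The interference signals $\tilde{\mathbf{g}}_{t,m}\in\mathbb{R}^D$ are arbitrary with $\|\tilde{\mathbf{g}}_{t,m}\|=1$, and interferers transmit at maximum power, $p_m=P_m$, $m\in\mathcal{M}$. With $\mathbf{\Theta}=\mathrm{diag}\{e^{j\theta_1},\dots,e^{j\theta_N}\}$, $j=\sqrt{-1}$, denoising factor $\lambda$, and $\ell_i=\frac{\beta_i\sqrt{p_i}}{\lambda}\Re\{\mathbf{h}_p^H\mathbf{\Theta}\mathbf{h}_{r,i}\}$,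 $i\in\mathcal{K}\cup\mathcal{M}$, the estimate is $$\hat{\mathbf{g}}_t=\sum_{k\in\mathcal{K}}\ell_k\mathbf{g}_{t,k}+\sum_{m\in\mathcal{M}}\ell_m\tilde{\mathbf{g}}_{t,m}+\frac{\Re\{\mathbf{z}_t\}}{\lambda}.$$ Here $\angle$ is the argument, $^\ast$ conjugation, $^H$ conjugate transpose, $\Re$ the real part. Scheme I: $\sqrt{p_k}=\beta_k^{-1}\frac{\min_{i\in\mathcal{K}}\sqrt{P_i}\beta_i}{G}$ for $k\in\mathcal{K}$, $\lambda=\frac{\pi N\sqrt K\min_{k\in\mathcal{K}}\sqrt{P_k}\beta_k}{4G}$, and $\theta_n=-\angle h_{p,n}^\ast+\angle\sum_{k=1}^K h_{r,k,n}^\ast$ for $n=1,\dots,N$. Scheme II: $\sqrt{p_k}=\frac{\sqrt{P_k}}{G}$ and $w_k=\frac{1}{\beta_k\sqrt{P_k}}$ for $k\in\mathcal{K}$, $\lambda=\frac{\pi NK}{4G\sqrt{\sum_{k=1}^Kw_k^2}}$, and $\theta_n=-\angle h_{p,n}^\ast+\angle\sum_{k=1}^K w_k h_{r,k,n}^\ast$ for $n=1,\dots,N$. *)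

theory Defs
  imports "HOL-Probability.Probability"
begin

(* Throughout, D = CARD('d) and N = CARD('n).  Devices are numbered 1..K, interferers K+1..K+M. *)

section \<open>Learning model\<close>

definition grad :: "(real^'d \<Rightarrow> real) \<Rightarrow> real^'d \<Rightarrow> real^'d" where
  "grad f w = (THE g. GDERIV f w :> g)"

text \<open>\<open>f s w\<close> is the loss of sample \<open>s\<close> at model \<open>w\<close>; \<open>x k j\<close>, for \<open>j < S\<close>, are the samples in
  the dataset of device \<open>k\<close>. A mini-batch is a set of sample indices, so repeated data points
  are allowed.\<close>

definition local_loss ::
  "('s \<Rightarrow> real^'d \<Rightarrow> real) \<Rightarrow> (nat \<Rightarrow> nat \<Rightarrow> 's) \<Rightarrow> nat \<Rightarrow> nat \<Rightarrow> real^'d \<Rightarrow> real" where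
  "local_loss f x S k w = (\<Sum>j<S. f (x k j) w) / real S"

definition global_loss ::
  "('s \<Rightarrow> real^'d \<Rightarrow> real) \<Rightarrow> (nat \<Rightarrow> nat \<Rightarrow> 's) \<Rightarrow> nat \<Rightarrow> nat \<Rightarrow> real^'d \<Rightarrow> real" where
  "global_loss f x S K w = (\<Sum>k=1..K. local_loss f x S k w) / real K"

definition minibatch_grad ::
  "('s \<Rightarrow> real^'d \<Rightarrow> real) \<Rightarrow> (nat \<Rightarrow> nat \<Rightarrow> 's) \<Rightarrow> nat \<Rightarrow> nat set \<Rightarrow> real^'d \<Rightarrow> real^'d" where
  "minibatch_grad f x k B w = (\<Sum>j\<in>B. grad (f (x k j)) w) /\<^sub>R real (card B)"

text \<open>Mean and variance of a random vector \<open>X\<close> given the random vector \<open>Y\<close>. They are used with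
  \<open>X\<close> a stochastic gradient and \<open>Y\<close> the (random) model at which it is evaluated.\<close>

definition cond_mean :: "'w measure \<Rightarrow> ('w \<Rightarrow> real^'d) \<Rightarrow> ('w \<Rightarrow> real^'d) \<Rightarrow> 'w \<Rightarrow> real^'d" where
  "cond_mean Pr Y X \<omega> =
     (\<chi> i. real_cond_exp Pr (vimage_algebra (space Pr) Y borel) (\<lambda>\<omega>'. X \<omega>' $ i) \<omega>)"

definition cond_variance :: "'w measure \<Rightarrow> ('w \<Rightarrow> real^'d) \<Rightarrow> ('w \<Rightarrow> real^'d) \<Rightarrow> 'w \<Rightarrow> real" where
  "cond_variance Pr Y X \<omega> =
     real_cond_exp Pr (vimage_algebra (space Pr) Y borel)
       (\<lambda>\<omega>'. (norm (X \<omega>' - cond_mean Pr Y X \<omega>'))\<^sup>2) \<omega>"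

section \<open>Communication model\<close>

text \<open>\<open>CN(0, v I)\<close>: the standard basis of \<open>complex^'n\<close> as a real Euclidean space consists of the
  vectors \<open>axis i 1\<close> and \<open>axis i \<i>\<close>, so the coordinates below are the real and imaginary
  parts of all entries; they are i.i.d. normal with variance \<open>v/2\<close>.\<close>

definition CN :: "'w measure \<Rightarrow> real \<Rightarrow> ('w \<Rightarrow> complex^'n) \<Rightarrow> bool" where
  "CN Pr v X \<longleftrightarrow>
     prob_space.indep_vars Pr (\<lambda>_. borel) (\<lambda>b \<omega>. X \<omega> \<bullet> b) Basis \<and>
     (\<forall>b\<in>Basis. distributed Pr lborel (\<lambda>\<omega>. X \<omega> \<bullet> b) (normal_density 0 (sqrt (v / 2))))"

datatype scheme = Scheme_I | Scheme_II

fun tx_power ::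
  "scheme \<Rightarrow> nat \<Rightarrow> real \<Rightarrow> (nat \<Rightarrow> real) \<Rightarrow> (nat \<Rightarrow> real) \<Rightarrow> nat \<Rightarrow> real" where
  "tx_power Scheme_I K G \<beta> P i =
     (if i \<in> {1..K} then (inverse (\<beta> i) * ((MIN j\<in>{1..K}. sqrt (P j) * \<beta> j) / G))\<^sup>2 else P i)"
| "tx_power Scheme_II K G \<beta> P i =
     (if i \<in> {1..K} then (sqrt (P i) / G)\<^sup>2 else P i)"

definition weight :: "(nat \<Rightarrow> real) \<Rightarrow> (nat \<Rightarrow> real) \<Rightarrow> nat \<Rightarrow> real" where
  "weight \<beta> P k = 1 / (\<beta> k * sqrt (P k))"

fun denoising_factor ::
  "scheme \<Rightarrow> nat \<Rightarrow> nat \<Rightarrow> real \<Rightarrow> (nat \<Rightarrow> real) \<Rightarrow> (nat \<Rightarrow> real) \<Rightarrow> real" where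
  "denoising_factor Scheme_I K N G \<beta> P =
     pi * real N * sqrt (real K) * (MIN k\<in>{1..K}. sqrt (P k) * \<beta> k) / (4 * G)"
| "denoising_factor Scheme_II K N G \<beta> P =
     pi * real N * real K / (4 * G * sqrt (\<Sum>k=1..K. (weight \<beta> P k)\<^sup>2))"

fun ris_phase ::
  "scheme \<Rightarrow> nat \<Rightarrow> (nat \<Rightarrow> real) \<Rightarrow> (nat \<Rightarrow> real) \<Rightarrow> complex^'n \<Rightarrow> (nat \<Rightarrow> complex^'n) \<Rightarrow> 'n \<Rightarrow> real" where
  "ris_phase Scheme_I K \<beta> P hp hr n =
     - Arg (cnj (hp $ n)) + Arg (\<Sum>k=1..K. cnj (hr k $ n))"
| "ris_phase Scheme_II K \<beta> P hp hr n =
     - Arg (cnj (hp $ n)) + Arg (\<Sum>k=1..K. complex_of_real (weight \<beta> P k) * cnj (hr k $ n))"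

text \<open>The coefficient \<open>\<ell>\<^sub>i\<close>; the sum is \<open>hp\<^sup>H \<Theta> hr\<^sub>i\<close> with \<open>\<Theta>\<close> the diagonal matrix of the RIS
  phase shifts.\<close>

definition rx_coeff ::
  "scheme \<Rightarrow> nat \<Rightarrow> real \<Rightarrow> (nat \<Rightarrow> real) \<Rightarrow> (nat \<Rightarrow> real) \<Rightarrow> complex^'n \<Rightarrow> (nat \<Rightarrow> complex^'n) \<Rightarrow> nat \<Rightarrow> real" where
  "rx_coeff u K G \<beta> P hp hr i =
     \<beta> i * sqrt (tx_power u K G \<beta> P i) / denoising_factor u K CARD('n) G \<beta> P *
     Re (\<Sum>n\<in>UNIV. cnj (hp $ n) * cis (ris_phase u K \<beta> P hp hr n) * hr i $ n)"

text \<open>The server's estimate, given the local gradients \<open>g\<close>, the interference \<open>gi\<close> and the noise \<open>z\<close>.\<close>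

definition grad_estimate ::
  "scheme \<Rightarrow> nat \<Rightarrow> nat \<Rightarrow> real \<Rightarrow> (nat \<Rightarrow> real) \<Rightarrow> (nat \<Rightarrow> real) \<Rightarrow> complex^'n \<Rightarrow> (nat \<Rightarrow> complex^'n)
     \<Rightarrow> (nat \<Rightarrow> real^'d) \<Rightarrow> (nat \<Rightarrow> real^'d) \<Rightarrow> complex^'d \<Rightarrow> real^'d" where
  "grad_estimate u K M G \<beta> P hp hr g gi z =
     (\<Sum>k\<in>{1..K}. rx_coeff u K G \<beta> P hp hr k *\<^sub>R g k) +
     (\<Sum>m\<in>{K+1..K+M}. rx_coeff u K G \<beta> P hp hr m *\<^sub>R gi m) +
     (\<chi> i. Re (z $ i)) /\<^sub>R denoising_factor u K CARD('n) G \<beta> P"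

text \<open>The random quantities drawn in one round (mini-batches, channels, noise), together with a
  \<open>\<sigma>\<close>-algebra \<open>A\<close> that represents everything determined before these draws.\<close>

datatype source = Past | Batch nat | Server_Channel | Device_Channel nat | Noise

definition round_indep ::
  "'w measure \<Rightarrow> nat \<Rightarrow> nat \<Rightarrow> 'w measure \<Rightarrow> (nat \<Rightarrow> 'w \<Rightarrow> nat set) \<Rightarrow> ('w \<Rightarrow> complex^'n)
     \<Rightarrow> (nat \<Rightarrow> 'w \<Rightarrow> complex^'n) \<Rightarrow> ('w \<Rightarrow> complex^'d) \<Rightarrow> bool" where
  "round_indep Pr K M A B hp hr z \<longleftrightarrow>
     prob_space.indep_sets Pr
       (\<lambda>s. case s of
              Past \<Rightarrow> sets A
            | Batch k \<Rightarrow> sets (vimage_algebra (space Pr) (B k) (count_space UNIV))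
            | Server_Channel \<Rightarrow> sets (vimage_algebra (space Pr) hp borel)
            | Device_Channel i \<Rightarrow> sets (vimage_algebra (space Pr) (hr i) borel)
            | Noise \<Rightarrow> sets (vimage_algebra (space Pr) z borel))
       ({Past, Server_Channel, Noise} \<union> Batch ` {1..K} \<union> Device_Channel ` {1..K+M})"

section \<open>Constants of the bound\<close>

definition alpha :: "(nat \<Rightarrow> real) \<Rightarrow> (nat \<Rightarrow> real) \<Rightarrow> nat \<Rightarrow> real" where
  "alpha \<beta> P i = \<beta> i * sqrt (P i)"

fun scaling_factor :: "scheme \<Rightarrow> nat \<Rightarrow> nat \<Rightarrow> real \<Rightarrow> real \<Rightarrow> (nat \<Rightarrow> real) \<Rightarrow> real" where
  "scaling_factor Scheme_I K N L \<xi> \<alpha> =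
     ((16 - pi\<^sup>2) * \<xi>\<^sup>2 / (pi\<^sup>2 * real N) + 1) * L"
| "scaling_factor Scheme_II K N L \<xi> \<alpha> =
     ((8 / (real K)\<^sup>2 * (\<Sum>k=1..K. (\<alpha> k)\<^sup>2) * (\<Sum>i=1..K. \<alpha> i powi (-2)) + 8 - pi\<^sup>2)
        / (pi\<^sup>2 * real N) * \<xi>\<^sup>2 + 1) * L"

fun interference_term :: "scheme \<Rightarrow> nat \<Rightarrow> nat \<Rightarrow> nat \<Rightarrow> real \<Rightarrow> (nat \<Rightarrow> real) \<Rightarrow> real" where
  "interference_term Scheme_I K M N G \<alpha> =
     (\<Sum>m\<in>{K+1..K+M}. 8 * G\<^sup>2 * (\<alpha> m)\<^sup>2
        / (pi\<^sup>2 * real N * real K * (MIN k\<in>{1..K}. (\<alpha> k)\<^sup>2)))"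
| "interference_term Scheme_II K M N G \<alpha> =
     (\<Sum>m\<in>{K+1..K+M}. 8 * G\<^sup>2 * (\<Sum>i=1..K. \<alpha> i powi (-2))
        / (pi\<^sup>2 * real N * (real K)\<^sup>2 * \<alpha> m powi (-2)))"

fun noise_term :: "scheme \<Rightarrow> nat \<Rightarrow> nat \<Rightarrow> nat \<Rightarrow> real \<Rightarrow> real \<Rightarrow> (nat \<Rightarrow> real) \<Rightarrow> real" where
  "noise_term Scheme_I K N D G \<sigma> \<alpha> =
     8 * G\<^sup>2 * \<sigma>\<^sup>2 * real D / (pi\<^sup>2 * (real N)\<^sup>2 * real K * (MIN k\<in>{1..K}. (\<alpha> k)\<^sup>2))"
| "noise_term Scheme_II K N D G \<sigma> \<alpha> =
     8 * G\<^sup>2 * \<sigma>\<^sup>2 * real D * (\<Sum>i=1..K. \<alpha> i powi (-2)) / (pi\<^sup>2 * (real N)\<^sup>2 * (real K)\<^sup>2)"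

fun bias_term ::
  "scheme \<Rightarrow> nat \<Rightarrow> nat \<Rightarrow> nat \<Rightarrow> nat \<Rightarrow> real \<Rightarrow> real \<Rightarrow> real \<Rightarrow> real \<Rightarrow> (nat \<Rightarrow> real) \<Rightarrow> real" where
  "bias_term Scheme_I K M N D L G \<sigma> \<chi>\<^sub>g \<alpha> =
     ((8 * (real K + 1) + pi\<^sup>2 * (real N - 1)) / (pi\<^sup>2 * real N * real K) * \<chi>\<^sub>g\<^sup>2
       + interference_term Scheme_I K M N G \<alpha> + noise_term Scheme_I K N D G \<sigma> \<alpha>) * L"
| "bias_term Scheme_II K M N D L G \<sigma> \<chi>\<^sub>g \<alpha> =
     ((8 / real K * (\<Sum>k=1..K. (\<alpha> k)\<^sup>2) * (\<Sum>i=1..K. \<alpha> i powi (-2)) + 8 + pi\<^sup>2 * (real N - 1))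
         / (pi\<^sup>2 * real N * real K) * \<chi>\<^sub>g\<^sup>2
       + interference_term Scheme_II K M N G \<alpha> + noise_term Scheme_II K N D G \<sigma> \<alpha>) * L"

end

theory Submission
  imports Defs
begin

text \<open>Let \<open>s\<^sub>n\<close> be the weighted sum of the device channels at the reflecting element \<open>n\<close> and \<open>u\<^sub>n\<close> its
  phase. Each gain is a sum over \<open>n\<close> of \<open>|h\<^sub>p\<^sub>n| Re (cnj u\<^sub>n h\<^sub>r\<^sub>i\<^sub>n)\<close>. The part of \<open>h\<^sub>r\<^sub>i\<^sub>n\<close> that is left after
  subtracting its multiple of \<open>s\<^sub>n\<close> is Gaussian and independent of \<open>s\<^sub>n\<close>, so the first two moments of the
  gains are explicit: the gradient estimate is unbiased, and its second moment is at most
  \<open>c E|grad F|\<^sup>2 + b\<close> with \<open>L b = \<epsilon>\<close>. The factor \<open>c L\<close> can exceed \<open>varpi\<close> (when \<open>\<xi> > 1\<close>), but it is at most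
  \<open>7/5 varpi\<close>. As \<open>7/5 < sqrt 2\<close>, the descent lemma with the step size \<open>1 / (varpi sqrt T)\<close> gives the
  rate for \<open>T \<ge> 2\<close>; for \<open>T = 1\<close> the rate follows from \<open>|grad F w|\<^sup>2 \<le> 2 L (F w - F wstar)\<close>.\<close>

section \<open>Smooth functions\<close>

text \<open>The factor is \<open>c = s + a \<xi>^2\<close> with
  \<open>s = 1 - (pi^2 - 8) / (pi^2 N)\<close> and \<open>a = 8 A / (pi^2 N)\<close>, where
  \<open>A \<ge> 1\<close> measures how unequal the steering weights are. Hence
  \<open>c - varpi / L = (pi^2 - 8) (\<xi>^2 - 1) / (pi^2 N)\<close>: the scaling factor multiplies
  the negative correction by \<xi>^2, although it belongs to the averaged gradient alone. Descent
  only needs \<open>\<eta> c L \<le> 1\<close>, that is \<open>c L \<le> varpi sqrt T\<close>. The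
  ratio \<open>c L / varpi\<close> never exceeds \<open>8 / (16 - pi^2) < 1.31\<close>, and 7/5 is a
  convenient rational between this and sqrt 2. A second obstacle is conditioning: the mean of a
  stochastic gradient is prescribed given the current model only, whereas the squared estimate pairs
  gradients of different devices. Independence of each mini-batch from all other sources extends the
  mean to these products. The gains of one round are mutually dependent, since they share the server
  channel and the phases; only their second-moment matrix is used, and it is found by comparing
  partial sums of the weighted channels.\<close>

lemma grad_eqI: "GDERIV f w :> g \<Longrightarrow> grad f w = g"
proof -
  assume g: "GDERIV f w :> g"
  have "g' = g" if "GDERIV f w :> g'" for g'
  proof -
    have "(\<lambda>h. h \<bullet> g') = (\<lambda>h. h \<bullet> g)"
      using that g unfolding gderiv_def by (rule has_derivative_unique)
    then show ?thesis by (metis vector_eq_ldot inner_commute)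
  qed
  then show ?thesis unfolding grad_def using g by blast
qed

lemma GDERIV_grad:
  assumes "f differentiable (at w)"
  shows "GDERIV f w :> grad f w"
proof -
  obtain f' where f': "(f has_derivative f') (at w)"
    using assms by (auto simp: differentiable_def)
  then have lin: "linear f'" by (rule has_derivative_linear)
  \<comment> \<open>The Riesz representative of the linear map \<open>f'\<close>.\<close>
  define g where "g = (\<Sum>b\<in>Basis. f' b *\<^sub>R b)"
  have "f' h = h \<bullet> g" for h
    unfolding g_def inner_sum_right
    by (subst euclidean_representation[of h, symmetric])
       (simp add: linear_sum[OF lin] linear_cmul[OF lin] mult.commute del: euclidean_representation)
  then have "f' = (\<lambda>h. h \<bullet> g)" by auto
  then have "GDERIV f w :> g"
    using f' by (simp only: gderiv_def)
  then show ?thesis using grad_eqI by metis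
qed

text \<open>Subtract the quadratic majorant from \<open>F\<close> along the segment from
  \<open>x\<close> to \<open>y\<close>. At parameter \<open>t\<close> the gradient has moved by at
  most \<open>L * t * norm d\<close>, which is exactly what the derivative of the quadratic term
  compensates, so the difference is nonincreasing.\<close>

lemma descent_lemma:
  assumes diff: "\<And>v. F differentiable (at v)" and lip: "L-lipschitz_on UNIV (grad F)"
  shows "F y \<le> F x + grad F x \<bullet> (y - x) + L / 2 * (norm (y - x))\<^sup>2"
proof -
  define d where "d = y - x"
  define \<phi> where "\<phi> t = F (x + t *\<^sub>R d) - t * (grad F x \<bullet> d) - L / 2 * t\<^sup>2 * (norm d)\<^sup>2" for t
  have der: "(\<phi> has_real_derivative (grad F (x + t *\<^sub>R d) \<bullet> d - grad F x \<bullet> d - L * t * (norm d)\<^sup>2)) (at t)" for t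
  proof -
    have "(F has_derivative (\<lambda>h. h \<bullet> grad F (x + t *\<^sub>R d))) (at (x + t *\<^sub>R d))"
      using GDERIV_grad[OF diff] by (simp add: gderiv_def)
    moreover have "((\<lambda>t. x + t *\<^sub>R d) has_derivative (\<lambda>h. h *\<^sub>R d)) (at t)"
      by (auto intro!: derivative_eq_intros)
    ultimately have "((\<lambda>t. F (x + t *\<^sub>R d)) has_derivative (\<lambda>h. (h *\<^sub>R d) \<bullet> grad F (x + t *\<^sub>R d))) (at t)"
      using has_derivative_compose by fastforce
    then have "((\<lambda>t. F (x + t *\<^sub>R d)) has_real_derivative (grad F (x + t *\<^sub>R d) \<bullet> d)) (at t)"
      unfolding has_field_derivative_def by (rule has_derivative_eq_rhs) (auto simp: inner_commute)
    then show ?thesis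
      unfolding \<phi>_def by (auto intro!: derivative_eq_intros simp: algebra_simps)
  qed
  have "\<phi> 1 \<le> \<phi> 0"
  proof (rule DERIV_nonpos_imp_nonincreasing[of 0 1 \<phi>])
    fix t :: real assume t: "0 \<le> t" "t \<le> 1"
    have "grad F (x + t *\<^sub>R d) \<bullet> d - grad F x \<bullet> d \<le> norm (grad F (x + t *\<^sub>R d) - grad F x) * norm d"
      by (metis inner_diff_left norm_cauchy_schwarz)
    also have "\<dots> \<le> (L * (t * norm d)) * norm d"
      using lipschitz_onD[OF lip, of "x + t *\<^sub>R d" x] t
      by (intro mult_right_mono) (auto simp: dist_norm)
    finally show "\<exists>z. DERIV \<phi> t :> z \<and> z \<le> 0"
      using der[of t] by (intro exI[of _ "grad F (x + t *\<^sub>R d) \<bullet> d - grad F x \<bullet> d - L * t * (norm d)\<^sup>2"])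
        (auto simp: power2_eq_square algebra_simps)
  qed simp
  then show ?thesis by (simp add: \<phi>_def d_def)
qed

text \<open>Differentiability alone does not make the gradient continuous, but each directional
  derivative is a pointwise limit of continuous difference quotients. This matters for the sample
  losses, whose gradients form the mini-batch gradients.\<close>

lemma borel_measurable_grad:
  assumes diff: "\<And>v. f differentiable (at v)"
  shows "grad f \<in> borel_measurable borel"
proof -
  have cont: "continuous_on UNIV f"
    by (intro continuous_at_imp_continuous_on ballI differentiable_imp_continuous_within diff)
  have "(\<lambda>v. grad f v \<bullet> b) \<in> borel_measurable borel" for b
  proof (rule borel_measurable_LIMSEQ_real)
    fix v
    have "(f has_derivative (\<lambda>h. h \<bullet> grad f v)) (at v)"
      using GDERIV_grad[OF diff] by (simp add: gderiv_def)
    moreover have "((\<lambda>t. v + t *\<^sub>R b) has_derivative (\<lambda>h. h *\<^sub>R b)) (at 0)"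
      by (auto intro!: derivative_eq_intros)
    ultimately have "((\<lambda>t. f (v + t *\<^sub>R b)) has_derivative (\<lambda>h. (h *\<^sub>R b) \<bullet> grad f v)) (at 0)"
      using has_derivative_compose[of "\<lambda>t. v + t *\<^sub>R b" "\<lambda>h. h *\<^sub>R b" 0 UNIV f "\<lambda>h. h \<bullet> grad f v"]
      by fastforce
    then have "((\<lambda>t. f (v + t *\<^sub>R b)) has_real_derivative (grad f v \<bullet> b)) (at 0)"
      unfolding has_field_derivative_def by (rule has_derivative_eq_rhs) (auto simp: inner_commute)
    then have "((\<lambda>h. (f (v + h *\<^sub>R b) - f v) / h) \<longlongrightarrow> grad f v \<bullet> b) (at 0)"
      by (simp add: DERIV_def)
    moreover have "filterlim (\<lambda>i. 1 / real (Suc i)) (at 0) sequentially"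
      by (intro filterlim_atI) (use LIMSEQ_Suc[OF lim_1_over_n] in auto)
    ultimately show "(\<lambda>i. (f (v + (1 / real (Suc i)) *\<^sub>R b) - f v) / (1 / real (Suc i)))
        \<longlonglongrightarrow> grad f v \<bullet> b"
      by (rule filterlim_compose)
  next
    fix i
    show "(\<lambda>v. (f (v + (1 / real (Suc i)) *\<^sub>R b) - f v) / (1 / real (Suc i))) \<in> borel_measurable borel"
      using cont
      by (intro borel_measurable_continuous_onI continuous_intros continuous_on_compose2[OF cont]) auto
  qed
  then show ?thesis by (subst borel_measurable_euclidean_space) auto
qed

section \<open>Independence of generated algebras\<close>

text \<open>Serves only as a measurable space: measurability with respect to it says that a random
  variable depends on the sources in \<open>J\<close> and on nothing else.\<close>

definition joint_algebra :: "'w measure \<Rightarrow> ('i \<Rightarrow> 'w set set) \<Rightarrow> 'i set \<Rightarrow> 'w measure" where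
  "joint_algebra M E J = sigma (space M) (\<Union>j\<in>J. E j)"

definition rv_events :: "'w measure \<Rightarrow> ('i \<Rightarrow> 'w \<Rightarrow> 'a::topological_space) \<Rightarrow> 'i \<Rightarrow> 'w set set" where
  "rv_events M X j = {X j -` A \<inter> space M | A. A \<in> sets borel}"

lemma space_joint_algebra [simp]: "space (joint_algebra M E J) = space M"
  by (simp add: joint_algebra_def space_measure_of_conv)

lemma sets_joint_algebra:
  "(\<And>j. j \<in> J \<Longrightarrow> E j \<subseteq> Pow (space M)) \<Longrightarrow>
    sets (joint_algebra M E J) = sigma_sets (space M) (\<Union>j\<in>J. E j)"
  unfolding joint_algebra_def by (intro sets_measure_of) auto

lemma Int_stable_rv_events:
  fixes X :: "'i \<Rightarrow> 'w \<Rightarrow> 'z::topological_space"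
  shows "Int_stable (rv_events M X j)"
  unfolding Int_stable_def rv_events_def
proof clarify
  fix A B :: "'z set" assume "A \<in> sets borel" "B \<in> sets borel"
  then have "A \<inter> B \<in> sets borel" by (rule sets.Int)
  moreover have "X j -` A \<inter> space M \<inter> (X j -` B \<inter> space M) = X j -` (A \<inter> B) \<inter> space M" by auto
  ultimately show "\<exists>C. X j -` A \<inter> space M \<inter> (X j -` B \<inter> space M) = X j -` C \<inter> space M \<and> C \<in> sets borel"
    by blast
qed

lemma measurable_joint_algebra_mono:
  assumes "X \<in> measurable (joint_algebra M E J) N" "J \<subseteq> J'" "\<And>j. j \<in> J' \<Longrightarrow> E j \<subseteq> Pow (space M)"
  shows "X \<in> measurable (joint_algebra M E J') N"
proof -
  have "sets (joint_algebra M E J) \<subseteq> sets (joint_algebra M E J')"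
  proof -
    have "sets (joint_algebra M E J) = sigma_sets (space M) (\<Union>j\<in>J. E j)"
      using assms(2,3) by (intro sets_joint_algebra) blast
    moreover have "sets (joint_algebra M E J') = sigma_sets (space M) (\<Union>j\<in>J'. E j)"
      using assms(3) by (rule sets_joint_algebra)
    ultimately show ?thesis
      using assms(2) by (simp add: sigma_sets_mono' UN_mono)
  qed
  then show ?thesis
    using measurable_sets[OF assms(1)] measurable_space[OF assms(1)]
    by (intro measurableI) auto
qed

lemma measurable_joint_algebraI:
  assumes "j \<in> J" "\<And>j. j \<in> J \<Longrightarrow> E j \<subseteq> Pow (space M)"
    "\<And>A. A \<in> sets N \<Longrightarrow> X -` A \<inter> space M \<in> E j" "X \<in> space M \<rightarrow> space N"
  shows "X \<in> measurable (joint_algebra M E J) N"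
proof (rule measurableI)
  fix A assume "A \<in> sets N"
  then show "X -` A \<inter> space (joint_algebra M E J) \<in> sets (joint_algebra M E J)"
    using assms by (subst sets_joint_algebra) (auto intro!: sigma_sets.Basic)
qed (use assms in auto)

lemma measurable_rv_joint_algebra:
  "j \<in> J \<Longrightarrow> X j \<in> borel_measurable (joint_algebra M (rv_events M X) J)"
  by (intro measurable_joint_algebraI[of j]) (auto simp: rv_events_def)

section \<open>Independence of variables that depend on disjoint groups of sources\<close>

context prob_space begin

lemma sets_joint_algebra_indep:
  assumes "indep_sets E I" "J \<subseteq> I"
  shows "sets (joint_algebra M E J) = sigma_sets (space M) (\<Union>j\<in>J. E j)"
    and "sets (joint_algebra M E J) \<subseteq> events"
proof -
  have ev: "(\<Union>j\<in>J. E j) \<subseteq> events"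
    using assms by (auto simp: indep_sets_def)
  then show eq: "sets (joint_algebra M E J) = sigma_sets (space M) (\<Union>j\<in>J. E j)"
    using sets.space_closed by (intro sets_joint_algebra) blast
  show "sets (joint_algebra M E J) \<subseteq> events"
    unfolding eq using ev by (rule sets.sigma_sets_subset)
qed

lemma indep_sets_joint_algebra:
  assumes ind: "indep_sets E I" and st: "\<And>i. i \<in> I \<Longrightarrow> Int_stable (E i)"
    and J: "\<And>l. l \<in> L \<Longrightarrow> J l \<subseteq> I" "disjoint_family_on J L"
  shows "indep_sets (\<lambda>l. sets (joint_algebra M E (J l))) L"
proof -
  have "indep_sets (\<lambda>l. sigma_sets (space M) (\<Union>i\<in>J l. E i)) L"
    using J by (intro indep_sets_collect_sigma indep_sets_mono_index[OF _ ind] st) auto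
  then show ?thesis
    by (rule indep_sets_mono_sets) (simp add: sets_joint_algebra_indep[OF ind J(1)])
qed

lemma rv_joint_algebra:
  assumes "indep_sets E I" "J \<subseteq> I" "X \<in> measurable (joint_algebra M E J) N"
  shows "random_variable N X"
  using sets_joint_algebra_indep(2)[OF assms(1,2)] measurable_sets[OF assms(3)] measurable_space[OF assms(3)]
  by (intro measurableI) auto

lemma indep_vars_joint_algebra:
  assumes ind: "indep_sets E I" and st: "\<And>i. i \<in> I \<Longrightarrow> Int_stable (E i)"
    and J: "\<And>l. l \<in> L \<Longrightarrow> J l \<subseteq> I" "disjoint_family_on J L"
    and X: "\<And>l. l \<in> L \<Longrightarrow> X l \<in> measurable (joint_algebra M E (J l)) (N l)"
  shows "indep_vars N X L"
  unfolding indep_vars_def2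
proof (intro conjI ballI indep_sets_mono_sets[OF indep_sets_joint_algebra[OF ind st J]])
  show "random_variable (N l) (X l)" if "l \<in> L" for l
    using rv_joint_algebra[OF ind J(1) X] that by blast
  show "{X l -` A \<inter> space M |A. A \<in> sets (N l)} \<subseteq> sets (joint_algebra M E (J l))" if "l \<in> L" for l
    using measurable_sets[OF X[OF that]] by auto
qed

text \<open>The form in which independence is used throughout: it suffices to name two disjoint
  groups of sources that determine \<open>X\<close> and \<open>Y\<close>.\<close>

lemma indep_var_joint_algebra:
  assumes "indep_sets E I" "\<And>i. i \<in> I \<Longrightarrow> Int_stable (E i)" "J1 \<union> J2 \<subseteq> I" "J1 \<inter> J2 = {}"
    and "X \<in> measurable (joint_algebra M E J1) N1" "Y \<in> measurable (joint_algebra M E J2) N2"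
  shows "indep_var N1 X N2 Y"
  unfolding indep_var_def
  by (rule indep_vars_joint_algebra[OF assms(1,2), of _ "case_bool J1 J2"])
    (use assms(3-) in \<open>auto simp: disjoint_family_on_def split: bool.splits\<close>)

text \<open>Two-level independence. A finite set of index pairs is cut into rows; outer independence
  splits the probability over the rows, inner independence splits each row. It serves to pass from
  independent vectors with independent coordinates to one independent family of all
  coordinates.\<close>

lemma indep_sets_Sigma:
  assumes outer: "indep_sets E I" and st: "\<And>i. i \<in> I \<Longrightarrow> Int_stable (E i)"
    and inner: "\<And>i. i \<in> I \<Longrightarrow> indep_sets (G i) (J i)"
    and sub: "\<And>i j. i \<in> I \<Longrightarrow> j \<in> J i \<Longrightarrow> G i j \<subseteq> E i"
  shows "indep_sets (\<lambda>(i, j). G i j) (Sigma I J)"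
proof (rule indep_setsI)
  fix p assume "p \<in> Sigma I J"
  then show "(case p of (i, j) \<Rightarrow> G i j) \<subseteq> events"
    using inner by (auto simp: indep_sets_def)
next
  fix A H assume H: "H \<noteq> {}" "H \<subseteq> Sigma I J" "finite H" and A: "\<forall>p\<in>H. A p \<in> (case p of (i, j) \<Rightarrow> G i j)"
  define I' where "I' = fst ` H"
  define C where "C i = (\<Inter>j\<in>H``{i}. A (i, j))" for i
  have fin: "finite I'" "\<And>i. finite (H``{i})" and ne: "I' \<noteq> {}" "\<And>i. i \<in> I' \<Longrightarrow> H``{i} \<noteq> {}"
    and sI: "I' \<subseteq> I" and sJ: "\<And>i. H``{i} \<subseteq> J i"
    using H by (auto simp: I'_def finite_Image)
  have HS: "H = Sigma I' (\<lambda>i. H``{i})"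
  proof (intro set_eqI)
    fix p show "p \<in> H \<longleftrightarrow> p \<in> Sigma I' (\<lambda>i. H``{i})"
      by (cases p) (auto simp: I'_def image_iff intro: bexI[of _ p])
  qed
  \<comment> \<open>The intersection along a row must again be an event of \<open>E i\<close> before
    outer independence applies; this is where Int-stability enters.\<close>
  have cl: "(\<Inter>j\<in>D. A (i, j)) \<in> E i" if "finite D" "D \<noteq> {}" "D \<subseteq> H``{i}" for i D
    using that
  proof (induction D rule: finite_ne_induct)
    case (singleton j)
    then have "(i, j) \<in> H" by auto
    then have "A (i, j) \<in> G i j" "i \<in> I" "j \<in> J i" using A H(2) by auto
    then show ?case using sub[of i j] by auto
  next
    case (insert j D)
    from insert have "(i, j) \<in> H" by auto
    then have "A (i, j) \<in> G i j" "i \<in> I" "j \<in> J i" using A H(2) by auto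
    then have "A (i, j) \<in> E i" "i \<in> I" using sub[of i j] by auto
    then show ?case using insert st[of i] by (auto simp: Int_stable_def)
  qed
  have "(\<Inter>p\<in>H. A p) = (\<Inter>i\<in>I'. C i)"
    unfolding C_def by (subst HS) (auto simp: I'_def)
  then have "prob (\<Inter>p\<in>H. A p) = (\<Prod>i\<in>I'. prob (C i))"
    using indep_setsD[OF outer sI ne(1) fin(1), of C] cl[OF fin(2) ne(2)] by (auto simp: C_def)
  also have "\<dots> = (\<Prod>i\<in>I'. \<Prod>j\<in>H``{i}. prob (A (i, j)))"
  proof (rule prod.cong[OF refl])
    fix i assume i: "i \<in> I'"
    show "prob (C i) = (\<Prod>j\<in>H``{i}. prob (A (i, j)))"
      unfolding C_def
      using indep_setsD[OF inner sJ ne(2)[OF i] fin(2), of "\<lambda>j. A (i, j)"] i sI A by auto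
  qed
  also have "\<dots> = (\<Prod>p\<in>H. prob (A p))"
    by (subst HS) (use fin in \<open>simp add: prod.Sigma\<close>)
  finally show "prob (\<Inter>p\<in>H. A p) = (\<Prod>p\<in>H. prob (A p))" .
qed

end

section \<open>Gaussian pairs and the Rayleigh mean\<close>

text \<open>\<open>\<rho>\<close> is the regression coefficient of \<open>X\<close> on
  \<open>X + R\<close>. At \<open>x = v + \<rho> * s\<close>, \<open>r = s - x\<close> the joint
  density of \<open>(X, R)\<close> factors into the density of the residual, of variance
  \<open>a^2 b^2 / (a^2 + b^2)\<close>, and that of the sum.\<close>

lemma normal_density_shear:
  fixes a b v s :: real
  assumes "0 < a" "0 < b"
  defines "\<rho> \<equiv> a\<^sup>2 / (a\<^sup>2 + b\<^sup>2)"
  shows "normal_density 0 a (v + \<rho> * s) * normal_density 0 b (s - (v + \<rho> * s)) =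
    normal_density 0 (a * b / sqrt (a\<^sup>2 + b\<^sup>2)) v * normal_density 0 (sqrt (a\<^sup>2 + b\<^sup>2)) s"
proof -
  define q where "q = a\<^sup>2 + b\<^sup>2"
  have q: "q > 0" using assms by (simp add: q_def add_pos_pos)
  have "- (v + \<rho> * s)\<^sup>2 / (2 * a\<^sup>2) + - (s - (v + \<rho> * s))\<^sup>2 / (2 * b\<^sup>2) = - v\<^sup>2 * q / (2 * a\<^sup>2 * b\<^sup>2) + - s\<^sup>2 / (2 * q)"
  proof -
    have \<rho>: "\<rho> = a\<^sup>2 / q" by (simp add: \<rho>_def q_def)
    have b2: "b\<^sup>2 = q - a\<^sup>2" by (simp add: q_def)
    have "b\<^sup>2 * (v + \<rho> * s)\<^sup>2 + a\<^sup>2 * (s - (v + \<rho> * s))\<^sup>2 = v\<^sup>2 * q + s\<^sup>2 * a\<^sup>2 * b\<^sup>2 / q"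
      using q unfolding \<rho> b2 by (simp add: field_simps power2_eq_square)
    then have "(b\<^sup>2 * (v + \<rho> * s)\<^sup>2 + a\<^sup>2 * (s - (v + \<rho> * s))\<^sup>2) / (2 * a\<^sup>2 * b\<^sup>2)
        = (v\<^sup>2 * q + s\<^sup>2 * a\<^sup>2 * b\<^sup>2 / q) / (2 * a\<^sup>2 * b\<^sup>2)" by simp
    moreover have "(b\<^sup>2 * (v + \<rho> * s)\<^sup>2 + a\<^sup>2 * (s - (v + \<rho> * s))\<^sup>2) / (2 * a\<^sup>2 * b\<^sup>2)
        = (v + \<rho> * s)\<^sup>2 / (2 * a\<^sup>2) + (s - (v + \<rho> * s))\<^sup>2 / (2 * b\<^sup>2)"
      using assms(1,2) by (simp add: field_simps)
    moreover have "(v\<^sup>2 * q + s\<^sup>2 * a\<^sup>2 * b\<^sup>2 / q) / (2 * a\<^sup>2 * b\<^sup>2) = v\<^sup>2 * q / (2 * a\<^sup>2 * b\<^sup>2) + s\<^sup>2 / (2 * q)"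
      using assms(1,2) q by (simp add: field_simps)
    ultimately show ?thesis by simp
  qed
  moreover have "sqrt (2 * pi * a\<^sup>2) * sqrt (2 * pi * b\<^sup>2) = sqrt (2 * pi * (a * b / sqrt q)\<^sup>2) * sqrt (2 * pi * q)"
    using q by (simp add: real_sqrt_mult[symmetric] power_divide power_mult_distrib)
  ultimately show ?thesis
    using q assms(1,2) unfolding normal_density_def q_def[symmetric]
    by (simp add: exp_add[symmetric] power_divide power_mult_distrib field_simps)
qed

context prob_space begin

text \<open>Both marginals and the independence are read off from one identity: the joint law of
  residual and sum is a product measure.\<close>

lemma normal_shear:
  fixes a b :: real
  assumes ab: "0 < a" "0 < b" and ind: "indep_var borel X borel R"
    and X: "distributed M lborel X (normal_density 0 a)" and R: "distributed M lborel R (normal_density 0 b)"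
  defines "\<rho> \<equiv> a\<^sup>2 / (a\<^sup>2 + b\<^sup>2)" and "\<sigma> \<equiv> sqrt (a\<^sup>2 + b\<^sup>2)" and "\<tau> \<equiv> a * b / sqrt (a\<^sup>2 + b\<^sup>2)"
  shows "indep_var borel (\<lambda>\<omega>. X \<omega> - \<rho> * (X \<omega> + R \<omega>)) borel (\<lambda>\<omega>. X \<omega> + R \<omega>)"
    and "distributed M lborel (\<lambda>\<omega>. X \<omega> - \<rho> * (X \<omega> + R \<omega>)) (normal_density 0 \<tau>)"
    and "distributed M lborel (\<lambda>\<omega>. X \<omega> + R \<omega>) (normal_density 0 \<sigma>)"
proof -
  let ?V = "\<lambda>\<omega>. X \<omega> - \<rho> * (X \<omega> + R \<omega>)" and ?S = "\<lambda>\<omega>. X \<omega> + R \<omega>"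
  have [measurable]: "X \<in> borel_measurable M" "R \<in> borel_measurable M"
    using ind by (auto dest: indep_var_rv1 indep_var_rv2)
  have pos: "\<sigma> > 0" "\<tau> > 0" using ab by (auto simp: \<sigma>_def \<tau>_def add_pos_pos)
  let ?f = "\<lambda>c x. ennreal (normal_density 0 c x)"
  interpret V: prob_space "density lborel (?f \<tau>)" using pos by (intro prob_space_normal_density)
  interpret S: prob_space "density lborel (?f \<sigma>)" using pos by (intro prob_space_normal_density)
  have "indep_var lborel X lborel R"
    using ind by (simp add: indep_var_def indep_vars_def2 UNIV_bool all_bool_eq)
      (auto elim!: indep_sets_mono_sets split: bool.splits)
  then have XR: "distributed M (lborel \<Otimes>\<^sub>M lborel) (\<lambda>\<omega>. (X \<omega>, R \<omega>)) (\<lambda>(x, r). ?f a x * ?f b r)"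
    using X R by (intro distributed_joint_indep sigma_finite_lborel) auto
  have joint: "distr M (borel \<Otimes>\<^sub>M borel) (\<lambda>\<omega>. (?V \<omega>, ?S \<omega>)) = density lborel (?f \<tau>) \<Otimes>\<^sub>M density lborel (?f \<sigma>)"
  proof (rule measure_eqI)
    show "sets (distr M (borel \<Otimes>\<^sub>M borel) (\<lambda>\<omega>. (?V \<omega>, ?S \<omega>))) = sets (density lborel (?f \<tau>) \<Otimes>\<^sub>M density lborel (?f \<sigma>))"
      by (simp cong: sets_pair_measure_cong)
  next
    fix A assume "A \<in> sets (distr M (borel \<Otimes>\<^sub>M borel) (\<lambda>\<omega>. (?V \<omega>, ?S \<omega>)))"
    then have A[measurable]: "A \<in> sets (borel \<Otimes>\<^sub>M (borel :: real measure))" by simp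
    let ?I = "\<lambda>v s. indicator A (v, s) :: ennreal"
    have "emeasure (distr M (borel \<Otimes>\<^sub>M borel) (\<lambda>\<omega>. (?V \<omega>, ?S \<omega>))) A = (\<integral>\<^sup>+\<omega>. ?I (?V \<omega>) (?S \<omega>) \<partial>M)"
      by (subst nn_integral_indicator[symmetric], simp, subst nn_integral_distr) auto
    also have "\<dots> = (\<integral>\<^sup>+p. (case p of (x, r) \<Rightarrow> ?f a x * ?f b r) * (case p of (x, r) \<Rightarrow> ?I (x - \<rho> * (x + r)) (x + r))
        \<partial>(lborel \<Otimes>\<^sub>M lborel))"
      by (subst distributed_nn_integral[OF XR]) auto
    also have "\<dots> = (\<integral>\<^sup>+x. \<integral>\<^sup>+r. ?f a x * ?f b r * ?I (x - \<rho> * (x + r)) (x + r) \<partial>lborel \<partial>lborel)"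
      by (subst lborel.nn_integral_fst[symmetric]) auto
    \<comment> \<open>The change of variables is done by two translations: \<open>r = s - x\<close>
      for fixed \<open>x\<close>, then, after exchanging the integrals,
      \<open>x = v + \<rho> * s\<close> for fixed \<open>s\<close>. Each has unit scale, so no extra
      factor arises.\<close>
    also have "\<dots> = (\<integral>\<^sup>+x. \<integral>\<^sup>+s. ?f a x * ?f b (s - x) * ?I (x - \<rho> * s) s \<partial>lborel \<partial>lborel)"
    proof (rule nn_integral_cong)
      fix x :: real
      show "(\<integral>\<^sup>+r. ?f a x * ?f b r * ?I (x - \<rho> * (x + r)) (x + r) \<partial>lborel)
        = (\<integral>\<^sup>+s. ?f a x * ?f b (s - x) * ?I (x - \<rho> * s) s \<partial>lborel)"
        by (subst nn_integral_real_affine[where c=1 and t="-x"]) auto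
    qed
    also have "\<dots> = (\<integral>\<^sup>+s. \<integral>\<^sup>+x. ?f a x * ?f b (s - x) * ?I (x - \<rho> * s) s \<partial>lborel \<partial>lborel)"
      by (subst lborel_pair.Fubini') auto
    also have "\<dots> = (\<integral>\<^sup>+s. \<integral>\<^sup>+v. ?f a (v + \<rho> * s) * ?f b (s - (v + \<rho> * s)) * ?I v s \<partial>lborel \<partial>lborel)"
    proof (rule nn_integral_cong)
      fix s :: real
      show "(\<integral>\<^sup>+x. ?f a x * ?f b (s - x) * ?I (x - \<rho> * s) s \<partial>lborel)
        = (\<integral>\<^sup>+v. ?f a (v + \<rho> * s) * ?f b (s - (v + \<rho> * s)) * ?I v s \<partial>lborel)"
        by (subst nn_integral_real_affine[where c=1 and t="\<rho> * s"]) (auto simp: add.commute)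
    qed
    also have "\<dots> = (\<integral>\<^sup>+s. \<integral>\<^sup>+v. ?f \<tau> v * ?f \<sigma> s * ?I v s \<partial>lborel \<partial>lborel)"
      using normal_density_shear[OF ab]
      by (simp add: \<rho>_def \<sigma>_def \<tau>_def ennreal_mult[symmetric])
    also have "\<dots> = (\<integral>\<^sup>+v. \<integral>\<^sup>+s. ?f \<tau> v * ?f \<sigma> s * ?I v s \<partial>lborel \<partial>lborel)"
      by (subst lborel_pair.Fubini') auto
    also have "\<dots> = (\<integral>\<^sup>+v. ?f \<tau> v * (\<integral>\<^sup>+s. ?f \<sigma> s * ?I v s \<partial>lborel) \<partial>lborel)"
      by (simp add: nn_integral_cmult[symmetric] mult.assoc)
    also have "\<dots> = (\<integral>\<^sup>+v. (\<integral>\<^sup>+s. ?I v s \<partial>density lborel (?f \<sigma>)) \<partial>density lborel (?f \<tau>))"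
      by (simp add: nn_integral_density)
    also have "\<dots> = emeasure (density lborel (?f \<tau>) \<Otimes>\<^sub>M density lborel (?f \<sigma>)) A"
      by (subst S.emeasure_pair_measure) (simp_all cong: sets_pair_measure_cong)
    finally show "emeasure (distr M (borel \<Otimes>\<^sub>M borel) (\<lambda>\<omega>. (?V \<omega>, ?S \<omega>))) A
      = emeasure (density lborel (?f \<tau>) \<Otimes>\<^sub>M density lborel (?f \<sigma>)) A" .
  qed
  have "distr M borel ?V = distr (distr M (borel \<Otimes>\<^sub>M borel) (\<lambda>\<omega>. (?V \<omega>, ?S \<omega>))) borel fst"
    by (subst distr_distr) (auto simp: comp_def)
  also have "\<dots> = distr (density lborel (?f \<tau>) \<Otimes>\<^sub>M density lborel (?f \<sigma>)) (density lborel (?f \<tau>)) fst"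
    unfolding joint by (intro distr_cong) auto
  finally have V: "distr M borel ?V = density lborel (?f \<tau>)" by (simp add: S.distr_pair_fst)
  have "distr M borel ?S = distr (distr M (borel \<Otimes>\<^sub>M borel) (\<lambda>\<omega>. (?S \<omega>, ?V \<omega>))) borel fst"
    by (subst distr_distr) (auto simp: comp_def)
  also have "distr M (borel \<Otimes>\<^sub>M borel) (\<lambda>\<omega>. (?S \<omega>, ?V \<omega>))
      = distr (distr M (borel \<Otimes>\<^sub>M borel) (\<lambda>\<omega>. (?V \<omega>, ?S \<omega>))) (borel \<Otimes>\<^sub>M borel) (\<lambda>(x, y). (y, x))"
    by (subst distr_distr) (auto simp: comp_def)
  also have "\<dots> = distr (density lborel (?f \<tau>) \<Otimes>\<^sub>M density lborel (?f \<sigma>)) (density lborel (?f \<sigma>) \<Otimes>\<^sub>M density lborel (?f \<tau>)) (\<lambda>(x, y). (y, x))"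
    unfolding joint by (intro distr_cong) (auto cong: sets_pair_measure_cong)
  also have "\<dots> = density lborel (?f \<sigma>) \<Otimes>\<^sub>M density lborel (?f \<tau>)"
  proof -
    interpret P: pair_sigma_finite "density lborel (?f \<sigma>)" "density lborel (?f \<tau>)" ..
    show ?thesis by (rule P.distr_pair_swap[symmetric])
  qed
  also have "distr \<dots> borel fst = distr (density lborel (?f \<sigma>) \<Otimes>\<^sub>M density lborel (?f \<tau>)) (density lborel (?f \<sigma>)) fst"
    by (intro distr_cong) auto
  finally have S: "distr M borel ?S = density lborel (?f \<sigma>)" by (simp add: V.distr_pair_fst)
  show "indep_var borel ?V borel ?S"
    unfolding indep_var_distribution_eq V S joint by simp
  show "distributed M lborel ?V (?f \<tau>)" "distributed M lborel ?S (?f \<sigma>)"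
    unfolding distributed_def using V S by (auto cong: distr_cong)
qed

lemma normal_moments:
  assumes "0 < a" and X: "distributed M lborel X (normal_density 0 a)"
  shows "integrable M X" "expectation X = 0" "integrable M (\<lambda>\<omega>. (X \<omega>)\<^sup>2)" "expectation (\<lambda>\<omega>. (X \<omega>)\<^sup>2) = a\<^sup>2"
proof -
  show "integrable M X"
    using distributed_integrable[OF X, of "\<lambda>x. x"] integrable_normal_moment_nz_1[OF assms(1), of 0] by simp
  show e: "expectation X = 0" by (rule normal_distributed_expectation[OF assms])
  show "integrable M (\<lambda>\<omega>. (X \<omega>)\<^sup>2)"
    using distributed_integrable[OF X, of "\<lambda>x. x\<^sup>2"] integrable_normal_moment[OF assms(1), of 0 2] by simp
  show "expectation (\<lambda>\<omega>. (X \<omega>)\<^sup>2) = a\<^sup>2"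
    using normal_distributed_variance[OF assms] e by simp
qed

text \<open>For a fixed slope \<open>t\<close> the integral over \<open>x\<close> is a second moment
  of a centred normal of variance \<open>s^2 / (1 + t^2)\<close>; what remains is the Cauchy kernel
  in \<open>t\<close>, whose total integral is pi.\<close>

lemma rayleigh_mean:
  assumes s: "0 < s" and ind: "indep_var borel X borel Y"
    and X: "distributed M lborel X (normal_density 0 s)" and Y: "distributed M lborel Y (normal_density 0 s)"
  shows "expectation (\<lambda>\<omega>. sqrt ((X \<omega>)\<^sup>2 + (Y \<omega>)\<^sup>2)) = s * sqrt (pi / 2)"
proof -
  let ?f = "\<lambda>x. ennreal (normal_density 0 s x)"
  have [measurable]: "X \<in> borel_measurable M" "Y \<in> borel_measurable M"
    using ind by (auto dest: indep_var_rv1 indep_var_rv2)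
  have "indep_var lborel X lborel Y"
    using ind by (simp add: indep_var_def indep_vars_def2 UNIV_bool all_bool_eq)
      (auto elim!: indep_sets_mono_sets split: bool.splits)
  then have XY: "distributed M (lborel \<Otimes>\<^sub>M lborel) (\<lambda>\<omega>. (X \<omega>, Y \<omega>)) (\<lambda>(x, r). ?f x * ?f r)"
    using X Y by (intro distributed_joint_indep sigma_finite_lborel) auto
  have "(\<integral>\<^sup>+\<omega>. ennreal (sqrt ((X \<omega>)\<^sup>2 + (Y \<omega>)\<^sup>2)) \<partial>M)
     = (\<integral>\<^sup>+p. (case p of (x, y) \<Rightarrow> ?f x * ?f y) * (case p of (x, y) \<Rightarrow> ennreal (sqrt (x\<^sup>2 + y\<^sup>2))) \<partial>(lborel \<Otimes>\<^sub>M lborel))"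
    by (subst distributed_nn_integral[OF XY]) auto
  also have "\<dots> = (\<integral>\<^sup>+x. \<integral>\<^sup>+y. ?f x * ?f y * ennreal (sqrt (x\<^sup>2 + y\<^sup>2)) \<partial>lborel \<partial>lborel)"
    by (subst lborel.nn_integral_fst[symmetric]) auto
  \<comment> \<open>the substitution \<open>y = x t\<close> separates the radius from the slope\<close>
  also have "\<dots> = (\<integral>\<^sup>+x. \<integral>\<^sup>+t. ennreal (x\<^sup>2 * sqrt (1 + t\<^sup>2) * normal_density 0 s x * normal_density 0 s (x * t)) \<partial>lborel \<partial>lborel)"
  proof (rule nn_integral_cong_AE)
    have "AE x in lborel. (x::real) \<noteq> 0" by (rule AE_lborel_singleton)
    then show "AE x in lborel. (\<integral>\<^sup>+y. ?f x * ?f y * ennreal (sqrt (x\<^sup>2 + y\<^sup>2)) \<partial>lborel)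
      = (\<integral>\<^sup>+t. ennreal (x\<^sup>2 * sqrt (1 + t\<^sup>2) * normal_density 0 s x * normal_density 0 s (x * t)) \<partial>lborel)"
    proof eventually_elim
      fix x :: real assume x: "x \<noteq> 0"
      have sq: "sqrt (x\<^sup>2 + (x * t)\<^sup>2) = \<bar>x\<bar> * sqrt (1 + t\<^sup>2)" for t
        by (simp add: power_mult_distrib distrib_left[symmetric, of "x\<^sup>2" 1, simplified] real_sqrt_mult)
      have "(\<integral>\<^sup>+y. ?f x * ?f y * ennreal (sqrt (x\<^sup>2 + y\<^sup>2)) \<partial>lborel)
        = ennreal \<bar>x\<bar> * (\<integral>\<^sup>+t. ?f x * ?f (x * t) * ennreal (sqrt (x\<^sup>2 + (x * t)\<^sup>2)) \<partial>lborel)"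
        using x by (subst nn_integral_real_affine[where c=x and t=0]) auto
      also have "\<dots> = (\<integral>\<^sup>+t. ennreal \<bar>x\<bar> * (?f x * ?f (x * t) * ennreal (sqrt (x\<^sup>2 + (x * t)\<^sup>2))) \<partial>lborel)"
        by (rule nn_integral_cmult[symmetric]) auto
      also have "\<dots> = (\<integral>\<^sup>+t. ennreal (x\<^sup>2 * sqrt (1 + t\<^sup>2) * normal_density 0 s x * normal_density 0 s (x * t)) \<partial>lborel)"
        unfolding sq by (intro nn_integral_cong)
          (simp add: ennreal_mult[symmetric] power2_eq_square ac_simps, simp add: mult.assoc[symmetric])
      finally show "(\<integral>\<^sup>+y. ?f x * ?f y * ennreal (sqrt (x\<^sup>2 + y\<^sup>2)) \<partial>lborel) = \<dots>" .
    qed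
  qed
  also have "\<dots> = (\<integral>\<^sup>+t. \<integral>\<^sup>+x. ennreal (x\<^sup>2 * sqrt (1 + t\<^sup>2) * normal_density 0 s x * normal_density 0 s (x * t)) \<partial>lborel \<partial>lborel)"
    by (subst lborel_pair.Fubini') auto
  also have "\<dots> = (\<integral>\<^sup>+t. ennreal (s / sqrt (2 * pi) * inverse (1 + t\<^sup>2)) \<partial>lborel)"
  proof (rule nn_integral_cong)
    fix t :: real
    define q where "q = sqrt (1 + t\<^sup>2)"
    have q: "q > 0" "q\<^sup>2 = 1 + t\<^sup>2" by (auto simp: q_def add_pos_nonneg)
    \<comment> \<open>The standard deviation for which the exponents at \<open>x\<close> and at
      \<open>x * t\<close> add up to a single Gaussian exponent in \<open>x\<close>.\<close>
    define k where "k = s / q"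
    have k: "k > 0" using s q by (simp add: k_def)
    have eq: "x\<^sup>2 * q * normal_density 0 s x * normal_density 0 s (x * t) = q * k / (sqrt (2 * pi) * s\<^sup>2) * (normal_density 0 k x * x\<^sup>2)" for x
    proof -
      have "- x\<^sup>2 / (2 * s\<^sup>2) + - (x * t)\<^sup>2 / (2 * s\<^sup>2) = - x\<^sup>2 / (2 * k\<^sup>2)"
        using s q(1) by (simp add: k_def power_divide q(2) power_mult_distrib field_simps)
      then have e: "exp (- x\<^sup>2 / (2 * s\<^sup>2)) * exp (- (x * t)\<^sup>2 / (2 * s\<^sup>2)) = exp (- x\<^sup>2 / (2 * k\<^sup>2))"
        by (metis exp_add)
      have n1: "normal_density 0 s x * normal_density 0 s (x * t) = 1 / (2 * pi * s\<^sup>2) * exp (- x\<^sup>2 / (2 * k\<^sup>2))"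
        unfolding normal_density_def e[symmetric] by simp
      have n2: "normal_density 0 k x = 1 / (sqrt (2 * pi) * k) * exp (- x\<^sup>2 / (2 * k\<^sup>2))"
        using k by (simp add: normal_density_def real_sqrt_mult)
      \<comment> \<open>\<open>r\<close> stands for \<open>sqrt (2 * pi)\<close> and
        \<open>e\<close> for the exponential, which turns the comparison into a rational
        identity.\<close>
      have c: "x\<^sup>2 * q * (1 / (2 * pi * s\<^sup>2) * e) = q * k / (r * s\<^sup>2) * (1 / (r * k) * e * x\<^sup>2)"
        if "r > 0" "2 * pi = r * r" for r e
        unfolding that(2) using k s that(1) by (simp add: field_simps)
      have "x\<^sup>2 * q * normal_density 0 s x * normal_density 0 s (x * t) = x\<^sup>2 * q * (1 / (2 * pi * s\<^sup>2) * exp (- x\<^sup>2 / (2 * k\<^sup>2)))"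
        unfolding n1[symmetric] by simp
      also have "\<dots> = q * k / (sqrt (2 * pi) * s\<^sup>2) * (normal_density 0 k x * x\<^sup>2)"
        unfolding n2 by (rule c) simp_all
      finally show ?thesis .
    qed
    have hb: "has_bochner_integral lborel (\<lambda>x. normal_density 0 k x * x\<^sup>2) (k\<^sup>2)"
      using normal_moment_even[OF k, of 0 1] by (simp add: fact_2)
    have "(\<integral>\<^sup>+x. ennreal (x\<^sup>2 * q * normal_density 0 s x * normal_density 0 s (x * t)) \<partial>lborel)
      = ennreal (q * k / (sqrt (2 * pi) * s\<^sup>2)) * (\<integral>\<^sup>+x. ennreal (normal_density 0 k x * x\<^sup>2) \<partial>lborel)"
      unfolding eq using q(1) k by (subst nn_integral_cmult[symmetric]) (auto simp: ennreal_mult[symmetric])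
    also have "(\<integral>\<^sup>+x. ennreal (normal_density 0 k x * x\<^sup>2) \<partial>lborel) = ennreal (k\<^sup>2)"
      using hb by (subst nn_integral_eq_integral) (auto simp: has_bochner_integral_iff)
    also have "ennreal (q * k / (sqrt (2 * pi) * s\<^sup>2)) * ennreal (k\<^sup>2) = ennreal (s / sqrt (2 * pi) * inverse (1 + t\<^sup>2))"
      using q(1) k s unfolding q(2)[symmetric]
      by (subst ennreal_mult[symmetric]) (auto simp: k_def field_simps power2_eq_square)
    finally show "(\<integral>\<^sup>+x. ennreal (x\<^sup>2 * sqrt (1 + t\<^sup>2) * normal_density 0 s x * normal_density 0 s (x * t)) \<partial>lborel)
        = ennreal (s / sqrt (2 * pi) * inverse (1 + t\<^sup>2))" by (simp add: q_def)
  qed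
  also have "\<dots> = ennreal (s / sqrt (2 * pi) * pi)"
  proof -
    have "integrable lborel (\<lambda>t::real. inverse (1 + t\<^sup>2))" "(\<integral>t. inverse (1 + t\<^sup>2) \<partial>lborel) = pi"
      using integrable_inverse_1_plus_square LBINT_inverse_1_plus_square
      by (simp_all add: interval_lebesgue_integral_def set_lebesgue_integral_def set_integrable_def)
    then show ?thesis
      using s by (subst nn_integral_eq_integral) (auto simp: integrable_mult_right)
  qed
  also have "s / sqrt (2 * pi) * pi = s * sqrt (pi / 2)"
    by (simp add: real_sqrt_divide real_sqrt_mult real_div_sqrt field_simps)
  finally show ?thesis
    using s by (subst integral_eq_nn_integral) auto
qed


lemma indep_sets_rv_events: "indep_vars (\<lambda>_. borel) X I \<Longrightarrow> indep_sets (rv_events M X) I"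
  unfolding indep_vars_def2 by (auto elim!: indep_sets_mono_sets simp: rv_events_def)

section \<open>Square-integrable random variables and projections on random directions\<close>

lemma integrable_mult_square:
  fixes X Y :: "'a \<Rightarrow> real"
  assumes [measurable]: "X \<in> borel_measurable M" "Y \<in> borel_measurable M"
    and "integrable M (\<lambda>\<omega>. (X \<omega>)\<^sup>2)" "integrable M (\<lambda>\<omega>. (Y \<omega>)\<^sup>2)"
  shows "integrable M (\<lambda>\<omega>. X \<omega> * Y \<omega>)"
proof (rule Bochner_Integration.integrable_bound)
  show "integrable M (\<lambda>\<omega>. (X \<omega>)\<^sup>2 + (Y \<omega>)\<^sup>2)" using assms by simp
  have "\<bar>x * y\<bar> \<le> x\<^sup>2 + y\<^sup>2" for x y :: real
  proof -
    have "0 \<le> (\<bar>x\<bar> - \<bar>y\<bar>)\<^sup>2" by simp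
    then have "2 * (\<bar>x\<bar> * \<bar>y\<bar>) \<le> x\<^sup>2 + y\<^sup>2" by (simp add: power2_diff)
    moreover have "0 \<le> \<bar>x\<bar> * \<bar>y\<bar>" by simp
    ultimately show ?thesis unfolding abs_mult by linarith
  qed
  then show "AE \<omega> in M. norm (X \<omega> * Y \<omega>) \<le> norm ((X \<omega>)\<^sup>2 + (Y \<omega>)\<^sup>2)" by simp
qed simp

lemma integrable_square_imp:
  fixes X :: "'a \<Rightarrow> real"
  assumes "X \<in> borel_measurable M" "integrable M (\<lambda>x. (X x)\<^sup>2)"
  shows "integrable M X"
  using integrable_mult_square[of X "\<lambda>_. 1"] assms by simp

lemma integrable_square_add:
  fixes X Y :: "'a \<Rightarrow> real"
  assumes "X \<in> borel_measurable M" "Y \<in> borel_measurable M"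
    and "integrable M (\<lambda>x. (X x)\<^sup>2)" "integrable M (\<lambda>x. (Y x)\<^sup>2)"
  shows "integrable M (\<lambda>x. (X x + Y x)\<^sup>2)"
  using integrable_mult_square[OF assms] assms by (simp add: power2_sum mult.assoc)

lemma integrable_square_mult_bounded:
  fixes X U :: "'a \<Rightarrow> real"
  assumes [measurable]: "X \<in> borel_measurable M" "U \<in> borel_measurable M"
    and "integrable M (\<lambda>\<omega>. (X \<omega>)\<^sup>2)" "\<And>\<omega>. \<bar>U \<omega>\<bar> \<le> 1"
  shows "integrable M (\<lambda>\<omega>. (X \<omega> * U \<omega>)\<^sup>2)"
proof (rule Bochner_Integration.integrable_bound[OF assms(3)])
  have "(x * u)\<^sup>2 \<le> x\<^sup>2" if "\<bar>u\<bar> \<le> 1" for x u :: real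
    using that by (auto simp: power_mult_distrib abs_square_le_1 intro!: mult_left_le)
  then show "AE \<omega> in M. norm ((X \<omega> * U \<omega>)\<^sup>2) \<le> norm ((X \<omega>)\<^sup>2)" using assms(4) by simp
qed simp

lemma indep_zero_mean:
  fixes X Y :: "'a \<Rightarrow> real"
  assumes "indep_var borel X borel Y" "integrable M X" "integrable M Y" "expectation X = 0"
  shows "integrable M (\<lambda>x. X x * Y x)" "expectation (\<lambda>x. X x * Y x) = 0"
  using indep_var_integrable[OF assms(1-3)] indep_var_lebesgue_integral[OF assms(1-3)] assms(4) by auto

text \<open>Projecting two independent centred variables of equal variance \<open>v\<close> on a
  unit vector independent of them gives mean 0 and variance \<open>v\<close>: the mixed term
  vanishes, and the squares sum to \<open>v\<close> times the expected squared length of the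
  direction. Normality plays no part; the components of the direction may depend on each
  other.\<close>

lemma direction_moments:
  fixes V1 V2 U1 U2 :: "'a \<Rightarrow> real"
  assumes ind: "indep_sets E I" and st: "\<And>i. i \<in> I \<Longrightarrow> Int_stable (E i)"
    and J: "J1 \<union> (J2 \<union> J3) \<subseteq> I" "J1 \<inter> (J2 \<union> J3) = {}" "J2 \<inter> J3 = {}"
    and V1: "V1 \<in> borel_measurable (joint_algebra M E J1)" and V2: "V2 \<in> borel_measurable (joint_algebra M E J2)"
    and U: "U1 \<in> borel_measurable (joint_algebra M E J3)" "U2 \<in> borel_measurable (joint_algebra M E J3)"
    and unit: "\<And>x. (U1 x)\<^sup>2 + (U2 x)\<^sup>2 = 1"
    and mean: "expectation V1 = 0" "expectation V2 = 0"
    and sq: "integrable M (\<lambda>x. (V1 x)\<^sup>2)" "integrable M (\<lambda>x. (V2 x)\<^sup>2)"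
    and var: "expectation (\<lambda>x. (V1 x)\<^sup>2) = v" "expectation (\<lambda>x. (V2 x)\<^sup>2) = v"
  shows "integrable M (\<lambda>x. (V1 x * U1 x + V2 x * U2 x)\<^sup>2)"
    and "expectation (\<lambda>x. V1 x * U1 x + V2 x * U2 x) = 0"
    and "expectation (\<lambda>x. (V1 x * U1 x + V2 x * U2 x)\<^sup>2) = v"
proof -
  note rv = rv_joint_algebra[OF ind]
  have [measurable]: "V1 \<in> borel_measurable M" "V2 \<in> borel_measurable M" "U1 \<in> borel_measurable M" "U2 \<in> borel_measurable M"
    using J by (auto intro: rv[OF _ V1] rv[OF _ V2] rv[OF _ U(1)] rv[OF _ U(2)])
  have b: "\<bar>U1 x\<bar> \<le> 1" "\<bar>U2 x\<bar> \<le> 1" for x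
    using unit[of x] by (metis abs_square_le_1 le_add_same_cancel1 le_add_same_cancel2 zero_le_power2)+
  have iU: "integrable M U1" "integrable M U2" "integrable M (\<lambda>x. (U1 x)\<^sup>2)" "integrable M (\<lambda>x. (U2 x)\<^sup>2)"
    using b by (auto intro!: integrable_const_bound[where B=1] simp: abs_square_le_1)
  have iV: "integrable M V1" "integrable M V2"
    using sq by (auto intro: integrable_square_imp)
  have s1: "integrable M (\<lambda>x. (V1 x * U1 x)\<^sup>2)" and s2: "integrable M (\<lambda>x. (V2 x * U2 x)\<^sup>2)"
    using sq b by (auto intro!: integrable_square_mult_bounded)
  then show "integrable M (\<lambda>x. (V1 x * U1 x + V2 x * U2 x)\<^sup>2)"
    by (intro integrable_square_add) auto
  have pw: "E j \<subseteq> Pow (space M)" if "j \<in> I" for j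
    using ind that sets.space_closed by (auto simp: indep_sets_def)
  have pw23: "E j \<subseteq> Pow (space M)" if "j \<in> J2 \<union> J3" for j
    using J(1) pw that by blast
  have sub23: "J2 \<union> J3 \<subseteq> I" using J(1) by blast
  have in23: "Z \<in> borel_measurable (joint_algebra M E J3) \<Longrightarrow> Z \<in> borel_measurable (joint_algebra M E (J2 \<union> J3))" for Z :: "'a \<Rightarrow> real"
    using measurable_joint_algebra_mono[of Z M E J3 borel "J2 \<union> J3", OF _ _ pw23] by blast
  have ind1: "indep_var borel V1 borel Z" if "Z \<in> borel_measurable (joint_algebra M E (J2 \<union> J3))" for Z :: "'a \<Rightarrow> real"
    using J that by (intro indep_var_joint_algebra[OF ind st _ _ V1]) auto
  have ind2: "indep_var borel V2 borel Z" if "Z \<in> borel_measurable (joint_algebra M E J3)" for Z :: "'a \<Rightarrow> real"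
    using J that by (intro indep_var_joint_algebra[OF ind st _ _ V2]) auto
  have m1: "integrable M (\<lambda>x. V1 x * U1 x)" "expectation (\<lambda>x. V1 x * U1 x) = 0"
    using indep_zero_mean[OF ind1[OF in23[OF U(1)]] iV(1) iU(1) mean(1)] by auto
  have m2: "integrable M (\<lambda>x. V2 x * U2 x)" "expectation (\<lambda>x. V2 x * U2 x) = 0"
    using indep_zero_mean[OF ind2[OF U(2)] iV(2) iU(2) mean(2)] by auto
  show "expectation (\<lambda>x. V1 x * U1 x + V2 x * U2 x) = 0"
    using m1 m2 by simp
  \<comment> \<open>In the mixed term everything except \<open>V1\<close> is treated as one variable
    on the sources \<open>J2 \<union> J3\<close>, hence independent of the centred
    \<open>V1\<close>.\<close>
  have "(\<lambda>x. U1 x * (V2 x * U2 x)) \<in> borel_measurable (joint_algebra M E (J2 \<union> J3))"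
  proof -
    have "V2 \<in> borel_measurable (joint_algebra M E (J2 \<union> J3))"
      by (rule measurable_joint_algebra_mono[of V2 M E J2 borel "J2 \<union> J3", OF V2 _ pw23]) auto
    then show ?thesis
      using in23[OF U(1)] in23[OF U(2)] by measurable
  qed
  moreover have "integrable M (\<lambda>x. U1 x * (V2 x * U2 x))"
    using s2 iU by (intro integrable_mult_square) auto
  ultimately have cr: "integrable M (\<lambda>x. V1 x * (U1 x * (V2 x * U2 x)))"
     "expectation (\<lambda>x. V1 x * (U1 x * (V2 x * U2 x))) = 0"
    using indep_zero_mean[OF ind1 iV(1) _ mean(1)] by auto
  have q1: "integrable M (\<lambda>x. (V1 x)\<^sup>2 * (U1 x)\<^sup>2)"
     "expectation (\<lambda>x. (V1 x)\<^sup>2 * (U1 x)\<^sup>2) = v * expectation (\<lambda>x. (U1 x)\<^sup>2)"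
  proof -
    note in23[OF U(1), measurable] V1[measurable]
    have "indep_var borel (\<lambda>x. (V1 x)\<^sup>2) borel (\<lambda>x. (U1 x)\<^sup>2)"
      by (rule indep_var_joint_algebra[OF ind st J(1,2)]) measurable
    from indep_var_integrable[OF this] indep_var_lebesgue_integral[OF this]
    show "integrable M (\<lambda>x. (V1 x)\<^sup>2 * (U1 x)\<^sup>2)"
     "expectation (\<lambda>x. (V1 x)\<^sup>2 * (U1 x)\<^sup>2) = v * expectation (\<lambda>x. (U1 x)\<^sup>2)"
      using sq iU var by auto
  qed
  have q2: "integrable M (\<lambda>x. (V2 x)\<^sup>2 * (U2 x)\<^sup>2)"
     "expectation (\<lambda>x. (V2 x)\<^sup>2 * (U2 x)\<^sup>2) = v * expectation (\<lambda>x. (U2 x)\<^sup>2)"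
  proof -
    note U(2)[measurable] V2[measurable]
    have "indep_var borel (\<lambda>x. (V2 x)\<^sup>2) borel (\<lambda>x. (U2 x)\<^sup>2)"
      by (rule indep_var_joint_algebra[OF ind st sub23 J(3)]) measurable
    from indep_var_integrable[OF this] indep_var_lebesgue_integral[OF this]
    show "integrable M (\<lambda>x. (V2 x)\<^sup>2 * (U2 x)\<^sup>2)"
     "expectation (\<lambda>x. (V2 x)\<^sup>2 * (U2 x)\<^sup>2) = v * expectation (\<lambda>x. (U2 x)\<^sup>2)"
      using sq iU var by auto
  qed
  have "expectation (\<lambda>x. (V1 x * U1 x + V2 x * U2 x)\<^sup>2) =
    expectation (\<lambda>x. ((V1 x)\<^sup>2 * (U1 x)\<^sup>2 + (V2 x)\<^sup>2 * (U2 x)\<^sup>2) + 2 * (V1 x * (U1 x * (V2 x * U2 x))))"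
    by (intro Bochner_Integration.integral_cong) (auto simp: power2_eq_square algebra_simps)
  also have "\<dots> = v * (expectation (\<lambda>x. (U1 x)\<^sup>2) + expectation (\<lambda>x. (U2 x)\<^sup>2))"
    using q1 q2 cr by (simp add: distrib_left)
  also have "expectation (\<lambda>x. (U1 x)\<^sup>2) + expectation (\<lambda>x. (U2 x)\<^sup>2) = 1"
    using iU unit by (subst Bochner_Integration.integral_add[symmetric]) (auto simp: prob_space)
  finally show "expectation (\<lambda>x. (V1 x * U1 x + V2 x * U2 x)\<^sup>2) = v" by simp
qed

end

section \<open>Phases of complex numbers\<close>

lemma measurable_cis_Arg[measurable]: "(\<lambda>z. cis (Arg z)) \<in> borel_measurable borel"
proof -
  \<comment> \<open>At 0 the two sides of \<open>cis (Arg z) = sgn z\<close> differ: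
    \<open>Arg 0 = 0\<close> gives 1, while \<open>sgn 0 = 0\<close>.\<close>
  have "(\<lambda>z. cis (Arg z)) = (\<lambda>z. if z = 0 then 1 else sgn z)"
    by (auto simp: cis_Arg Arg_zero)
  moreover have "(\<lambda>z::complex. if z = 0 then 1 else sgn z) \<in> borel_measurable borel"
    unfolding sgn_div_norm by measurable
  ultimately show ?thesis by simp
qed

lemma cis_Arg_mult_norm: "cis (Arg z) * of_real (norm z) = z"
  by (metis Arg_zero cis_zero mult_cancel_left2 norm_zero of_real_0 mult.commute rcis_cmod_Arg rcis_def)

lemma norm_eq_Re_cis_Arg: "Re z * Re (cis (Arg z)) + Im z * Im (cis (Arg z)) = norm z"
proof -
  have "Re (cis (Arg z)) * norm z = Re z" "Im (cis (Arg z)) * norm z = Im z"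
    using arg_cong[OF cis_Arg_mult_norm[of z], of Re] arg_cong[OF cis_Arg_mult_norm[of z], of Im] by auto
  then have "Re z * Re (cis (Arg z)) + Im z * Im (cis (Arg z))
    = norm z * ((Re (cis (Arg z)))\<^sup>2 + (Im (cis (Arg z)))\<^sup>2)"
    by (metis (no_types, opaque_lifting) distrib_left mult.assoc mult.commute power2_eq_square)
  then show ?thesis by (simp add: )
qed

context prob_space begin

text \<open>With \<open>s = X + R\<close> as a complex number and \<open>u\<close> its phase, split
  \<open>X = \<rho> s + V\<close>. The projection on \<open>u\<close> becomes
  \<open>\<rho> |s| + D\<close>, where \<open>D\<close> projects a residual \<open>V\<close>
  independent of \<open>u\<close>. The mean comes from the Rayleigh mean of \<open>|s|\<close>; the
  second moment is \<open>\<rho>^2 E|s|^2 + \<tau>^2\<close>, since \<open>|s| D\<close> has mean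
  0.\<close>

lemma gaussian_projection:
  fixes X R :: "bool \<Rightarrow> 'a \<Rightarrow> real"
  assumes ab: "0 < a" "0 < b"
    and ind: "indep_vars (\<lambda>_. borel) (\<lambda>(c, d). if d then X c else R c) UNIV"
    and X: "\<And>c. distributed M lborel (X c) (normal_density 0 a)"
    and R: "\<And>c. distributed M lborel (R c) (normal_density 0 b)"
  defines "u \<equiv> \<lambda>x. cis (Arg (Complex (X True x + R True x) (X False x + R False x)))"
  defines "Y \<equiv> \<lambda>x. X True x * Re (u x) + X False x * Im (u x)"
  shows "expectation Y = a\<^sup>2 / sqrt (a\<^sup>2 + b\<^sup>2) * sqrt (pi / 2)"
    and "expectation (\<lambda>x. (Y x)\<^sup>2) = a\<^sup>2 * a\<^sup>2 / (a\<^sup>2 + b\<^sup>2) + a\<^sup>2"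
proof -
  define \<rho> where "\<rho> = a\<^sup>2 / (a\<^sup>2 + b\<^sup>2)"
  define \<sigma> where "\<sigma> = sqrt (a\<^sup>2 + b\<^sup>2)"
  define \<tau> where "\<tau> = a * b / sqrt (a\<^sup>2 + b\<^sup>2)"
  have pos: "\<sigma> > 0" "\<tau> > 0" using ab by (auto simp: \<sigma>_def \<tau>_def add_pos_pos)
  define S where "S c x = X c x + R c x" for c x
  define V where "V c x = X c x - \<rho> * S c x" for c x
  let ?Q = "\<lambda>(c, d). if d then X c else R c"
  \<comment> \<open>Indexed like the given family: \<open>c\<close> selects the real or imaginary
    part, while \<open>d\<close> now selects residual or sum.\<close>
  define Z where "Z = (\<lambda>(c, d). if d then V c else S c)"
  note indQ = indep_sets_rv_events[OF ind]
  have mX: "X c \<in> borel_measurable (joint_algebra M (rv_events M ?Q) J)" if "(c, True) \<in> J" for c J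
    using measurable_rv_joint_algebra[OF that, of ?Q M] by simp
  have mR: "R c \<in> borel_measurable (joint_algebra M (rv_events M ?Q) J)" if "(c, False) \<in> J" for c J
    using measurable_rv_joint_algebra[OF that, of ?Q M] by simp
  have XR: "indep_var borel (X c) borel (R c)" for c
    by (rule indep_var_joint_algebra[OF indQ Int_stable_rv_events, of "{(c, True)}" "{(c, False)}"])
       (auto intro: mX mR)
  note shear = normal_shear[OF ab XR X R]
  have VS: "indep_var borel (V c) borel (S c)" for c
    using shear(1)[of c] by (simp add: S_def[abs_def] V_def[abs_def] \<rho>_def \<tau>_def)
  have dV: "distributed M lborel (V c) (normal_density 0 \<tau>)" for c
    using shear(2)[of c] by (simp add: S_def[abs_def] V_def[abs_def] \<rho>_def \<tau>_def)
  have dS: "distributed M lborel (S c) (normal_density 0 \<sigma>)" for c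
    using shear(3)[of c] by (simp add: S_def[abs_def] \<sigma>_def)
  \<comment> \<open>Across the two parts independence is inherited, because \<open>V c\<close> and
    \<open>S c\<close> involve only \<open>X c\<close> and \<open>R c\<close>; within a part it is
    the shear.\<close>
  have "indep_sets (\<lambda>(c, d). rv_events M Z (c, d)) (Sigma UNIV (\<lambda>_. UNIV))"
  proof (rule indep_sets_Sigma)
    show "indep_sets (\<lambda>c. sets (joint_algebra M (rv_events M ?Q) ({c} \<times> UNIV))) UNIV"
      by (rule indep_sets_joint_algebra[OF indQ Int_stable_rv_events]) (auto simp: disjoint_family_on_def)
    show "Int_stable (sets N)" for N :: "'a measure" by (auto simp: Int_stable_def)
    show "indep_sets (\<lambda>d. rv_events M Z (c, d)) UNIV" for c
    proof -
      have "(\<lambda>_. borel) = (case_bool borel borel :: bool \<Rightarrow> real measure)"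
        "(\<lambda>d. Z (c, d)) = case_bool (V c) (S c)"
        by (auto simp: fun_eq_iff Z_def split: bool.splits)
      then have "indep_vars (\<lambda>_. borel) (\<lambda>d. Z (c, d)) UNIV"
        using VS[of c] by (simp add: indep_var_def)
      then show ?thesis
        using indep_sets_rv_events by (auto simp: rv_events_def[abs_def])
    qed
    show "rv_events M Z (c, d) \<subseteq> sets (joint_algebra M (rv_events M ?Q) ({c} \<times> UNIV))" for c d
    proof -
      have [measurable]: "X c \<in> borel_measurable (joint_algebra M (rv_events M ?Q) ({c} \<times> UNIV))"
        "R c \<in> borel_measurable (joint_algebra M (rv_events M ?Q) ({c} \<times> UNIV))"
        by (auto intro: mX mR)
      have "Z (c, d) \<in> borel_measurable (joint_algebra M (rv_events M ?Q) ({c} \<times> UNIV))"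
        by (cases d) (auto simp: Z_def V_def[abs_def] S_def[abs_def])
      from measurable_sets[OF this] show ?thesis by (auto simp: rv_events_def)
    qed
  qed
  then have indZ: "indep_sets (rv_events M Z) UNIV" by (simp add: case_prod_beta')
  have mV: "V c \<in> borel_measurable (joint_algebra M (rv_events M Z) J)" if "(c, True) \<in> J" for c J
    using measurable_rv_joint_algebra[OF that, of Z M] by (simp add: Z_def)
  have mS: "S c \<in> borel_measurable (joint_algebra M (rv_events M Z) J)" if "(c, False) \<in> J" for c J
    using measurable_rv_joint_algebra[OF that, of Z M] by (simp add: Z_def)
  note iV = normal_moments[OF pos(2) dV] and iS = normal_moments[OF pos(1) dS]
  have [measurable]: "V c \<in> borel_measurable M" "S c \<in> borel_measurable M" for c
    using VS[of c] by (auto dest: indep_var_rv1 indep_var_rv2)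
  define s where "s x = Complex (S True x) (S False x)" for x
  have u: "u x = cis (Arg (s x))" for x by (simp add: u_def s_def S_def)
  have s_eq: "s x = of_real (S True x) + \<i> * of_real (S False x)" for x
    by (simp add: s_def complex_eq_iff)
  have ms: "s \<in> borel_measurable N" if "S True \<in> borel_measurable N" "S False \<in> borel_measurable N" for N
    using that unfolding s_eq[abs_def] by measurable
  define D where "D x = V True x * Re (u x) + V False x * Im (u x)" for x
  have mu: "(\<lambda>x. Re (u x)) \<in> borel_measurable N" "(\<lambda>x. Im (u x)) \<in> borel_measurable N" 
    if "S True \<in> borel_measurable N" "S False \<in> borel_measurable N" for N
  proof -
    have "u \<in> borel_measurable N"
      using measurable_compose[OF ms[OF that] measurable_cis_Arg] by (simp add: u[abs_def])
    then show "(\<lambda>x. Re (u x)) \<in> borel_measurable N" "(\<lambda>x. Im (u x)) \<in> borel_measurable N"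
      by (simp_all add: borel_measurable_complex_iff)
  qed
  have D: "integrable M (\<lambda>x. (D x)\<^sup>2)" "expectation D = 0" "expectation (\<lambda>x. (D x)\<^sup>2) = \<tau>\<^sup>2"
  proof -
    let ?J = "{(True, False), (False, False)} :: (bool \<times> bool) set"
    have uJ: "(\<lambda>x. Re (u x)) \<in> borel_measurable (joint_algebra M (rv_events M Z) ?J)"
      "(\<lambda>x. Im (u x)) \<in> borel_measurable (joint_algebra M (rv_events M Z) ?J)"
      by (auto intro!: mu mS)
    have u1: "(Re (u x))\<^sup>2 + (Im (u x))\<^sup>2 = 1" for x by (simp add: u)
    have V1: "V True \<in> borel_measurable (joint_algebra M (rv_events M Z) {(True, True)})"
      and V2: "V False \<in> borel_measurable (joint_algebra M (rv_events M Z) {(False, True)})"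
      by (auto intro: mV)
    show "integrable M (\<lambda>x. (D x)\<^sup>2)" "expectation D = 0" "expectation (\<lambda>x. (D x)\<^sup>2) = \<tau>\<^sup>2"
      using direction_moments[OF indZ Int_stable_rv_events _ _ _ V1 V2 uJ u1 iV(2) iV(2) iV(3) iV(3) iV(4) iV(4)]
      unfolding D_def by auto
  qed
  have [measurable]: "D \<in> borel_measurable M" "s \<in> borel_measurable M"
    unfolding D_def using mu[of M] ms[of M] by auto
  have norm_s: "norm (s x) = sqrt ((S True x)\<^sup>2 + (S False x)\<^sup>2)" for x
    by (simp add: s_def cmod_def)
  have Y: "Y x = \<rho> * norm (s x) + D x" for x
  proof -
    have "Y x = \<rho> * (Re (s x) * Re (u x) + Im (s x) * Im (u x)) + D x"
      by (simp add: Y_def D_def V_def s_def algebra_simps)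
    then show ?thesis using norm_eq_Re_cis_Arg[of "s x"] by (simp only: u)
  qed
  have ns2: "integrable M (\<lambda>x. (norm (s x))\<^sup>2)" "expectation (\<lambda>x. (norm (s x))\<^sup>2) = 2 * \<sigma>\<^sup>2"
    using iS(3,4)[of True] iS(3,4)[of False] by (simp_all add: norm_s)
  have ns: "integrable M (\<lambda>x. norm (s x))" using ns2(1) by (rule integrable_square_imp[rotated]) measurable
  have iD: "integrable M D" using D(1) by (rule integrable_square_imp[rotated]) measurable
  have "indep_var borel (S True) borel (S False)"
    by (rule indep_var_joint_algebra[OF indZ Int_stable_rv_events, of "{(True, False)}" "{(False, False)}"])
       (auto intro: mS)
  then have "expectation (\<lambda>x. norm (s x)) = \<sigma> * sqrt (pi / 2)"
    unfolding norm_s by (rule rayleigh_mean[OF pos(1) _ dS dS])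
  moreover have "\<rho> * \<sigma> = a\<^sup>2 / \<sigma>"
  proof -
    have "a\<^sup>2 + b\<^sup>2 = \<sigma> * \<sigma>" by (simp add: \<sigma>_def)
    then have "\<rho> = a\<^sup>2 / (\<sigma> * \<sigma>)" by (simp only: \<rho>_def)
    then show ?thesis using pos(1) by simp
  qed
  ultimately show "expectation Y = a\<^sup>2 / sqrt (a\<^sup>2 + b\<^sup>2) * sqrt (pi / 2)"
    using ns iD D(2) unfolding Y \<sigma>_def[symmetric] by (simp add: mult.assoc[symmetric])
  have VS0: "integrable M (\<lambda>x. V c x * S c x)" "expectation (\<lambda>x. V c x * S c x) = 0" for c
    using indep_zero_mean[OF VS iV(1) iS(1) iV(2)] by auto
  \<comment> \<open>Multiplying by \<open>norm (s x)\<close> undoes the normalization of the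
    direction, so the mixed term becomes a sum of products of independent centred variables, without
    any phase.\<close>
  have sD: "norm (s x) * D x = V True x * S True x + V False x * S False x" for x
  proof -
    have "Re (u x) * norm (s x) = S True x" "Im (u x) * norm (s x) = S False x"
      using arg_cong[OF cis_Arg_mult_norm[of "s x"], of Re] arg_cong[OF cis_Arg_mult_norm[of "s x"], of Im]
      unfolding u[symmetric] by (simp_all add: s_def)
    note this[symmetric]
    then show ?thesis by (simp only: D_def) (simp add: algebra_simps)
  qed
  have "expectation (\<lambda>x. (Y x)\<^sup>2) = expectation (\<lambda>x. \<rho>\<^sup>2 * (norm (s x))\<^sup>2 + (D x)\<^sup>2
     + 2 * \<rho> * (V True x * S True x + V False x * S False x))"
    unfolding sD[symmetric] Y by (simp add: power2_sum power_mult_distrib mult.assoc)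
  also have "\<dots> = \<rho>\<^sup>2 * (2 * \<sigma>\<^sup>2) + \<tau>\<^sup>2"
    using ns2 D VS0 by simp
  also have "\<dots> = a\<^sup>2 * a\<^sup>2 / (a\<^sup>2 + b\<^sup>2) + a\<^sup>2"
  proof -
    define q where "q = a\<^sup>2 + b\<^sup>2"
    have q: "q > 0" and b2: "b\<^sup>2 = q - a\<^sup>2" using ab by (auto simp: q_def add_pos_pos)
    show ?thesis unfolding \<rho>_def \<sigma>_def \<tau>_def q_def[symmetric] using q
      by (simp add: power_divide power_mult_distrib b2) (simp add: field_simps power2_eq_square power4_eq_xxxx)
  qed
  finally show "expectation (\<lambda>x. (Y x)\<^sup>2) = a\<^sup>2 * a\<^sup>2 / (a\<^sup>2 + b\<^sup>2) + a\<^sup>2" .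
qed

end

section \<open>Moments of the reflected gains\<close>

context prob_space begin

text \<open>The weights are nonzero and \<open>A\<close> is nonempty because otherwise a summand or
  the sum is constant and has no density.\<close>

lemma weighted_sum_normal:
  fixes X :: "'i \<Rightarrow> bool \<Rightarrow> 'a \<Rightarrow> real"
  assumes A: "finite A" "A \<noteq> {}" "A \<subseteq> I" and r: "0 < r"
    and ind: "indep_vars (\<lambda>_. borel) (\<lambda>(i, c). X i c) (I \<times> UNIV)"
    and dist: "\<And>i c. i \<in> I \<Longrightarrow> distributed M lborel (X i c) (normal_density 0 r)"
    and w: "\<And>i. i \<in> A \<Longrightarrow> w i \<noteq> 0"
  shows "distributed M lborel (\<lambda>x. \<Sum>i\<in>A. w i * X i c x) (normal_density 0 (r * sqrt (\<Sum>i\<in>A. (w i)\<^sup>2)))"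
proof -
  let ?X = "\<lambda>(i, c). X i c"
  have "indep_vars (\<lambda>_. borel) (\<lambda>i x. w i * X i c x) A"
  proof (rule indep_vars_joint_algebra[OF indep_sets_rv_events[OF ind] Int_stable_rv_events])
    show "disjoint_family_on (\<lambda>i. {(i, c)}) A" by (auto simp: disjoint_family_on_def)
    show "{(i, c)} \<subseteq> I \<times> UNIV" if "i \<in> A" for i using that A by auto
    have "X i c \<in> borel_measurable (joint_algebra M (rv_events M ?X) {(i, c)})" for i
      using measurable_rv_joint_algebra[of "(i, c)" "{(i, c)}" ?X M] by simp
    then show "(\<lambda>x. w i * X i c x) \<in> borel_measurable (joint_algebra M (rv_events M ?X) {(i, c)})" for i
      by measurable
  qed
  moreover have "distributed M lborel (\<lambda>x. w i * X i c x) (normal_density 0 (\<bar>w i\<bar> * r))" if "i \<in> A" for i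
    using normal_density_affine[OF dist[of i c] r, of "w i" 0] w A that by auto
  ultimately have "distributed M lborel (\<lambda>x. \<Sum>i\<in>A. w i * X i c x) (normal_density (\<Sum>i\<in>A. 0) (sqrt (\<Sum>i\<in>A. (\<bar>w i\<bar> * r)\<^sup>2)))"
    using A w r by (intro sum_indep_normal) auto
  moreover have "sqrt (\<Sum>i\<in>A. (\<bar>w i\<bar> * r)\<^sup>2) = r * sqrt (\<Sum>i\<in>A. (w i)\<^sup>2)"
    using r by (simp add: power_mult_distrib sum_distrib_right[symmetric] real_sqrt_mult)
  ultimately show ?thesis by simp
qed

text \<open>Each partial sum of the weighted channels, together with the complementary sum, is a
  pair of Gaussians to which the projection on the common phase applies. Singletons then give the
  moments of one gain, and pairs give the mixed moments. A channel of weight 0 does not influence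
  the phase and is handled by its independence from it.\<close>

lemma phase_aligned_moments:
  fixes X :: "nat \<Rightarrow> bool \<Rightarrow> 'a \<Rightarrow> real"
  assumes I: "finite I" and r: "0 < r"
    and ind: "indep_vars (\<lambda>_. borel) (\<lambda>(i, c). X i c) (I \<times> UNIV)"
    and dist: "\<And>i c. i \<in> I \<Longrightarrow> distributed M lborel (X i c) (normal_density 0 r)"
    and W: "0 < (\<Sum>i\<in>I. (w i)\<^sup>2)" (is "0 < ?W")
  defines "u \<equiv> \<lambda>x. cis (Arg (Complex (\<Sum>i\<in>I. w i * X i True x) (\<Sum>i\<in>I. w i * X i False x)))"
  defines "Y \<equiv> \<lambda>i x. X i True x * Re (u x) + X i False x * Im (u x)"
  shows "\<And>i. i \<in> I \<Longrightarrow> Y i \<in> borel_measurable M"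
    and "\<And>i. i \<in> I \<Longrightarrow> integrable M (\<lambda>x. (Y i x)\<^sup>2)"
    and "\<And>i. i \<in> I \<Longrightarrow> expectation (Y i) = r * w i / sqrt ?W * sqrt (pi / 2)"
    and "\<And>i k. i \<in> I \<Longrightarrow> k \<in> I \<Longrightarrow>
      expectation (\<lambda>x. Y i x * Y k x) = r\<^sup>2 * (w i * w k / ?W + of_bool (i = k))"
proof -
  let ?X = "\<lambda>(i, c). X i c"
  let ?E = "rv_events M ?X"
  \<comment> \<open>Only these channels determine the phase; in the application they are the
    devices, the remaining ones the interferers.\<close>
  define A0 where "A0 = {i \<in> I. w i \<noteq> 0}"
  have A0: "A0 \<subseteq> I" "finite A0" using I by (auto simp: A0_def)
  define a where "a A = (\<Sum>i\<in>A. (w i)\<^sup>2)" for A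
  have Wa: "?W = a A0" unfolding a_def A0_def using I by (intro sum.mono_neutral_right) auto
  have apos: "a A > 0" if "A \<subseteq> A0" "A \<noteq> {}" for A
    unfolding a_def using that A0 by (intro sum_pos) (auto simp: A0_def finite_subset)
  have sumA0: "(\<Sum>i\<in>I. w i * X i c x) = (\<Sum>i\<in>A0. w i * X i c x)" for c x
    unfolding A0_def using I by (intro sum.mono_neutral_right) auto
  note indE = indep_sets_rv_events[OF ind]
  have mX: "X i c \<in> borel_measurable (joint_algebra M ?E J)" if "(i, c) \<in> J" for i c J
    using measurable_rv_joint_algebra[OF that, of ?X M] by simp
  have [measurable]: "X i c \<in> borel_measurable M" if "i \<in> I" for i c
    using rv_joint_algebra[OF indE _ mX, of "{(i, c)}"] that by auto
  define s where "s x = Complex (\<Sum>i\<in>A0. w i * X i True x) (\<Sum>i\<in>A0. w i * X i False x)" for x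
  have u: "u x = cis (Arg (s x))" for x unfolding u_def s_def sumA0 ..
  have s_eq: "s x = of_real (\<Sum>i\<in>A0. w i * X i True x) + \<i> * of_real (\<Sum>i\<in>A0. w i * X i False x)" for x
    by (simp add: s_def complex_eq_iff)
  have mu: "(\<lambda>x. Re (u x)) \<in> borel_measurable N" "(\<lambda>x. Im (u x)) \<in> borel_measurable N"
    if m[measurable]: "\<And>i c. i \<in> A0 \<Longrightarrow> X i c \<in> borel_measurable N" for N
  proof -
    have "s \<in> borel_measurable N" unfolding s_eq[abs_def] by measurable
    then have "u \<in> borel_measurable N"
      using measurable_compose[OF _ measurable_cis_Arg] by (simp add: u[abs_def])
    then show "(\<lambda>x. Re (u x)) \<in> borel_measurable N" "(\<lambda>x. Im (u x)) \<in> borel_measurable N"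
      by (simp_all add: borel_measurable_complex_iff)
  qed
  have [measurable]: "(\<lambda>x. Re (u x)) \<in> borel_measurable M" "(\<lambda>x. Im (u x)) \<in> borel_measurable M"
    using A0 by (auto intro!: mu)
  have u1: "(Re (u x))\<^sup>2 + (Im (u x))\<^sup>2 = 1" for x by (simp add: u)
  have ub: "\<bar>Re (u x)\<bar> \<le> 1" "\<bar>Im (u x)\<bar> \<le> 1" for x by (simp_all add: u)
  note mom = normal_moments[OF r dist]
  show mY[measurable]: "Y i \<in> borel_measurable M" if "i \<in> I" for i
    using that unfolding Y_def by measurable
  have s2: "integrable M (\<lambda>x. (X i True x * Re (u x))\<^sup>2)" "integrable M (\<lambda>x. (X i False x * Im (u x))\<^sup>2)"
    if "i \<in> I" for i
    using that mom(3) ub by (intro integrable_square_mult_bounded; measurable)+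
  show iY2: "integrable M (\<lambda>x. (Y i x)\<^sup>2)" if "i \<in> I" for i
    unfolding Y_def using s2[OF that] that by (intro integrable_square_add) measurable
  have iYY: "integrable M (\<lambda>x. Y i x * Y k x)" if "i \<in> I" "k \<in> I" for i k
    by (rule integrable_mult_square[OF mY[OF that(1)] mY[OF that(2)] iY2[OF that(1)] iY2[OF that(2)]])
  have norms: "(\<Sum>i\<in>A0. w i * Y i x) = norm (s x)" for x
  proof -
    have "(\<Sum>i\<in>A0. w i * Y i x) = Re (s x) * Re (u x) + Im (s x) * Im (u x)"
      unfolding Y_def s_def by (simp add: algebra_simps sum.distrib sum_distrib_left)
    then show ?thesis using norm_eq_Re_cis_Arg[of "s x"] by (simp only: u)
  qed
  have nd: "distributed M lborel (\<lambda>x. \<Sum>i\<in>A. w i * X i c x) (normal_density 0 (r * sqrt (a A)))"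
    if "A \<subseteq> A0" "A \<noteq> {}" for A c
    unfolding a_def using that A0
    by (intro weighted_sum_normal[OF _ _ _ r ind dist]) (auto simp: A0_def finite_subset)
  have A0ne: "A0 \<noteq> {}" using W unfolding Wa a_def by auto
  note W0 = W[unfolded Wa]
  have sub: "expectation (\<lambda>x. \<Sum>i\<in>A. w i * Y i x) = r * a A / sqrt (a A0) * sqrt (pi / 2) \<and>
      expectation (\<lambda>x. (\<Sum>i\<in>A. w i * Y i x)\<^sup>2) = r\<^sup>2 * (a A * a A / a A0 + a A)"
    if A: "A \<subseteq> A0" "A \<noteq> {}" for A
  \<comment> \<open>If \<open>A\<close> exhausts \<open>A0\<close> there is no second Gaussian left
    for the projection lemma, but the projected sum is then \<open>norm (s x)\<close> itself and the
    Rayleigh mean applies directly.\<close>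
  proof (cases "A = A0")
    case True
    let ?S = "\<lambda>c x. \<Sum>i\<in>A0. w i * X i c x"
    have rp: "r * sqrt (a A0) > 0" using r W0 by simp
    have "?S c \<in> borel_measurable (joint_algebra M ?E (A0 \<times> {c}))" for c
    proof -
      have [measurable]: "X i c \<in> borel_measurable (joint_algebra M ?E (A0 \<times> {c}))" if "i \<in> A0" for i
        using that by (intro mX) auto
      show ?thesis by measurable
    qed
    note mS = this
    have "indep_var borel (?S True) borel (?S False)"
      by (rule indep_var_joint_algebra[OF indE Int_stable_rv_events _ _ mS mS]) (use A0 in auto)
    then have e: "expectation (\<lambda>x. norm (s x)) = r * sqrt (a A0) * sqrt (pi / 2)"
      unfolding s_def complex_norm using rayleigh_mean[OF rp _ nd[OF order_refl A0ne] nd[OF order_refl A0ne], of True False] by simp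
    note m = normal_moments[OF rp nd[OF order_refl A0ne]]
    have "expectation (\<lambda>x. (norm (s x))\<^sup>2) = 2 * (r * sqrt (a A0))\<^sup>2"
      unfolding s_def complex_norm using m(3,4)[of True] m(3,4)[of False] by simp
    then show ?thesis
      unfolding True norms e using W0 by (simp add: power_mult_distrib real_div_sqrt field_simps)
  next
    case False
    define A' where "A' = A0 - A"
    have A': "A' \<subseteq> A0" "A' \<noteq> {}" "A \<inter> A' = {}" "A0 = A \<union> A'" using A False by (auto simp: A'_def)
    have fin: "finite A" "finite A'" using A A' A0 finite_subset by blast+
    have aa: "a A0 = a A + a A'" unfolding a_def A'(4) using A' fin by (subst sum.union_disjoint) auto
    let ?p = "r * sqrt (a A)" and ?q = "r * sqrt (a A')"
    let ?XX = "\<lambda>c x. \<Sum>i\<in>A. w i * X i c x" and ?RR = "\<lambda>c x. \<Sum>i\<in>A'. w i * X i c x"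
    have pq: "?p > 0" "?q > 0" using r apos A A' by auto
    have sq: "?p\<^sup>2 = r\<^sup>2 * a A" "?q\<^sup>2 = r\<^sup>2 * a A'" "?p\<^sup>2 + ?q\<^sup>2 = r\<^sup>2 * a A0"
      using apos[OF A] apos[OF A'(1,2)] aa by (simp_all add: power_mult_distrib distrib_left)
    have "indep_vars (\<lambda>_. borel) (\<lambda>(c, d). if d then ?XX c else ?RR c) UNIV"
    proof (rule indep_vars_joint_algebra[OF indE Int_stable_rv_events])
      let ?J = "\<lambda>(c::bool, d). if d then A \<times> {c} else A' \<times> {c}"
      show "?J l \<subseteq> I \<times> UNIV" if "l \<in> UNIV" for l using A A' A0 by (auto split: prod.splits if_splits)
      show "disjoint_family_on ?J UNIV" using A' by (auto simp: disjoint_family_on_def)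
      fix l :: "bool \<times> bool"
      obtain c d where l: "l = (c, d)" by (cases l)
      have [measurable]: "X i c \<in> borel_measurable (joint_algebra M ?E (A \<times> {c}))" if "i \<in> A" for i
        using that by (intro mX) auto
      have [measurable]: "X i c \<in> borel_measurable (joint_algebra M ?E (A' \<times> {c}))" if "i \<in> A'" for i
        using that by (intro mX) auto
      show "(case l of (c, d) \<Rightarrow> if d then ?XX c else ?RR c) \<in> borel_measurable (joint_algebra M ?E (?J l))"
        unfolding l by simp
    qed
    note gp = gaussian_projection[OF pq this nd[OF A] nd[OF A'(1,2)]]
    have uu: "u x = cis (Arg (Complex (?XX True x + ?RR True x) (?XX False x + ?RR False x)))" for x
      unfolding u s_def A'(4) using A' fin by (simp add: sum.union_disjoint)
    have YY: "(\<Sum>i\<in>A. w i * Y i x) = ?XX True x * Re (u x) + ?XX False x * Im (u x)" for x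
      unfolding Y_def by (simp add: algebra_simps sum.distrib sum_distrib_left)
    have "expectation (\<lambda>x. \<Sum>i\<in>A. w i * Y i x) = ?p\<^sup>2 / sqrt (?p\<^sup>2 + ?q\<^sup>2) * sqrt (pi / 2)"
      unfolding YY unfolding uu by (rule gp(1))
    also have "\<dots> = r * a A / sqrt (a A0) * sqrt (pi / 2)"
      unfolding sq(3) unfolding sq(1) using r by (simp add: real_sqrt_mult power2_eq_square)
    finally have 1: "expectation (\<lambda>x. \<Sum>i\<in>A. w i * Y i x) = \<dots>" .
    have "expectation (\<lambda>x. (\<Sum>i\<in>A. w i * Y i x)\<^sup>2) = ?p\<^sup>2 * ?p\<^sup>2 / (?p\<^sup>2 + ?q\<^sup>2) + ?p\<^sup>2"
      unfolding YY unfolding uu by (rule gp(2))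
    also have "\<dots> = r\<^sup>2 * (a A * a A / a A0 + a A)"
      unfolding sq(3) unfolding sq(1) using r by (simp add: distrib_left)
    finally show ?thesis using 1 by simp
  qed
  \<comment> \<open>Channel \<open>i\<close> is absent from the phase and from \<open>Y k\<close>,
    so in every term \<open>X i c\<close> is a centred factor independent of the rest.\<close>
  have Y0: "expectation (Y i) = 0 \<and> expectation (\<lambda>x. (Y i x)\<^sup>2) = r\<^sup>2 \<and>
    (\<forall>k\<in>I - {i}. expectation (\<lambda>x. Y i x * Y k x) = 0)" if i: "i \<in> I" "i \<notin> A0" for i
  proof (intro conjI ballI)
    let ?J = "(I - {i}) \<times> (UNIV :: bool set)"
    have JX: "X k c \<in> borel_measurable (joint_algebra M ?E ?J)" if "k \<in> I - {i}" for k c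
      using that by (intro mX) auto
    have Ju: "(\<lambda>x. Re (u x)) \<in> borel_measurable (joint_algebra M ?E ?J)"
      "(\<lambda>x. Im (u x)) \<in> borel_measurable (joint_algebra M ?E ?J)"
      using A0 i by (auto intro!: mu JX)
    have V: "X i c \<in> borel_measurable (joint_algebra M ?E {(i, c)})" for c by (intro mX) auto
    have "{(i, True)} \<union> ({(i, False)} \<union> ?J) \<subseteq> I \<times> UNIV" "{(i, True)} \<inter> ({(i, False)} \<union> ?J) = {}"
      "{(i, False)} \<inter> ?J = {}" using i by auto
    note dm = direction_moments[OF indE Int_stable_rv_events this V V Ju u1 mom(2)[OF i(1)] mom(2)[OF i(1)]
        mom(3)[OF i(1)] mom(3)[OF i(1)] mom(4)[OF i(1)] mom(4)[OF i(1)]]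
    show "expectation (Y i) = 0" "expectation (\<lambda>x. (Y i x)\<^sup>2) = r\<^sup>2"
      using dm(2,3) by (simp_all add: Y_def)
    fix k assume k: "k \<in> I - {i}"
    then have kI: "k \<in> I" by simp
    have JY: "Y k \<in> borel_measurable (joint_algebra M ?E ?J)"
      using JX[OF k, measurable] Ju[measurable] unfolding Y_def by measurable
    have z: "integrable M (\<lambda>x. X i c x * (U x * Y k x))" "expectation (\<lambda>x. X i c x * (U x * Y k x)) = 0"
      if U: "U \<in> borel_measurable (joint_algebra M ?E ?J)" "\<And>x. \<bar>U x\<bar> \<le> 1" for U c
    proof -
      have UM: "U \<in> borel_measurable M" using i by (intro rv_joint_algebra[OF indE _ U(1)]) auto
      have "(\<lambda>x. U x * Y k x) \<in> borel_measurable (joint_algebra M ?E ?J)"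
        using U(1) JY by (rule borel_measurable_times)
      then have id: "indep_var borel (X i c) borel (\<lambda>x. U x * Y k x)"
        using i by (intro indep_var_joint_algebra[OF indE Int_stable_rv_events _ _ V]) auto
      have "integrable M (\<lambda>x. U x * Y k x)"
      proof (rule integrable_mult_square[OF UM mY[OF kI] _ iY2[OF kI]])
        show "integrable M (\<lambda>x. (U x)\<^sup>2)"
          using UM U(2) by (intro integrable_const_bound[where B=1]) (auto simp: abs_square_le_1)
      qed
      from indep_zero_mean[OF id mom(1)[OF i(1)] this mom(2)[OF i(1)]]
      show "integrable M (\<lambda>x. X i c x * (U x * Y k x))" "expectation (\<lambda>x. X i c x * (U x * Y k x)) = 0"
        by auto
    qed
    have "expectation (\<lambda>x. Y i x * Y k x) =
      expectation (\<lambda>x. X i True x * (Re (u x) * Y k x) + X i False x * (Im (u x) * Y k x))"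
      by (rule Bochner_Integration.integral_cong) (simp_all add: Y_def algebra_simps)
    also have "\<dots> = 0"
      using z[OF Ju(1) ub(1)] z[OF Ju(2) ub(2)] by simp
    finally show "expectation (\<lambda>x. Y i x * Y k x) = 0" .
  qed
  have one: "expectation (Y i) = r * w i / sqrt ?W * sqrt (pi / 2) \<and>
     expectation (\<lambda>x. (Y i x)\<^sup>2) = r\<^sup>2 * (w i * w i / ?W + 1)" if i: "i \<in> I" for i
  proof (cases "i \<in> A0")
    case True
    then have wi: "w i \<noteq> 0" by (simp add: A0_def)
    \<comment> \<open>The partial sum over \<open>{i}\<close> determines the moments of
      \<open>w i * Y i\<close>; the weight is cancelled afterwards.\<close>
    have "w i * expectation (Y i) = r * (w i)\<^sup>2 / sqrt (a A0) * sqrt (pi / 2)"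
      and e2: "(w i)\<^sup>2 * expectation (\<lambda>x. (Y i x)\<^sup>2) = r\<^sup>2 * ((w i)\<^sup>2 * (w i)\<^sup>2 / a A0 + (w i)\<^sup>2)"
      using sub[of "{i}"] True by (auto simp: a_def power_mult_distrib)
    then have "w i * expectation (Y i) = w i * (r * w i / sqrt ?W * sqrt (pi / 2))"
      unfolding Wa by (simp add: power2_eq_square)
    moreover have "(w i)\<^sup>2 * expectation (\<lambda>x. (Y i x)\<^sup>2) = (w i)\<^sup>2 * (r\<^sup>2 * (w i * w i / ?W + 1))"
      unfolding e2 Wa by (simp add: power2_eq_square algebra_simps)
    ultimately show ?thesis using wi by (metis mult_left_cancel power_not_zero)
  next
    case False
    then have "w i = 0" using i by (simp add: A0_def)
    then show ?thesis using Y0[OF i False] by simp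
  qed
  show "expectation (Y i) = r * w i / sqrt ?W * sqrt (pi / 2)" if "i \<in> I" for i
    using one[OF that] by simp
  show "expectation (\<lambda>x. Y i x * Y k x) = r\<^sup>2 * (w i * w k / ?W + of_bool (i = k))"
    if ik: "i \<in> I" "k \<in> I" for i k
  proof (cases "i = k")
    case True
    then show ?thesis using one[OF ik(1)] by (simp add: power2_eq_square)
  next
    case ne: False
    show ?thesis
    proof (cases "i \<in> A0 \<and> k \<in> A0")
      case False
      then consider "i \<notin> A0" | "k \<notin> A0" by auto
      then show ?thesis
      proof cases
        case 1
        then have "w i = 0" using ik by (simp add: A0_def)
        then show ?thesis using Y0[OF ik(1) 1] ik ne by simp
      next
        case 2
        then have "w k = 0" using ik by (simp add: A0_def)
        then show ?thesis using Y0[OF ik(2) 2] ik ne by (simp add: mult.commute[of "Y i _"])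
      qed
    next
      case True
      then have w: "w i \<noteq> 0" "w k \<noteq> 0" by (auto simp: A0_def)
      let ?e = "expectation (\<lambda>x. Y i x * Y k x)"
      \<comment> \<open>polarization: the subset \<open>{i, k}\<close> provides the second moment of \<open>w\<^sub>i Y\<^sub>i + w\<^sub>k Y\<^sub>k\<close>\<close>
      have "expectation (\<lambda>x. (w i * Y i x + w k * Y k x)\<^sup>2) =
        expectation (\<lambda>x. (w i)\<^sup>2 * (Y i x)\<^sup>2 + (w k)\<^sup>2 * (Y k x)\<^sup>2 + 2 * w i * w k * (Y i x * Y k x))"
        by (rule Bochner_Integration.integral_cong) (simp_all add: power2_eq_square algebra_simps)
      also have "\<dots> = (w i)\<^sup>2 * expectation (\<lambda>x. (Y i x)\<^sup>2) + (w k)\<^sup>2 * expectation (\<lambda>x. (Y k x)\<^sup>2) + 2 * w i * w k * ?e"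
        using iY2 iYY ik by simp
      finally have "r\<^sup>2 * (((w i)\<^sup>2 + (w k)\<^sup>2) * ((w i)\<^sup>2 + (w k)\<^sup>2) / ?W + ((w i)\<^sup>2 + (w k)\<^sup>2)) =
        (w i)\<^sup>2 * (r\<^sup>2 * (w i * w i / ?W + 1)) + (w k)\<^sup>2 * (r\<^sup>2 * (w k * w k / ?W + 1)) + 2 * w i * w k * ?e"
        using sub[of "{i, k}"] True ne one[OF ik(1)] one[OF ik(2)] by (simp add: a_def Wa)
      then have "2 * w i * w k * ?e = 2 * w i * w k * (r\<^sup>2 * (w i * w k / ?W))"
        using W by (auto simp: field_simps power2_eq_square)
      moreover have "2 * w i * w k \<noteq> 0" using w by simp
      ultimately have "?e = r\<^sup>2 * (w i * w k / ?W)" using mult_left_cancel[of "2 * w i * w k" ?e] by blast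
      then show ?thesis using ne by simp
    qed
  qed
qed

end

text \<open>Stated for the phase factor because \<open>Arg (cnj z) = - Arg z\<close> fails on the
  negative real axis, where both arguments are pi.\<close>

lemma cis_Arg_cnj: "cis (Arg (cnj z)) = cnj (cis (Arg z))"
proof (cases "z = 0")
  case False
  then show ?thesis by (simp add: cis_Arg sgn_eq)
qed (simp add: Arg_zero)

lemma Basis_complex_vec: "(Basis :: (complex^'n) set) = (\<Union>n. {axis n 1, axis n \<i>})"
  by (auto simp: Basis_vec_def Basis_complex_def)

context prob_space begin

text \<open>The phase shift cancels the phase of the server channel, so the gain is a sum over
  elements of \<open>H n * Y n i\<close> with \<open>H n\<close> the modulus of the server channel
  and \<open>Y n i\<close> a phase-aligned projection. Moduli and projections are independent of
  each other, and different elements are independent: the N diagonal pairs contribute second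
  moments, the N(N-1) others products of means. Index 0 stands for the server channel.\<close>

lemma ris_gain_moments:
  fixes hp :: "'a \<Rightarrow> complex^'n" and hr :: "nat \<Rightarrow> 'a \<Rightarrow> complex^'n" and w :: "nat \<Rightarrow> real"
  assumes I: "finite I" "0 \<notin> I"
    and ind: "indep_sets (\<lambda>j. rv_events M (\<lambda>j. if j = 0 then hp else hr j) j) (insert 0 I)"
    and hp: "CN M 1 hp" and hr: "\<And>i. i \<in> I \<Longrightarrow> CN M 1 (hr i)"
    and W: "0 < (\<Sum>i\<in>I. (w i)\<^sup>2)" (is "0 < ?W")
  defines "A \<equiv> \<lambda>i x. Re (\<Sum>n\<in>UNIV. cnj (hp x $ n) *
      cis (- Arg (cnj (hp x $ n)) + Arg (\<Sum>k\<in>I. complex_of_real (w k) * cnj (hr k x $ n))) * hr i x $ n)"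
  shows "\<And>i. i \<in> I \<Longrightarrow> A i \<in> borel_measurable M"
    and "\<And>i. i \<in> I \<Longrightarrow> integrable M (\<lambda>x. (A i x)\<^sup>2)"
    and "\<And>i. i \<in> I \<Longrightarrow> expectation (A i) = real CARD('n) * (pi / 4) * (w i / sqrt ?W)"
    and "\<And>i k. i \<in> I \<Longrightarrow> k \<in> I \<Longrightarrow> expectation (\<lambda>x. A i x * A k x) =
      real CARD('n) * ((w i * w k / ?W + of_bool (i = k)) / 2)
      + real CARD('n) * (real CARD('n) - 1) * ((pi / 4)\<^sup>2 * (w i * w k / ?W))"
proof -
  define h where "h j = (if j = 0 then hp else hr j)" for j
  \<comment> \<open>Each real coordinate of a \<open>CN M 1\<close> vector has variance 1/2, and
    \<open>r^2 * (sqrt (pi / 2))^2 = pi / 4\<close> is the source of every \<open>pi / 4\<close>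
    below.\<close>
  define r where "r = sqrt (1 / 2 :: real)"
  have r: "r > 0" "r\<^sup>2 = 1 / 2" by (auto simp: r_def)
  have mulr: "(r * a / s * q) * (r * b / s * q) = r\<^sup>2 * q\<^sup>2 * (a * b / (s * s))"
    and mulr1: "(r * q) * (r * a / s * q) = r\<^sup>2 * q\<^sup>2 * (a / s)" for a b s q
    by (simp_all add: power2_eq_square)
  define Z where "Z = (\<lambda>(j, b) x. h j x \<bullet> b)"
  define e where "e n c = (axis n (if c then 1 else \<i>) :: complex^'n)" for n c
  have e: "e n c \<in> Basis" for n c by (auto simp: e_def Basis_complex_vec)
  have e_eq: "e n c = e m d \<longleftrightarrow> n = m \<and> c = d" for n m c d
    by (auto simp: e_def axis_eq_axis complex_eq_iff)
  have Ze: "Z (j, e n True) x = Re (h j x $ n)" "Z (j, e n False) x = Im (h j x $ n)" for j n x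
    by (simp_all add: Z_def e_def inner_axis inner_complex_def)
  let ?I = "insert 0 I \<times> (Basis :: (complex^'n) set)"
  have CN: "CN M 1 (h j)" if "j \<in> insert 0 I" for j
    using that hp hr by (auto simp: h_def)
  \<comment> \<open>Independence of the channel vectors and, by \<open>CN\<close>, of the
    coordinates within each vector combine into one family of real variables.\<close>
  have "indep_sets (\<lambda>(j, b). rv_events M Z (j, b)) (Sigma (insert 0 I) (\<lambda>_. Basis))"
  proof (rule indep_sets_Sigma)
    show "indep_sets (rv_events M h) (insert 0 I)"
      using ind by (simp add: h_def[abs_def])
    show "Int_stable (rv_events M h j)" for j by (rule Int_stable_rv_events)
    show "indep_sets (\<lambda>b. rv_events M Z (j, b)) Basis" if "j \<in> insert 0 I" for j
      using indep_sets_rv_events[of "\<lambda>b x. h j x \<bullet> b" Basis] CN[OF that]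
      by (simp add: CN_def rv_events_def[abs_def] Z_def)
    show "rv_events M Z (j, b) \<subseteq> rv_events M h j" for j b
    proof
      fix S assume "S \<in> rv_events M Z (j, b)"
      then obtain B where B: "B \<in> sets borel" "S = (\<lambda>x. h j x \<bullet> b) -` B \<inter> space M"
        by (auto simp: rv_events_def Z_def)
      have "(\<lambda>v. v \<bullet> b) \<in> borel_measurable borel" by simp
      then have "(\<lambda>v. v \<bullet> b) -` B \<in> sets borel" using B(1) measurable_sets_borel by blast
      moreover have "S = h j -` ((\<lambda>v. v \<bullet> b) -` B) \<inter> space M" using B(2) by auto
      ultimately show "S \<in> rv_events M h j" unfolding rv_events_def by blast
    qed
  qed
  then have indZ: "indep_sets (rv_events M Z) ?I" by (simp add: case_prod_beta')
  let ?alg = "\<lambda>J. joint_algebra M (rv_events M Z) J"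
  have mZ: "Z p \<in> borel_measurable (?alg J)" if "p \<in> J" for p J
    using measurable_rv_joint_algebra[OF that] .
  have dZ: "distributed M lborel (Z (j, b)) (normal_density 0 r)" if "j \<in> insert 0 I" "b \<in> Basis" for j b
    using CN[OF that(1)] that(2) by (simp add: CN_def Z_def r_def)

  define H where "H n x = norm (hp x $ n)" for n x
  have Hsq: "H n x = sqrt ((Z (0, e n True) x)\<^sup>2 + (Z (0, e n False) x)\<^sup>2)" for n x
    by (simp add: H_def Ze h_def cmod_def)
  have mH: "H n \<in> borel_measurable (?alg J)" if "{(0, e n True), (0, e n False)} \<subseteq> J" for n J
  proof -
    have [measurable]: "Z (0, e n True) \<in> borel_measurable (?alg J)" "Z (0, e n False) \<in> borel_measurable (?alg J)"
      using that by (auto intro: mZ)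
    show ?thesis unfolding Hsq[abs_def] by measurable
  qed
  note momZ = normal_moments[OF r(1) dZ]
  have mHM: "H n \<in> borel_measurable M" for n
    using e by (intro rv_joint_algebra[OF indZ _ mH[OF order_refl]]) auto
  have H2: "integrable M (\<lambda>x. (H n x)\<^sup>2)" "expectation (\<lambda>x. (H n x)\<^sup>2) = 1" for n
    using momZ(3,4)[of 0 "e n True"] momZ(3,4)[of 0 "e n False"] e r(2) by (simp_all add: Hsq)
  have H1: "expectation (H n) = r * sqrt (pi / 2)" for n
  proof -
    have "indep_var borel (Z (0, e n True)) borel (Z (0, e n False))"
      by (rule indep_var_joint_algebra[OF indZ Int_stable_rv_events _ _
            mZ[OF singletonI] mZ[OF singletonI]]) (auto simp: e e_eq)
    from rayleigh_mean[OF r(1) this dZ dZ] show ?thesis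
      unfolding Hsq[abs_def] using e by simp
  qed
  have iH: "integrable M (H n)" for n by (rule integrable_square_imp[OF mHM H2(1)])
  have HH: "integrable M (\<lambda>x. H n x * H m x)"
    "expectation (\<lambda>x. H n x * H m x) = (if n = m then 1 else pi / 4)" for n m
  proof -
    show "integrable M (\<lambda>x. H n x * H m x)"
      by (rule integrable_mult_square[OF mHM mHM H2(1) H2(1)])
    show "expectation (\<lambda>x. H n x * H m x) = (if n = m then 1 else pi / 4)"
    proof (cases "n = m")
      case True
      then show ?thesis using H2(2)[of m] by (simp add: power2_eq_square)
    next
      case False
      then have "indep_var borel (H n) borel (H m)"
        by (intro indep_var_joint_algebra[OF indZ Int_stable_rv_events _ _ mH[OF order_refl] mH[OF order_refl]])
          (auto simp: e e_eq)
      from indep_var_lebesgue_integral[OF this iH iH] False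
      have "expectation (\<lambda>x. H n x * H m x) = (r * sqrt (pi / 2)) * (r * sqrt (pi / 2))" by (simp add: H1)
      also have "\<dots> = r\<^sup>2 * (sqrt (pi / 2))\<^sup>2" by (simp only: power2_eq_square mult_ac)
      also have "\<dots> = pi / 4" by (simp add: r(2))
      finally show ?thesis using False by simp
    qed
  qed

  define u where "u n x = cis (Arg (Complex (\<Sum>i\<in>I. w i * Z (i, e n True) x) (\<Sum>i\<in>I. w i * Z (i, e n False) x)))" for n x
  define Y where "Y n i x = Z (i, e n True) x * Re (u n x) + Z (i, e n False) x * Im (u n x)" for n i x
  have indn: "indep_vars (\<lambda>_. borel) (\<lambda>(i, c). Z (i, e n c)) (I \<times> UNIV)" for n
  proof (rule indep_vars_joint_algebra[OF indZ Int_stable_rv_events])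
    let ?J = "\<lambda>(i, c). {(i, e n c)}"
    show "?J l \<subseteq> ?I" if "l \<in> I \<times> UNIV" for l using that e by auto
    show "disjoint_family_on ?J (I \<times> UNIV)" by (auto simp: disjoint_family_on_def e_eq)
    show "(case l of (i, c) \<Rightarrow> Z (i, e n c)) \<in> borel_measurable (?alg (?J l))" for l
      by (cases l) (simp add: mZ)
  qed
  have dn: "distributed M lborel (Z (i, e n c)) (normal_density 0 r)" if "i \<in> I" for i n c
    using that e by (intro dZ) auto
  note pam = phase_aligned_moments[where X = "\<lambda>i c. Z (i, e n c)" for n, OF I(1) r(1) indn dn W,
      folded u_def, folded Y_def]
  have mYM: "Y n i \<in> borel_measurable M" if "i \<in> I" for n i
    using pam(1)[OF _ that, of n] by (simp add: Y_def[abs_def])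
  have Y2: "integrable M (\<lambda>x. (Y n i x)\<^sup>2)" if "i \<in> I" for n i
    using pam(2)[OF _ that, of n] by (simp add: Y_def)
  have Y1: "expectation (Y n i) = r * w i / sqrt ?W * sqrt (pi / 2)" if "i \<in> I" for n i
    using pam(3)[OF _ that, of n] by (simp add: Y_def[abs_def])
  have Ynn: "expectation (\<lambda>x. Y n i x * Y n k x) = (w i * w k / ?W + of_bool (i = k)) / 2"
    if "i \<in> I" "k \<in> I" for n i k
    using pam(4)[OF _ that, of n] r(2) by (simp add: Y_def)
  have iY: "integrable M (Y n i)" if "i \<in> I" for n i by (rule integrable_square_imp[OF mYM[OF that] Y2[OF that]])
  have mY: "Y n i \<in> borel_measurable (?alg J)" if i: "i \<in> I" and J: "\<And>k c. k \<in> I \<Longrightarrow> (k, e n c) \<in> J" for n i J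
  proof -
    have [measurable]: "Z (k, e n c) \<in> borel_measurable (?alg J)" if "k \<in> I" for k c
      using J[OF that] by (rule mZ)
    define s where "s x = Complex (\<Sum>i\<in>I. w i * Z (i, e n True) x) (\<Sum>i\<in>I. w i * Z (i, e n False) x)" for x
    have "s x = of_real (\<Sum>i\<in>I. w i * Z (i, e n True) x) + \<i> * of_real (\<Sum>i\<in>I. w i * Z (i, e n False) x)" for x
      by (simp add: s_def complex_eq_iff)
    then have "s = (\<lambda>x. of_real (\<Sum>i\<in>I. w i * Z (i, e n True) x) + \<i> * of_real (\<Sum>i\<in>I. w i * Z (i, e n False) x))"
      by blast
    then have "s \<in> borel_measurable (?alg J)" by (simp only:) measurable
    moreover have "u n = (\<lambda>x. cis (Arg (s x)))" by (simp add: fun_eq_iff u_def s_def)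
    ultimately have "u n \<in> borel_measurable (?alg J)"
      using measurable_compose[OF _ measurable_cis_Arg] by simp
    then have [measurable]: "(\<lambda>x. Re (u n x)) \<in> borel_measurable (?alg J)" "(\<lambda>x. Im (u n x)) \<in> borel_measurable (?alg J)"
      by (simp_all add: borel_measurable_complex_iff)
    show ?thesis unfolding Y_def[abs_def] using i by measurable
  qed
  have YY: "integrable M (\<lambda>x. Y n i x * Y m k x)"
    "expectation (\<lambda>x. Y n i x * Y m k x) =
      (if n = m then (w i * w k / ?W + of_bool (i = k)) / 2 else pi / 4 * (w i * w k / ?W))"
    if ik: "i \<in> I" "k \<in> I" for n m i k
  proof -
    show "integrable M (\<lambda>x. Y n i x * Y m k x)"
      by (rule integrable_mult_square[OF mYM[OF ik(1)] mYM[OF ik(2)] Y2[OF ik(1)] Y2[OF ik(2)]])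
    show "expectation (\<lambda>x. Y n i x * Y m k x) =
      (if n = m then (w i * w k / ?W + of_bool (i = k)) / 2 else pi / 4 * (w i * w k / ?W))"
    proof (cases "n = m")
      case True
      then show ?thesis using Ynn[OF ik] by simp
    next
      case False
      have J: "Y n i \<in> borel_measurable (?alg (I \<times> range (e n)))" if "i \<in> I" for n i
        using that by (intro mY) auto
      have "indep_var borel (Y n i) borel (Y m k)"
        by (rule indep_var_joint_algebra[OF indZ Int_stable_rv_events _ _ J[OF ik(1)] J[OF ik(2)]])
          (use False in \<open>auto simp: e e_eq\<close>)
      from indep_var_lebesgue_integral[OF this iY[OF ik(1)] iY[OF ik(2)]]
      have "expectation (\<lambda>x. Y n i x * Y m k x) = (r * w i / sqrt ?W * sqrt (pi / 2)) * (r * w k / sqrt ?W * sqrt (pi / 2))"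
        by (simp add: Y1 ik)
      also have "\<dots> = r\<^sup>2 * (sqrt (pi / 2))\<^sup>2 * (w i * w k / (sqrt ?W * sqrt ?W))"
        by (rule mulr)
      also have "\<dots> = pi / 4 * (w i * w k / ?W)"
        using W by (simp add: r(2))
      finally show ?thesis using False by simp
    qed
  qed

  have A: "A i x = (\<Sum>n\<in>UNIV. H n x * Y n i x)" if i: "i \<in> I" for i x
  proof -
    have "Re (cnj (hp x $ n) * cis (- Arg (cnj (hp x $ n)) + Arg (\<Sum>k\<in>I. complex_of_real (w k) * cnj (hr k x $ n))) * hr i x $ n)
      = H n x * Y n i x" for n
    proof -
      have hk: "h k = hr k" if "k \<in> I" for k using that I(2) by (auto simp: h_def)
      \<comment> \<open>The RIS phase is defined from conjugated channels, hence its factor is the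
        conjugate of the phase \<open>u n x\<close> of the weighted sum.\<close>
      have "(\<Sum>k\<in>I. complex_of_real (w k) * cnj (hr k x $ n)) =
          cnj (Complex (\<Sum>i\<in>I. w i * Z (i, e n True) x) (\<Sum>i\<in>I. w i * Z (i, e n False) x))"
        by (simp add: complex_eq_iff Ze hk sum_negf)
      then have c: "cis (Arg (\<Sum>k\<in>I. complex_of_real (w k) * cnj (hr k x $ n))) = cnj (u n x)"
        by (simp only: cis_Arg_cnj u_def)
      have "cnj (hp x $ n) * cis (- Arg (cnj (hp x $ n))) = of_real (H n x)"
      proof -
        have "cnj (hp x $ n) * cis (- Arg (cnj (hp x $ n)))
          = of_real (norm (cnj (hp x $ n))) * (cis (Arg (cnj (hp x $ n))) * cis (- Arg (cnj (hp x $ n))))"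
          by (subst (1) cis_Arg_mult_norm[of "cnj (hp x $ n)", symmetric]) (simp only: mult_ac)
        then show ?thesis by (simp add: cis_mult H_def del: complex_mod_cnj) simp
      qed
      then have "cnj (hp x $ n) * cis (- Arg (cnj (hp x $ n)) + Arg (\<Sum>k\<in>I. complex_of_real (w k) * cnj (hr k x $ n))) * hr i x $ n
        = of_real (H n x) * (cnj (u n x) * hr i x $ n)"
        unfolding cis_mult[symmetric] c by (metis mult.assoc)
      then show ?thesis by (simp only:) (simp add: hk[OF i] Y_def Ze mult.commute)
    qed
    then show ?thesis by (simp add: A_def)
  qed
  have HY: "integrable M (\<lambda>x. (H n x * H m x) * (Y n i x * Y m k x))"
     "expectation (\<lambda>x. (H n x * H m x) * (Y n i x * Y m k x))
       = (if n = m then (w i * w k / ?W + of_bool (i = k)) / 2 else (pi / 4)\<^sup>2 * (w i * w k / ?W))"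
    if ik: "i \<in> I" "k \<in> I" for n m i k
  proof -
    let ?J = "{0} \<times> (Basis :: (complex^'n) set)" and ?L = "I \<times> (Basis :: (complex^'n) set)"
    have "(\<lambda>x. H n x * H m x) \<in> borel_measurable (?alg ?J)"
      by (intro borel_measurable_times mH) (auto simp: e)
    moreover have "(\<lambda>x. Y n i x * Y m k x) \<in> borel_measurable (?alg ?L)"
      using ik by (intro borel_measurable_times mY) (auto simp: e)
    ultimately have iv: "indep_var borel (\<lambda>x. H n x * H m x) borel (\<lambda>x. Y n i x * Y m k x)"
      by (rule indep_var_joint_algebra[OF indZ Int_stable_rv_events, rotated 2]) (use I(2) in auto)
    show "integrable M (\<lambda>x. (H n x * H m x) * (Y n i x * Y m k x))"
      by (rule indep_var_integrable[OF iv HH(1) YY(1)[OF ik]])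
    show "expectation (\<lambda>x. (H n x * H m x) * (Y n i x * Y m k x))
       = (if n = m then (w i * w k / ?W + of_bool (i = k)) / 2 else (pi / 4)\<^sup>2 * (w i * w k / ?W))"
      unfolding indep_var_lebesgue_integral[OF iv HH(1) YY(1)[OF ik]] HH(2) YY(2)[OF ik]
      by (simp add: power2_eq_square)
  qed
  have Aeq: "A i = (\<lambda>x. \<Sum>n\<in>UNIV. H n x * Y n i x)" if "i \<in> I" for i using A[OF that] by auto
  have AA: "A i x * A k x = (\<Sum>n\<in>UNIV. \<Sum>m\<in>UNIV. (H n x * H m x) * (Y n i x * Y m k x))"
    if "i \<in> I" "k \<in> I" for i k x
    unfolding A[OF that(1)] A[OF that(2)] sum_product by (simp only: mult_ac)
  show "A i \<in> borel_measurable M" if "i \<in> I" for i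
    unfolding Aeq[OF that] using mHM mYM[OF that] by (intro borel_measurable_sum borel_measurable_times)
  show "integrable M (\<lambda>x. (A i x)\<^sup>2)" if "i \<in> I" for i
    unfolding power2_eq_square AA[OF that that]
    by (intro Bochner_Integration.integrable_sum HY(1) that)
  have iv: "indep_var borel (H n) borel (Y n i)" if "i \<in> I" for n i
  proof (rule indep_var_joint_algebra[OF indZ Int_stable_rv_events])
    show "H n \<in> borel_measurable (?alg ({0} \<times> Basis))" by (intro mH) (auto simp: e)
    show "Y n i \<in> borel_measurable (?alg (I \<times> Basis))" using that by (intro mY) (auto simp: e)
  qed (use I(2) in auto)
  show "expectation (A i) = real CARD('n) * (pi / 4) * (w i / sqrt ?W)" if i: "i \<in> I" for i
  proof -
    have "integrable M (\<lambda>x. H n x * Y n i x)" for n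
      by (rule indep_var_integrable[OF iv[OF i] iH iY[OF i]])
    then have "expectation (A i) = (\<Sum>n\<in>UNIV. expectation (\<lambda>x. H n x * Y n i x))"
      unfolding Aeq[OF i] by (intro Bochner_Integration.integral_sum)
    also have "\<dots> = real CARD('n) * ((r * sqrt (pi / 2)) * (r * w i / sqrt ?W * sqrt (pi / 2)))"
      by (simp add: indep_var_lebesgue_integral[OF iv[OF i] iH iY[OF i]] H1 Y1[OF i])
    also have "(r * sqrt (pi / 2)) * (r * w i / sqrt ?W * sqrt (pi / 2)) = r\<^sup>2 * (sqrt (pi / 2))\<^sup>2 * (w i / sqrt ?W)"
      by (rule mulr1)
    also have "\<dots> = (pi / 4) * (w i / sqrt ?W)" by (simp add: r(2))
    finally show ?thesis by simp
  qed
  show "expectation (\<lambda>x. A i x * A k x) =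
      real CARD('n) * ((w i * w k / ?W + of_bool (i = k)) / 2)
      + real CARD('n) * (real CARD('n) - 1) * ((pi / 4)\<^sup>2 * (w i * w k / ?W))"
    if ik: "i \<in> I" "k \<in> I" for i k
  proof -
    have cnt: "(\<Sum>m\<in>(UNIV::'n set). if n = m then a else b) = a + (real CARD('n) - 1) * b" for n and a b :: real
    proof -
      have "(\<Sum>m\<in>(UNIV::'n set). if n = m then a else b) = (\<Sum>m\<in>(UNIV::'n set). b + (if n = m then a - b else 0))"
        by (rule sum.cong) auto
      then show ?thesis by (simp add: sum.distrib algebra_simps)
    qed
    let ?a = "(w i * w k / ?W + of_bool (i = k)) / 2" and ?b = "(pi / 4)\<^sup>2 * (w i * w k / ?W)"
    have "expectation (\<lambda>x. A i x * A k x) = (\<Sum>n\<in>UNIV. \<Sum>m\<in>UNIV. expectation (\<lambda>x. (H n x * H m x) * (Y n i x * Y m k x)))"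
      unfolding AA[OF ik] using HY(1)[OF ik]
      by (simp add: Bochner_Integration.integral_sum Bochner_Integration.integrable_sum)
    also have "\<dots> = (\<Sum>n\<in>(UNIV::'n set). \<Sum>m\<in>(UNIV::'n set). if n = m then ?a else ?b)"
      unfolding HY(2)[OF ik] ..
    also have "\<dots> = (\<Sum>n\<in>(UNIV::'n set). ?a + (real CARD('n) - 1) * ?b)"
      by (rule sum.cong[OF refl]) (rule cnt)
    also have "\<dots> = real CARD('n) * ?a + real CARD('n) * (real CARD('n) - 1) * ?b"
      by (simp add: distrib_left)
    finally show ?thesis .
  qed
qed

end

section \<open>Conditional moments of mini-batch gradients\<close>

lemma borel_measurable_vec_iff:
  fixes f :: "'a \<Rightarrow> real^'d"
  shows "f \<in> borel_measurable N \<longleftrightarrow> (\<forall>c. (\<lambda>x. f x $ c) \<in> borel_measurable N)"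
proof
  assume "f \<in> borel_measurable N"
  then have "(\<lambda>x. f x \<bullet> axis c 1) \<in> borel_measurable N" for c by measurable
  then show "\<forall>c. (\<lambda>x. f x $ c) \<in> borel_measurable N" by (simp add: inner_axis)
next
  assume "\<forall>c. (\<lambda>x. f x $ c) \<in> borel_measurable N"
  then show "f \<in> borel_measurable N"
    by (subst borel_measurable_euclidean_space) (auto simp: Basis_vec_def inner_axis)
qed

lemma borel_measurable_nth:
  fixes f :: "'a \<Rightarrow> real^'d"
  shows "f \<in> borel_measurable N \<Longrightarrow> (\<lambda>x. f x $ c) \<in> borel_measurable N"
  using borel_measurable_vec_iff by blast

context prob_space begin

section \<open>Square-integrable random vectors and their random combinations\<close>

lemma integrable_nth_square:
  fixes y :: "'a \<Rightarrow> real^'d"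
  assumes y: "y \<in> borel_measurable M" and "integrable M (\<lambda>\<omega>. (norm (y \<omega>))\<^sup>2)"
  shows "integrable M (\<lambda>\<omega>. (y \<omega> $ c)\<^sup>2)"
proof (rule Bochner_Integration.integrable_bound[OF assms(2)])
  show "(\<lambda>\<omega>. (y \<omega> $ c)\<^sup>2) \<in> borel_measurable M"
    by (intro borel_measurable_power borel_measurable_nth y)
  have "(x $ c)\<^sup>2 \<le> (norm x)\<^sup>2" for x :: "real^'d"
    using component_le_norm_cart[of x c] by (metis abs_le_square_iff abs_norm_cancel)
  then show "AE \<omega> in M. norm ((y \<omega> $ c)\<^sup>2) \<le> norm ((norm (y \<omega>))\<^sup>2)" by simp
qed

lemma integrable_nth:
  fixes y :: "'a \<Rightarrow> real^'d"
  assumes "y \<in> borel_measurable M" "integrable M (\<lambda>x. (norm (y x))\<^sup>2)"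
  shows "integrable M (\<lambda>x. y x $ c)"
  by (rule integrable_square_imp[OF borel_measurable_nth[OF assms(1)] integrable_nth_square[OF assms]])

lemma integrable_inner_square:
  fixes x y :: "'a \<Rightarrow> real^'d"
  assumes "x \<in> borel_measurable M" "y \<in> borel_measurable M"
    and "integrable M (\<lambda>\<omega>. (norm (x \<omega>))\<^sup>2)" "integrable M (\<lambda>\<omega>. (norm (y \<omega>))\<^sup>2)"
  shows "integrable M (\<lambda>\<omega>. x \<omega> \<bullet> y \<omega>)"
  unfolding inner_vec_def inner_real_def
  by (rule Bochner_Integration.integrable_sum, rule integrable_mult_square[OF borel_measurable_nth[OF assms(1)]
        borel_measurable_nth[OF assms(2)] integrable_nth_square[OF assms(1,3)] integrable_nth_square[OF assms(2,4)]])

text \<open>\<open>J1\<close> carries the model and the transmitted vectors, \<open>J2\<close> the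
  gains, \<open>J3\<close> the noise. Expanding the square, every term separates into a moment of
  gains times a moment of vectors, and the terms linear in the centred noise vanish. Gains may
  depend on each other, and so may the vectors, since only independence between the three groups is
  invoked.\<close>

lemma random_combination_moments:
  fixes y :: "'i \<Rightarrow> 'a \<Rightarrow> real^'d" and l :: "'i \<Rightarrow> 'a \<Rightarrow> real" and \<nu> d :: "'a \<Rightarrow> real^'d"
  assumes ind: "indep_sets E J" and st: "\<And>j. j \<in> J \<Longrightarrow> Int_stable (E j)"
    and J: "J1 \<subseteq> J" "J2 \<subseteq> J" "J3 \<subseteq> J" "J1 \<inter> J2 = {}" "J1 \<inter> J3 = {}" "J2 \<inter> J3 = {}"
    and I: "finite I"
    and y: "\<And>i. i \<in> I \<Longrightarrow> y i \<in> borel_measurable (joint_algebra M E J1)"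
    and d: "d \<in> borel_measurable (joint_algebra M E J1)"
    and l: "\<And>i. i \<in> I \<Longrightarrow> l i \<in> borel_measurable (joint_algebra M E J2)"
    and n: "\<nu> \<in> borel_measurable (joint_algebra M E J3)"
    and y2: "\<And>i. i \<in> I \<Longrightarrow> integrable M (\<lambda>x. (norm (y i x))\<^sup>2)"
    and d2: "integrable M (\<lambda>x. (norm (d x))\<^sup>2)"
    and l2: "\<And>i. i \<in> I \<Longrightarrow> integrable M (\<lambda>x. (l i x)\<^sup>2)"
    and n2: "integrable M (\<lambda>x. (norm (\<nu> x))\<^sup>2)"
    and n0: "\<And>c. expectation (\<lambda>x. \<nu> x $ c) = 0"
  defines "r \<equiv> \<lambda>x. (\<Sum>i\<in>I. l i x *\<^sub>R y i x) + \<nu> x"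
  shows "r \<in> borel_measurable M"
    and "integrable M (\<lambda>x. (norm (r x))\<^sup>2)"
    and "expectation (\<lambda>x. (norm (r x))\<^sup>2) =
      (\<Sum>i\<in>I. \<Sum>k\<in>I. expectation (\<lambda>x. l i x * l k x) * expectation (\<lambda>x. y i x \<bullet> y k x))
      + expectation (\<lambda>x. (norm (\<nu> x))\<^sup>2)"
    and "integrable M (\<lambda>x. d x \<bullet> r x)"
    and "expectation (\<lambda>x. d x \<bullet> r x) = (\<Sum>i\<in>I. expectation (l i) * expectation (\<lambda>x. d x \<bullet> y i x))"
proof -
  note rv = rv_joint_algebra[OF ind]
  have yM: "y i \<in> borel_measurable M" and lM: "l i \<in> borel_measurable M" if "i \<in> I" for i
    using rv[OF J(1) y[OF that]] rv[OF J(2) l[OF that]] by auto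
  have dM: "d \<in> borel_measurable M" and nM: "\<nu> \<in> borel_measurable M"
    using rv[OF J(1) d] rv[OF J(3) n] by auto
  show rM: "r \<in> borel_measurable M"
    unfolding r_def using yM lM nM by measurable
  have pw: "E j \<subseteq> Pow (space M)" if "j \<in> J" for j
    using ind that sets.space_closed by (auto simp: indep_sets_def)
  have nc: "(\<lambda>x. \<nu> x $ c) \<in> borel_measurable (joint_algebra M E J3)" for c
    by (rule borel_measurable_nth[OF n])
  have inc: "integrable M (\<lambda>x. \<nu> x $ c)" for c
    by (rule integrable_nth[OF nM n2])
  have J12: "J1 \<union> J2 \<subseteq> J" using J by auto
  have pw12: "E j \<subseteq> Pow (space M)" if "j \<in> J1 \<union> J2" for j
    using J12 that by (intro pw) blast
  have up1: "Z \<in> borel_measurable (joint_algebra M E (J1 \<union> J2))"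
    if "Z \<in> borel_measurable (joint_algebra M E J1)" for Z :: "'a \<Rightarrow> real"
    by (rule measurable_joint_algebra_mono[of Z M E J1 borel "J1 \<union> J2", OF that _ pw12]) simp_all
  have up2: "Z \<in> borel_measurable (joint_algebra M E (J1 \<union> J2))"
    if "Z \<in> borel_measurable (joint_algebra M E J2)" for Z :: "'a \<Rightarrow> real"
    by (rule measurable_joint_algebra_mono[of Z M E J2 borel "J1 \<union> J2", OF that _ pw12]) simp_all
  \<comment> \<open>\<open>Z\<close> may mix gains and vectors, which is why the noise is separated
    from both groups at once.\<close>
  have noise: "integrable M (\<lambda>x. Z x * \<nu> x $ c) \<and> expectation (\<lambda>x. Z x * \<nu> x $ c) = 0"
    if "Z \<in> borel_measurable (joint_algebra M E (J1 \<union> J2))" "integrable M Z" for Z c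
  proof -
    have "indep_var borel (\<lambda>x. \<nu> x $ c) borel Z"
      by (rule indep_var_joint_algebra[OF ind st _ _ nc that(1)]) (use J in auto)
    from indep_zero_mean[OF this inc that(2) n0] show ?thesis by (simp add: mult.commute)
  qed
  have split: "integrable M (\<lambda>x. Z x * X x) \<and> expectation (\<lambda>x. Z x * X x) = expectation Z * expectation X"
    if "Z \<in> borel_measurable (joint_algebra M E J2)" "X \<in> borel_measurable (joint_algebra M E J1)"
      "integrable M Z" "integrable M X" for Z X :: "'a \<Rightarrow> real"
  proof -
    have "indep_var borel Z borel X"
      by (rule indep_var_joint_algebra[OF ind st _ _ that(1,2)]) (use J in auto)
    from indep_var_integrable[OF this that(3,4)] indep_var_lebesgue_integral[OF this that(3,4)]
    show ?thesis by simp
  qed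
  have il: "integrable M (l i)" if "i \<in> I" for i
    by (rule integrable_square_imp[OF lM[OF that] l2[OF that]])
  have ill: "integrable M (\<lambda>x. l i x * l k x)" if "i \<in> I" "k \<in> I" for i k
    by (rule integrable_mult_square[OF lM[OF that(1)] lM[OF that(2)] l2[OF that(1)] l2[OF that(2)]])
  have iyy: "integrable M (\<lambda>x. y i x \<bullet> y k x)" if "i \<in> I" "k \<in> I" for i k
    by (rule integrable_inner_square[OF yM[OF that(1)] yM[OF that(2)] y2[OF that(1)] y2[OF that(2)]])
  have idy: "integrable M (\<lambda>x. d x \<bullet> y i x)" if "i \<in> I" for i
    by (rule integrable_inner_square[OF dM yM[OF that] d2 y2[OF that]])
  have yc: "(\<lambda>x. y i x $ c) \<in> borel_measurable (joint_algebra M E J1)" if "i \<in> I" for i c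
    by (rule borel_measurable_nth[OF y[OF that]])
  have iyc: "integrable M (\<lambda>x. y i x $ c)" if "i \<in> I" for i c
    by (rule integrable_nth[OF yM[OF that] y2[OF that]])
  have T1: "integrable M (\<lambda>x. (l i x * l k x) * (y i x \<bullet> y k x)) \<and>
     expectation (\<lambda>x. (l i x * l k x) * (y i x \<bullet> y k x)) = expectation (\<lambda>x. l i x * l k x) * expectation (\<lambda>x. y i x \<bullet> y k x)"
    if "i \<in> I" "k \<in> I" for i k
    by (rule split[OF borel_measurable_times[OF l[OF that(1)] l[OF that(2)]]
        borel_measurable_inner[OF y[OF that(1)] y[OF that(2)]] ill[OF that] iyy[OF that]])
  have T2: "integrable M (\<lambda>x. l i x * (y i x \<bullet> \<nu> x)) \<and> expectation (\<lambda>x. l i x * (y i x \<bullet> \<nu> x)) = 0"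
    if i: "i \<in> I" for i
  proof -
    have "(\<lambda>x. l i x * y i x $ c) \<in> borel_measurable (joint_algebra M E (J1 \<union> J2))" for c
      using up1[OF yc[OF i]] up2[OF l[OF i]] by measurable
    moreover have "integrable M (\<lambda>x. l i x * y i x $ c)" for c
      using split[OF l[OF i] yc[OF i] il[OF i] iyc[OF i]] by simp
    ultimately have *: "integrable M (\<lambda>x. (l i x * y i x $ c) * \<nu> x $ c)" "expectation (\<lambda>x. (l i x * y i x $ c) * \<nu> x $ c) = 0" for c
      using noise by blast+
    have "l i x * (y i x \<bullet> \<nu> x) = (\<Sum>c\<in>UNIV. (l i x * y i x $ c) * \<nu> x $ c)" for x
      by (simp add: inner_vec_def sum_distrib_left mult.assoc)
    then show ?thesis using * by simp
  qed
  have T3: "integrable M (\<lambda>x. d x \<bullet> \<nu> x) \<and> expectation (\<lambda>x. d x \<bullet> \<nu> x) = 0"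
  proof -
    have dc: "(\<lambda>x. d x $ c) \<in> borel_measurable (joint_algebra M E (J1 \<union> J2))" for c
      by (rule up1[OF borel_measurable_nth[OF d]])
    have "integrable M (\<lambda>x. d x $ c)" for c
      by (rule integrable_nth[OF dM d2])
    then have "integrable M (\<lambda>x. d x $ c * \<nu> x $ c)" "expectation (\<lambda>x. d x $ c * \<nu> x $ c) = 0" for c
      using noise[OF dc] by blast+
    then show ?thesis by (simp add: inner_vec_def)
  qed
  have T4: "integrable M (\<lambda>x. l i x * (d x \<bullet> y i x)) \<and>
     expectation (\<lambda>x. l i x * (d x \<bullet> y i x)) = expectation (l i) * expectation (\<lambda>x. d x \<bullet> y i x)" if "i \<in> I" for i
    by (rule split[OF l[OF that] borel_measurable_inner[OF d y[OF that]] il[OF that] idy[OF that]])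
  have nr: "(norm (r x))\<^sup>2 = (\<Sum>i\<in>I. \<Sum>k\<in>I. (l i x * l k x) * (y i x \<bullet> y k x))
      + 2 * (\<Sum>i\<in>I. l i x * (y i x \<bullet> \<nu> x)) + (norm (\<nu> x))\<^sup>2" for x
  proof -
    let ?s = "\<Sum>i\<in>I. l i x *\<^sub>R y i x"
    have "(norm (r x))\<^sup>2 = ?s \<bullet> ?s + 2 * (?s \<bullet> \<nu> x) + (norm (\<nu> x))\<^sup>2"
      unfolding r_def power2_norm_eq_inner by (simp add: inner_add_left inner_add_right inner_commute)
    moreover have "?s \<bullet> ?s = (\<Sum>i\<in>I. \<Sum>k\<in>I. (l i x * l k x) * (y i x \<bullet> y k x))"
      unfolding inner_sum_left by (simp add: inner_sum_right sum_distrib_left mult_ac)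
    moreover have "?s \<bullet> \<nu> x = (\<Sum>i\<in>I. l i x * (y i x \<bullet> \<nu> x))"
      by (simp add: inner_sum_left)
    ultimately show ?thesis by simp
  qed
  show "integrable M (\<lambda>x. (norm (r x))\<^sup>2)"
    unfolding nr using T1 T2 n2
    by (intro Bochner_Integration.integrable_add integrable_mult_right Bochner_Integration.integrable_sum) auto
  show "expectation (\<lambda>x. (norm (r x))\<^sup>2) =
      (\<Sum>i\<in>I. \<Sum>k\<in>I. expectation (\<lambda>x. l i x * l k x) * expectation (\<lambda>x. y i x \<bullet> y k x))
      + expectation (\<lambda>x. (norm (\<nu> x))\<^sup>2)"
    unfolding nr using T1 T2 n2 by simp
  have dr: "d x \<bullet> r x = (\<Sum>i\<in>I. l i x * (d x \<bullet> y i x)) + d x \<bullet> \<nu> x" for x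
    unfolding r_def by (simp add: inner_add_right inner_sum_right)
  show "integrable M (\<lambda>x. d x \<bullet> r x)"
    unfolding dr using T3 T4 by (intro Bochner_Integration.integrable_add Bochner_Integration.integrable_sum) auto
  show "expectation (\<lambda>x. d x \<bullet> r x) = (\<Sum>i\<in>I. expectation (l i) * expectation (\<lambda>x. d x \<bullet> y i x))"
    unfolding dr using T3 T4 by simp
qed

text \<open>The given conditional mean refers to the model \<open>w\<close> alone, but products with
  variables \<open>Z\<close> built from further sources are needed. The batch takes finitely many
  values and is independent of the rest, so averaging the gradient over its law yields a function
  \<open>m\<close> of the model that is the conditional mean given \<open>w\<close> and also
  replaces \<open>g\<close> next to any \<open>Z\<close> that does not involve the batch. Uniqueness
  identifies \<open>h (w \<omega>)\<close> with \<open>m (w \<omega>)\<close> almost surely.\<close>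

lemma minibatch_moments:
  fixes \<Gamma> :: "'b \<Rightarrow> real^'d \<Rightarrow> real^'d" and B :: "'a \<Rightarrow> 'b" and w g :: "'a \<Rightarrow> real^'d" and h :: "real^'d \<Rightarrow> real^'d"
  assumes ind: "indep_sets E J" and st: "\<And>j. j \<in> J \<Longrightarrow> Int_stable (E j)"
    and bp: "b \<in> J" "p \<in> J" "b \<noteq> p"
    and B: "\<And>C. B -` {C} \<inter> space M \<in> E b"
    and w: "w \<in> borel_measurable (joint_algebra M E {p})"
    and CC: "finite CC" "\<And>\<omega>. \<omega> \<in> space M \<Longrightarrow> B \<omega> \<in> CC"
    and \<Gamma>: "\<And>C. C \<in> CC \<Longrightarrow> \<Gamma> C \<in> borel_measurable borel"
    and g: "\<And>\<omega>. \<omega> \<in> space M \<Longrightarrow> g \<omega> = \<Gamma> (B \<omega>) (w \<omega>)"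
    and G: "0 \<le> G" "\<And>\<omega>. \<omega> \<in> space M \<Longrightarrow> norm (g \<omega>) \<le> G"
    and h: "h \<in> borel_measurable borel"
    and cm: "AE \<omega> in M. cond_mean M w g \<omega> = h (w \<omega>)"
    and cv: "AE \<omega> in M. cond_variance M w g \<omega> \<le> v"
  shows "g \<in> borel_measurable (joint_algebra M E {p, b})"
    and "integrable M (\<lambda>\<omega>. (norm (g \<omega>))\<^sup>2)"
    and "integrable M (\<lambda>\<omega>. (norm (h (w \<omega>)))\<^sup>2)"
    and "\<And>J' Z c. J' \<subseteq> J \<Longrightarrow> p \<in> J' \<Longrightarrow> b \<notin> J' \<Longrightarrow> Z \<in> borel_measurable (joint_algebra M E J') \<Longrightarrow> integrable M Z \<Longrightarrow>
      integrable M (\<lambda>\<omega>. g \<omega> $ c * Z \<omega>) \<and> integrable M (\<lambda>\<omega>. h (w \<omega>) $ c * Z \<omega>) \<and>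
      expectation (\<lambda>\<omega>. g \<omega> $ c * Z \<omega>) = expectation (\<lambda>\<omega>. h (w \<omega>) $ c * Z \<omega>)"
    and "expectation (\<lambda>\<omega>. (norm (g \<omega>))\<^sup>2) \<le> expectation (\<lambda>\<omega>. (norm (h (w \<omega>)))\<^sup>2) + v"
proof -
  \<comment> \<open>\<open>\<Gamma> C (w \<omega>)\<close> may be unbounded where \<open>B \<omega> \<noteq> C\<close>; truncation makes it integrable
    and changes nothing where \<open>B \<omega> = C\<close>\<close>
  define \<Gamma>' where "\<Gamma>' C x = (if norm (\<Gamma> C x) \<le> G then \<Gamma> C x else 0)" for C x
  have \<Gamma>'[measurable]: "\<Gamma>' C \<in> borel_measurable borel" if "C \<in> CC" for C
    unfolding \<Gamma>'_def[abs_def] using \<Gamma>[OF that] by measurable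
  have \<Gamma>'b: "norm (\<Gamma>' C x) \<le> G" for C x using G(1) by (simp add: \<Gamma>'_def)
  define D where "D C = B -` {C} \<inter> space M" for C
  \<comment> \<open>The gradient at the fixed model \<open>x\<close>, averaged over the law of the
    batch.\<close>
  define m where "m x = (\<Sum>C\<in>CC. prob (D C) *\<^sub>R \<Gamma>' C x)" for x
  have pw: "E j \<subseteq> Pow (space M)" if "j \<in> J" for j
    using ind that sets.space_closed by (auto simp: indep_sets_def)
  have gsum: "g \<omega> = (\<Sum>C\<in>CC. indicator (D C) \<omega> *\<^sub>R \<Gamma>' C (w \<omega>))" if "\<omega> \<in> space M" for \<omega>
  proof -
    have "(\<Sum>C\<in>CC. indicator (D C) \<omega> *\<^sub>R \<Gamma>' C (w \<omega>)) = (\<Sum>C\<in>CC. if C = B \<omega> then \<Gamma>' C (w \<omega>) else 0)"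
      using that by (intro sum.cong) (auto simp: D_def indicator_def)
    also have "\<dots> = \<Gamma>' (B \<omega>) (w \<omega>)" using CC that by simp
    also have "\<dots> = g \<omega>" using G(2)[OF that] g[OF that] by (simp add: \<Gamma>'_def)
    finally show ?thesis by simp
  qed
  have sJ: "sets (joint_algebra M E J') = sigma_sets (space M) (\<Union>j\<in>J'. E j)" if "J' \<subseteq> J" for J'
    by (rule sets_joint_algebra_indep(1)[OF ind that])
  have Dset: "D C \<in> sets (joint_algebra M E J')" if "b \<in> J'" "J' \<subseteq> J" for C J'
    unfolding sJ[OF that(2)] using B that by (auto simp: D_def intro!: sigma_sets.Basic)
  have wJ: "w \<in> borel_measurable (joint_algebra M E J')" if "p \<in> J'" "J' \<subseteq> J" for J'
  proof (rule measurable_joint_algebra_mono[of w M E "{p}" borel J', OF w])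
    show "E j \<subseteq> Pow (space M)" if "j \<in> J'" for j using that \<open>J' \<subseteq> J\<close> by (intro pw) blast
  qed (use that in simp)
  have wM[measurable]: "w \<in> borel_measurable M"
    using bp by (intro rv_joint_algebra[OF ind _ w]) auto
  have pb: "{p, b} \<subseteq> J" using bp by auto
  show gpb: "g \<in> borel_measurable (joint_algebra M E {p, b})"
  proof -
    have [measurable]: "D C \<in> sets (joint_algebra M E {p, b})" for C
      by (rule Dset[OF _ pb]) simp
    have [measurable]: "w \<in> borel_measurable (joint_algebra M E {p, b})"
      by (rule wJ[OF _ pb]) simp
    have "(\<lambda>\<omega>. \<Sum>C\<in>CC. indicator (D C) \<omega> *\<^sub>R \<Gamma>' C (w \<omega>)) \<in> borel_measurable (joint_algebra M E {p, b})"
      by measurable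
    then show ?thesis
      by (rule measurable_cong[THEN iffD2, rotated]) (simp add: gsum)
  qed
  have gM[measurable]: "g \<in> borel_measurable M" by (rule rv_joint_algebra[OF ind pb gpb])
  have hw[measurable]: "(\<lambda>\<omega>. h (w \<omega>)) \<in> borel_measurable M" using h by measurable
  have mM[measurable]: "m \<in> borel_measurable borel" unfolding m_def[abs_def] by measurable
  have mb: "norm (m x) \<le> real (card CC) * G" for x
  proof -
    have "norm (m x) \<le> (\<Sum>C\<in>CC. norm (prob (D C) *\<^sub>R \<Gamma>' C x))" unfolding m_def by (rule norm_sum)
    also have "\<dots> \<le> (\<Sum>C\<in>CC. 1 * G)"
      using \<Gamma>'b prob_le_1 by (intro sum_mono) (simp, intro mult_mono[of _ 1 _ G, simplified], auto)
    finally show ?thesis by simp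
  qed
  have bmul: "integrable M (\<lambda>\<omega>. x \<omega> $ c * Z \<omega>)"
    if "x \<in> borel_measurable M" "\<And>\<omega>. \<omega> \<in> space M \<Longrightarrow> norm (x \<omega>) \<le> R" "integrable M Z" for x :: "'a \<Rightarrow> real^'d" and c Z R
  proof (rule Bochner_Integration.integrable_bound[of _ "\<lambda>\<omega>. R * Z \<omega>"])
    show "integrable M (\<lambda>\<omega>. R * Z \<omega>)" using that(3) by simp
    show "(\<lambda>\<omega>. x \<omega> $ c * Z \<omega>) \<in> borel_measurable M"
      by (rule borel_measurable_times[OF borel_measurable_nth[OF that(1)] borel_measurable_integrable[OF that(3)]])
    show "AE \<omega> in M. norm (x \<omega> $ c * Z \<omega>) \<le> norm (R * Z \<omega>)"
    proof (rule AE_I2)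
      fix \<omega> assume "\<omega> \<in> space M"
      then have "\<bar>x \<omega> $ c\<bar> \<le> \<bar>R\<bar>" using that(2)[of \<omega>] component_le_norm_cart[of "x \<omega>" c] by linarith
      then show "norm (x \<omega> $ c * Z \<omega>) \<le> norm (R * Z \<omega>)" by (simp add: abs_mult mult_right_mono)
    qed
  qed
  \<comment> \<open>Decompose over the value \<open>C\<close> of the batch: the indicator of
    \<open>D C\<close> is independent of the factor built from \<open>w\<close> and
    \<open>Z\<close>, so it can be replaced by its probability.\<close>
  have core: "integrable M (\<lambda>\<omega>. g \<omega> $ c * Z \<omega>) \<and> integrable M (\<lambda>\<omega>. m (w \<omega>) $ c * Z \<omega>) \<and>
      expectation (\<lambda>\<omega>. g \<omega> $ c * Z \<omega>) = expectation (\<lambda>\<omega>. m (w \<omega>) $ c * Z \<omega>)"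
    if J': "J' \<subseteq> J" "p \<in> J'" "b \<notin> J'" and Z: "Z \<in> borel_measurable (joint_algebra M E J')" "integrable M Z" for J' Z c
  proof (intro conjI)
    show "integrable M (\<lambda>\<omega>. g \<omega> $ c * Z \<omega>)" by (rule bmul[OF gM G(2) Z(2)])
    show "integrable M (\<lambda>\<omega>. m (w \<omega>) $ c * Z \<omega>)" by (rule bmul[OF _ mb Z(2)]) measurable
    have it: "integrable M (\<lambda>\<omega>. \<Gamma>' C (w \<omega>) $ c * Z \<omega>)" if "C \<in> CC" for C
      by (rule bmul[OF _ \<Gamma>'b Z(2)]) (use \<Gamma>'[OF that] in measurable)
    have ind1: "indep_var borel (indicator (D C) :: 'a \<Rightarrow> real) borel (\<lambda>\<omega>. \<Gamma>' C (w \<omega>) $ c * Z \<omega>)" if C: "C \<in> CC" for C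
    proof (rule indep_var_joint_algebra[OF ind st])
      show "(indicator (D C) :: 'a \<Rightarrow> real) \<in> borel_measurable (joint_algebra M E {b})"
        using Dset[of "{b}" C] bp by (intro borel_measurable_indicator) auto
      have "(\<lambda>\<omega>. \<Gamma>' C (w \<omega>)) \<in> borel_measurable (joint_algebra M E J')"
        by (rule measurable_compose[OF wJ[OF J'(2,1)] \<Gamma>'[OF C]])
      then show "(\<lambda>\<omega>. \<Gamma>' C (w \<omega>) $ c * Z \<omega>) \<in> borel_measurable (joint_algebra M E J')"
        by (intro borel_measurable_times borel_measurable_nth Z(1))
    qed (use J' bp in auto)
    have DM: "D C \<in> events" for C using B bp ind by (auto simp: D_def indep_sets_def)
    have iI: "integrable M (indicator (D C) :: 'a \<Rightarrow> real)" for C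
      by (rule integrable_real_indicator[OF DM]) (simp add: less_top[symmetric])
    note ii = indep_var_integrable[OF ind1 iI it] and ie = indep_var_lebesgue_integral[OF ind1 iI it]
    have "expectation (\<lambda>\<omega>. g \<omega> $ c * Z \<omega>) = expectation (\<lambda>\<omega>. \<Sum>C\<in>CC. indicator (D C) \<omega> * (\<Gamma>' C (w \<omega>) $ c * Z \<omega>))"
      by (rule Bochner_Integration.integral_cong) (simp_all add: gsum sum_distrib_right mult.assoc)
    also have "\<dots> = (\<Sum>C\<in>CC. prob (D C) * expectation (\<lambda>\<omega>. \<Gamma>' C (w \<omega>) $ c * Z \<omega>))"
      using ii DM by (subst Bochner_Integration.integral_sum) (auto simp: ie)
    also have "\<dots> = expectation (\<lambda>\<omega>. \<Sum>C\<in>CC. prob (D C) * (\<Gamma>' C (w \<omega>) $ c * Z \<omega>))"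
      using it by (subst Bochner_Integration.integral_sum) auto
    also have "\<dots> = expectation (\<lambda>\<omega>. m (w \<omega>) $ c * Z \<omega>)"
      by (rule Bochner_Integration.integral_cong) (simp_all add: m_def sum_distrib_right mult.assoc)
    finally show "expectation (\<lambda>\<omega>. g \<omega> $ c * Z \<omega>) = expectation (\<lambda>\<omega>. m (w \<omega>) $ c * Z \<omega>)" .
  qed
  let ?V = "vimage_algebra (space M) w borel"
  have subV: "subalgebra M ?V"
    unfolding subalgebra_def using measurable_sets[OF wM] by (auto simp: sets_vimage_algebra2)
  interpret V: finite_measure_subalgebra M ?V
    using subV by unfold_locales
  have wV: "w \<in> borel_measurable ?V" by (rule measurable_vimage_algebra1) simp
  have gc: "integrable M (\<lambda>\<omega>. g \<omega> $ c)" for c using bmul[OF gM G(2), of "\<lambda>_. 1"] by simp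
  have mc: "integrable M (\<lambda>\<omega>. m (w \<omega>) $ c)" for c
    using bmul[of "\<lambda>\<omega>. m (w \<omega>)" _ "\<lambda>_. 1" c, OF measurable_compose[OF wM mM] mb] by simp
  \<comment> \<open>The characterizing integrals are \<open>core\<close> with \<open>Z\<close> the
    indicator of an event determined by \<open>w\<close>.\<close>
  have ce: "AE \<omega> in M. real_cond_exp M ?V (\<lambda>\<omega>'. g \<omega>' $ c) \<omega> = m (w \<omega>) $ c" for c
  proof (rule V.real_cond_exp_charact)
    fix A assume "A \<in> sets ?V"
    then obtain S where S: "S \<in> sets borel" "A = w -` S \<inter> space M" by (auto simp: sets_vimage_algebra2)
    have "A \<in> sets (joint_algebra M E {p})" using measurable_sets[OF w S(1)] S(2) by simp
    then have "(indicator A :: 'a \<Rightarrow> real) \<in> borel_measurable (joint_algebra M E {p})" by simp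
    moreover have "integrable M (indicator A :: 'a \<Rightarrow> real)"
      using S by (intro integrable_real_indicator) (auto simp: less_top[symmetric])
    ultimately show "set_lebesgue_integral M A (\<lambda>\<omega>. g \<omega> $ c) = set_lebesgue_integral M A (\<lambda>\<omega>. m (w \<omega>) $ c)"
      using core[of "{p}" "indicator A" c] bp by (simp add: set_lebesgue_integral_def mult.commute)
  next
    show "(\<lambda>\<omega>. m (w \<omega>) $ c) \<in> borel_measurable ?V"
      by (rule borel_measurable_nth[OF measurable_compose[OF wV mM]])
  qed (use gc mc in auto)
  have mean: "AE \<omega> in M. cond_mean M w g \<omega> = m (w \<omega>)"
  proof -
    have "AE \<omega> in M. \<forall>c\<in>UNIV. real_cond_exp M ?V (\<lambda>\<omega>'. g \<omega>' $ c) \<omega> = m (w \<omega>) $ c"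
      by (rule AE_finite_allI[OF finite]) (rule ce)
    then show ?thesis by (simp add: cond_mean_def vec_eq_iff)
  qed
  have hm: "AE \<omega> in M. h (w \<omega>) = m (w \<omega>)" using cm mean by eventually_elim simp
  show g2: "integrable M (\<lambda>\<omega>. (norm (g \<omega>))\<^sup>2)"
    using G by (intro integrable_const_bound[where B = "G\<^sup>2"]) (auto intro!: power_mono)
  have m2: "integrable M (\<lambda>\<omega>. (norm (m (w \<omega>)))\<^sup>2)"
    using mb by (intro integrable_const_bound[where B = "(real (card CC) * G)\<^sup>2"]) (auto intro!: power_mono)
  show "integrable M (\<lambda>\<omega>. (norm (h (w \<omega>)))\<^sup>2)"
    by (rule integrable_cong_AE[THEN iffD2, OF _ _ _ m2]) (use hm in auto)
  show "integrable M (\<lambda>\<omega>. g \<omega> $ c * Z \<omega>) \<and> integrable M (\<lambda>\<omega>. h (w \<omega>) $ c * Z \<omega>) \<and>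
      expectation (\<lambda>\<omega>. g \<omega> $ c * Z \<omega>) = expectation (\<lambda>\<omega>. h (w \<omega>) $ c * Z \<omega>)"
    if J': "J' \<subseteq> J" "p \<in> J'" "b \<notin> J'" and Z: "Z \<in> borel_measurable (joint_algebra M E J')" "integrable M Z" for J' Z c
  proof -
    have ae: "AE \<omega> in M. h (w \<omega>) $ c * Z \<omega> = m (w \<omega>) $ c * Z \<omega>" using hm by eventually_elim simp
    have ZM: "Z \<in> borel_measurable M" using Z(2) by auto
    have meas: "(\<lambda>\<omega>. h (w \<omega>) $ c * Z \<omega>) \<in> borel_measurable M" "(\<lambda>\<omega>. m (w \<omega>) $ c * Z \<omega>) \<in> borel_measurable M"
      by (intro borel_measurable_times borel_measurable_nth hw ZM measurable_compose[OF wM mM])+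
    show ?thesis
      using core[OF J' Z, of c] integrable_cong_AE[OF meas ae] integral_cong_AE[OF meas ae] by simp
  qed
  let ?f = "\<lambda>\<omega>. (norm (g \<omega> - cond_mean M w g \<omega>))\<^sup>2"
  have cmM: "cond_mean M w g \<in> borel_measurable M"
    unfolding borel_measurable_vec_iff cond_mean_def by simp
  have diff2: "integrable M (\<lambda>\<omega>. (norm (g \<omega> - m (w \<omega>)))\<^sup>2)"
    by (intro integrable_const_bound[where B = "(G + real (card CC) * G)\<^sup>2"])
      (auto intro!: power_mono order_trans[OF norm_triangle_ineq4] add_mono G mb AE_I2)
  have fae: "AE \<omega> in M. ?f \<omega> = (norm (g \<omega> - m (w \<omega>)))\<^sup>2" using mean by eventually_elim simp
  have fM: "?f \<in> borel_measurable M" "(\<lambda>\<omega>. (norm (g \<omega> - m (w \<omega>)))\<^sup>2) \<in> borel_measurable M" using cmM by measurable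
  have fi: "integrable M ?f" using integrable_cong_AE[OF fM fae] diff2 by simp
  have "expectation (\<lambda>\<omega>. (norm (g \<omega> - m (w \<omega>)))\<^sup>2) = expectation (real_cond_exp M ?V ?f)"
    using V.real_cond_exp_int(2)[OF fi] integral_cong_AE[OF fM fae] by simp
  also have "\<dots> \<le> expectation (\<lambda>_. v)"
    using cv V.real_cond_exp_int(1)[OF fi] by (intro integral_mono_AE) (auto simp: cond_variance_def)
  finally have le: "expectation (\<lambda>\<omega>. (norm (g \<omega> - m (w \<omega>)))\<^sup>2) \<le> v" by (simp add: prob_space)
  have gm: "integrable M (\<lambda>\<omega>. g \<omega> \<bullet> m (w \<omega>)) \<and> expectation (\<lambda>\<omega>. g \<omega> \<bullet> m (w \<omega>)) = expectation (\<lambda>\<omega>. (norm (m (w \<omega>)))\<^sup>2)"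
  proof -
    have "(\<lambda>\<omega>. m (w \<omega>) $ c) \<in> borel_measurable (joint_algebra M E {p})" for c
      by (rule borel_measurable_nth[OF measurable_compose[OF w mM]])
    note * = core[of "{p}", OF _ _ _ this mc]
    show ?thesis
      unfolding power2_norm_eq_inner inner_vec_def using * bp by simp
  qed
  \<comment> \<open>Bias-variance identity: by \<open>gm\<close> the mixed term equals twice the
    squared mean, which leaves the difference of the two second moments.\<close>
  have "expectation (\<lambda>\<omega>. (norm (g \<omega> - m (w \<omega>)))\<^sup>2) = expectation (\<lambda>\<omega>. (norm (g \<omega>))\<^sup>2 - 2 * (g \<omega> \<bullet> m (w \<omega>)) + (norm (m (w \<omega>)))\<^sup>2)"
    by (rule Bochner_Integration.integral_cong) (simp_all add: power2_norm_eq_inner inner_diff_left inner_diff_right inner_commute)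
  also have "\<dots> = expectation (\<lambda>\<omega>. (norm (g \<omega>))\<^sup>2) - expectation (\<lambda>\<omega>. (norm (m (w \<omega>)))\<^sup>2)"
    using g2 m2 gm by simp
  also have "expectation (\<lambda>\<omega>. (norm (m (w \<omega>)))\<^sup>2) = expectation (\<lambda>\<omega>. (norm (h (w \<omega>)))\<^sup>2)"
    by (rule integral_cong_AE) (use hm in auto)
  finally show "expectation (\<lambda>\<omega>. (norm (g \<omega>))\<^sup>2) \<le> expectation (\<lambda>\<omega>. (norm (h (w \<omega>)))\<^sup>2) + v"
    using le by simp
qed

end

text \<open>Batches of different devices are independent, so an off-diagonal inner product has the
  same expectation as that of the true gradients. Only the K diagonal terms pay the variance
  \<open>v\<close>, which makes it enter the mean gradient as \<open>v / K\<close>.\<close>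

lemma (in prob_space) average_gradient_moments:
  fixes \<Gamma> :: "nat \<Rightarrow> 'b \<Rightarrow> real^'d \<Rightarrow> real^'d" and B :: "nat \<Rightarrow> 'a \<Rightarrow> 'b"
    and w :: "'a \<Rightarrow> real^'d" and g :: "nat \<Rightarrow> 'a \<Rightarrow> real^'d" and h :: "nat \<Rightarrow> real^'d \<Rightarrow> real^'d"
  assumes K: "1 \<le> K"
    and ind: "indep_sets E J" and st: "\<And>j. j \<in> J \<Longrightarrow> Int_stable (E j)"
    and bp: "\<And>k. k \<in> {1..K} \<Longrightarrow> b k \<in> J" "p \<in> J" "\<And>k. k \<in> {1..K} \<Longrightarrow> b k \<noteq> p" "inj_on b {1..K}"
    and B: "\<And>k C. k \<in> {1..K} \<Longrightarrow> B k -` {C} \<inter> space M \<in> E (b k)"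
    and w: "w \<in> borel_measurable (joint_algebra M E {p})"
    and CC: "finite CC" "\<And>k \<omega>. k \<in> {1..K} \<Longrightarrow> \<omega> \<in> space M \<Longrightarrow> B k \<omega> \<in> CC"
    and \<Gamma>: "\<And>k C. k \<in> {1..K} \<Longrightarrow> C \<in> CC \<Longrightarrow> \<Gamma> k C \<in> borel_measurable borel"
    and g: "\<And>k \<omega>. k \<in> {1..K} \<Longrightarrow> \<omega> \<in> space M \<Longrightarrow> g k \<omega> = \<Gamma> k (B k \<omega>) (w \<omega>)"
    and G: "0 \<le> G" "\<And>k \<omega>. k \<in> {1..K} \<Longrightarrow> \<omega> \<in> space M \<Longrightarrow> norm (g k \<omega>) \<le> G"
    and h: "\<And>k. k \<in> {1..K} \<Longrightarrow> h k \<in> borel_measurable borel"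
    and cm: "\<And>k. k \<in> {1..K} \<Longrightarrow> AE \<omega> in M. cond_mean M w (g k) \<omega> = h k (w \<omega>)"
    and cv: "\<And>k. k \<in> {1..K} \<Longrightarrow> AE \<omega> in M. cond_variance M w (g k) \<omega> \<le> v"
    and hF: "\<And>x. hF x = (\<Sum>k=1..K. h k x) /\<^sub>R real K"
  shows "\<And>k. k \<in> {1..K} \<Longrightarrow> g k \<in> borel_measurable (joint_algebra M E ({p} \<union> b ` {1..K}))"
    and "\<And>k. k \<in> {1..K} \<Longrightarrow> integrable M (\<lambda>\<omega>. (norm (g k \<omega>))\<^sup>2)"
    and "\<And>k. k \<in> {1..K} \<Longrightarrow> integrable M (\<lambda>\<omega>. (norm (h k (w \<omega>)))\<^sup>2)"
    and "integrable M (\<lambda>\<omega>. (norm (hF (w \<omega>)))\<^sup>2)"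
    and "(\<Sum>k=1..K. expectation (\<lambda>\<omega>. hF (w \<omega>) \<bullet> g k \<omega>)) = real K * expectation (\<lambda>\<omega>. (norm (hF (w \<omega>)))\<^sup>2)"
    and "(\<Sum>i=1..K. \<Sum>k=1..K. expectation (\<lambda>\<omega>. g i \<omega> \<bullet> g k \<omega>))
      \<le> (real K)\<^sup>2 * expectation (\<lambda>\<omega>. (norm (hF (w \<omega>)))\<^sup>2) + real K * v"
    and "\<And>k. k \<in> {1..K} \<Longrightarrow> expectation (\<lambda>\<omega>. (norm (g k \<omega>))\<^sup>2) \<le> expectation (\<lambda>\<omega>. (norm (h k (w \<omega>)))\<^sup>2) + v"
proof -
  have mm: "g k \<in> borel_measurable (joint_algebra M E {p, b k})"
    "integrable M (\<lambda>\<omega>. (norm (g k \<omega>))\<^sup>2)"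
    "integrable M (\<lambda>\<omega>. (norm (h k (w \<omega>)))\<^sup>2)"
    "\<And>J' Z c. J' \<subseteq> J \<Longrightarrow> p \<in> J' \<Longrightarrow> b k \<notin> J' \<Longrightarrow> Z \<in> borel_measurable (joint_algebra M E J') \<Longrightarrow> integrable M Z \<Longrightarrow>
      integrable M (\<lambda>\<omega>. g k \<omega> $ c * Z \<omega>) \<and> integrable M (\<lambda>\<omega>. h k (w \<omega>) $ c * Z \<omega>) \<and>
      expectation (\<lambda>\<omega>. g k \<omega> $ c * Z \<omega>) = expectation (\<lambda>\<omega>. h k (w \<omega>) $ c * Z \<omega>)"
    "expectation (\<lambda>\<omega>. (norm (g k \<omega>))\<^sup>2) \<le> expectation (\<lambda>\<omega>. (norm (h k (w \<omega>)))\<^sup>2) + v"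
    if k: "k \<in> {1..K}" for k
    by (rule minibatch_moments[OF ind st bp(1)[OF k] bp(2) bp(3)[OF k] B[OF k] w CC(1) CC(2)[OF k] \<Gamma>[OF k]
          g[OF k] G(1) G(2)[OF k] h[OF k] cm[OF k] cv[OF k]]; assumption)+
  show "integrable M (\<lambda>\<omega>. (norm (g k \<omega>))\<^sup>2)" "integrable M (\<lambda>\<omega>. (norm (h k (w \<omega>)))\<^sup>2)"
    "expectation (\<lambda>\<omega>. (norm (g k \<omega>))\<^sup>2) \<le> expectation (\<lambda>\<omega>. (norm (h k (w \<omega>)))\<^sup>2) + v" if "k \<in> {1..K}" for k
    using mm(2,3,5)[OF that] by auto
  have pw: "E j \<subseteq> Pow (space M)" if "j \<in> J" for j
    using ind that sets.space_closed by (auto simp: indep_sets_def)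
  show gJ: "g k \<in> borel_measurable (joint_algebra M E ({p} \<union> b ` {1..K}))" if "k \<in> {1..K}" for k
  proof (rule measurable_joint_algebra_mono[OF mm(1)[OF that]])
    show "{p, b k} \<subseteq> {p} \<union> b ` {1..K}" using that by auto
    show "E j \<subseteq> Pow (space M)" if "j \<in> {p} \<union> b ` {1..K}" for j using that bp by (intro pw) auto
  qed
  have hp: "(\<lambda>\<omega>. h k (w \<omega>)) \<in> borel_measurable (joint_algebra M E {p})" if "k \<in> {1..K}" for k
    by (rule measurable_compose[OF w h[OF that]])
  have hM: "(\<lambda>\<omega>. h k (w \<omega>)) \<in> borel_measurable M" if "k \<in> {1..K}" for k
    using bp by (intro rv_joint_algebra[OF ind _ hp[OF that]]) auto
  have hFp: "(\<lambda>\<omega>. hF (w \<omega>)) \<in> borel_measurable (joint_algebra M E {p})"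
    unfolding hF by (intro borel_measurable_scaleR borel_measurable_const borel_measurable_sum hp) auto
  have hFM: "(\<lambda>\<omega>. hF (w \<omega>)) \<in> borel_measurable M"
    using bp by (intro rv_joint_algebra[OF ind _ hFp]) auto
  have ihh: "integrable M (\<lambda>\<omega>. h i (w \<omega>) \<bullet> h k (w \<omega>))" if "i \<in> {1..K}" "k \<in> {1..K}" for i k
    by (rule integrable_inner_square[OF hM[OF that(1)] hM[OF that(2)] mm(3)[OF that(1)] mm(3)[OF that(2)]])
  have nF: "(real K)\<^sup>2 * (norm (hF (w \<omega>)))\<^sup>2 = (\<Sum>i=1..K. \<Sum>k=1..K. h i (w \<omega>) \<bullet> h k (w \<omega>))" for \<omega>
  proof -
    have "(real K)\<^sup>2 * (norm (hF (w \<omega>)))\<^sup>2 = (norm (\<Sum>k=1..K. h k (w \<omega>)))\<^sup>2"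
      using K by (simp add: hF power_mult_distrib[symmetric])
    also have "\<dots> = (\<Sum>i=1..K. \<Sum>k=1..K. h i (w \<omega>) \<bullet> h k (w \<omega>))"
      unfolding power2_norm_eq_inner inner_sum_left by (simp add: inner_sum_right inner_commute)
    finally show ?thesis .
  qed
  have "integrable M (\<lambda>\<omega>. (real K)\<^sup>2 * (norm (hF (w \<omega>)))\<^sup>2)"
    unfolding nF using ihh by (intro Bochner_Integration.integrable_sum) auto
  then show iF: "integrable M (\<lambda>\<omega>. (norm (hF (w \<omega>)))\<^sup>2)" using K by simp
  have EF: "(real K)\<^sup>2 * expectation (\<lambda>\<omega>. (norm (hF (w \<omega>)))\<^sup>2) = (\<Sum>i=1..K. \<Sum>k=1..K. expectation (\<lambda>\<omega>. h i (w \<omega>) \<bullet> h k (w \<omega>)))"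
  proof -
    have "(real K)\<^sup>2 * expectation (\<lambda>\<omega>. (norm (hF (w \<omega>)))\<^sup>2) = expectation (\<lambda>\<omega>. \<Sum>i=1..K. \<Sum>k=1..K. h i (w \<omega>) \<bullet> h k (w \<omega>))"
      unfolding nF[symmetric] by simp
    also have "\<dots> = (\<Sum>i=1..K. expectation (\<lambda>\<omega>. \<Sum>k=1..K. h i (w \<omega>) \<bullet> h k (w \<omega>)))"
      using ihh by (intro Bochner_Integration.integral_sum Bochner_Integration.integrable_sum) auto
    also have "\<dots> = (\<Sum>i=1..K. \<Sum>k=1..K. expectation (\<lambda>\<omega>. h i (w \<omega>) \<bullet> h k (w \<omega>)))"
      using ihh by (intro sum.cong refl Bochner_Integration.integral_sum) auto
    finally show ?thesis .
  qed
  have dg: "expectation (\<lambda>\<omega>. g k \<omega> \<bullet> Z \<omega>) = expectation (\<lambda>\<omega>. h k (w \<omega>) \<bullet> Z \<omega>)"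
    if k: "k \<in> {1..K}" and J': "J' \<subseteq> J" "p \<in> J'" "b k \<notin> J'"
      and Z: "Z \<in> borel_measurable (joint_algebra M E J')" "integrable M (\<lambda>\<omega>. (norm (Z \<omega>))\<^sup>2)" for k J' and Z :: "'a \<Rightarrow> real^'d"
  proof -
    have ZM: "Z \<in> borel_measurable M" by (rule rv_joint_algebra[OF ind J'(1) Z(1)])
    note * = mm(4)[OF k J' borel_measurable_nth[OF Z(1)] integrable_nth[OF ZM Z(2)]]
    show ?thesis
      unfolding inner_vec_def inner_real_def using * by (simp add: Bochner_Integration.integral_sum)
  qed
  have "(\<Sum>k=1..K. expectation (\<lambda>\<omega>. hF (w \<omega>) \<bullet> g k \<omega>)) = (\<Sum>k=1..K. expectation (\<lambda>\<omega>. h k (w \<omega>) \<bullet> hF (w \<omega>)))"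
    using dg[of _ "{p}" "\<lambda>\<omega>. hF (w \<omega>)", OF _ _ _ _ hFp iF] bp by (intro sum.cong refl) (auto simp: inner_commute)
  also have "\<dots> = expectation (\<lambda>\<omega>. (\<Sum>k=1..K. h k (w \<omega>)) \<bullet> hF (w \<omega>))"
    unfolding inner_sum_left
    by (rule Bochner_Integration.integral_sum[symmetric]) (rule integrable_inner_square[OF hM hFM mm(3) iF])
  also have "\<dots> = expectation (\<lambda>\<omega>. real K * (norm (hF (w \<omega>)))\<^sup>2)"
  proof (rule Bochner_Integration.integral_cong[OF refl])
    fix \<omega>
    have "(\<Sum>k=1..K. h k (w \<omega>)) = real K *\<^sub>R hF (w \<omega>)" using K by (simp add: hF)
    then show "(\<Sum>k=1..K. h k (w \<omega>)) \<bullet> hF (w \<omega>) = real K * (norm (hF (w \<omega>)))\<^sup>2"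
      by (simp add: power2_norm_eq_inner)
  qed
  finally show "(\<Sum>k=1..K. expectation (\<lambda>\<omega>. hF (w \<omega>) \<bullet> g k \<omega>)) = real K * expectation (\<lambda>\<omega>. (norm (hF (w \<omega>)))\<^sup>2)"
    by simp
  have "expectation (\<lambda>\<omega>. g i \<omega> \<bullet> g k \<omega>) \<le> expectation (\<lambda>\<omega>. h i (w \<omega>) \<bullet> h k (w \<omega>)) + (if i = k then v else 0)"
    if i: "i \<in> {1..K}" and k: "k \<in> {1..K}" for i k
  proof (cases "i = k")
    case True
    then show ?thesis using mm(5)[OF k] by (simp add: power2_norm_eq_inner)
  next
    case False
    \<comment> \<open>The two gradients are replaced one after the other: batch \<open>i\<close> is
      averaged while \<open>g k\<close> is kept as the partner, then batch \<open>k\<close> with the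
      partner \<open>h i (w \<omega>)\<close>.\<close>
    have "expectation (\<lambda>\<omega>. g i \<omega> \<bullet> g k \<omega>) = expectation (\<lambda>\<omega>. h i (w \<omega>) \<bullet> g k \<omega>)"
      by (rule dg[OF i _ _ _ mm(1)[OF k] mm(2)[OF k]]) (use bp i k False in \<open>auto simp: inj_on_eq_iff\<close>)
    also have "\<dots> = expectation (\<lambda>\<omega>. g k \<omega> \<bullet> h i (w \<omega>))" by (simp add: inner_commute)
    also have "\<dots> = expectation (\<lambda>\<omega>. h k (w \<omega>) \<bullet> h i (w \<omega>))"
      by (rule dg[OF k _ _ _ hp[OF i] mm(3)[OF i]]) (use bp i k False in auto)
    finally show ?thesis using False by (simp add: inner_commute)
  qed
  then have "(\<Sum>i=1..K. \<Sum>k=1..K. expectation (\<lambda>\<omega>. g i \<omega> \<bullet> g k \<omega>))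
    \<le> (\<Sum>i=1..K. \<Sum>k=1..K. expectation (\<lambda>\<omega>. h i (w \<omega>) \<bullet> h k (w \<omega>)) + (if i = k then v else 0))"
    by (intro sum_mono) auto
  also have "\<dots> = (real K)\<^sup>2 * expectation (\<lambda>\<omega>. (norm (hF (w \<omega>)))\<^sup>2) + real K * v"
    unfolding EF by (simp add: sum.distrib)
  finally show "(\<Sum>i=1..K. \<Sum>k=1..K. expectation (\<lambda>\<omega>. g i \<omega> \<bullet> g k \<omega>))
      \<le> (real K)\<^sup>2 * expectation (\<lambda>\<omega>. (norm (hF (w \<omega>)))\<^sup>2) + real K * v" .
qed

section \<open>Constants of the two schemes\<close>

text \<open>With unit weights the phases of Scheme I take the form of Scheme II, so one computation
  of moments serves both.\<close>

fun steering_weight :: "scheme \<Rightarrow> (nat \<Rightarrow> real) \<Rightarrow> (nat \<Rightarrow> real) \<Rightarrow> nat \<Rightarrow> real" where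
  "steering_weight Scheme_I \<beta> P k = 1"
| "steering_weight Scheme_II \<beta> P k = weight \<beta> P k"

definition total_weight :: "scheme \<Rightarrow> nat \<Rightarrow> (nat \<Rightarrow> real) \<Rightarrow> (nat \<Rightarrow> real) \<Rightarrow> real" where
  "total_weight u K \<beta> P = (\<Sum>k=1..K. (steering_weight u \<beta> P k)\<^sup>2)"

text \<open>Quotient of the two sides of a Cauchy-Schwarz inequality, with value 1 for equal
  weights. It is the only trace that the choice of the scheme leaves in the scaling factor.\<close>

definition imbalance :: "scheme \<Rightarrow> nat \<Rightarrow> (nat \<Rightarrow> real) \<Rightarrow> (nat \<Rightarrow> real) \<Rightarrow> real" where
  "imbalance u K \<beta> P = total_weight u K \<beta> P * (\<Sum>k=1..K. 1 / (steering_weight u \<beta> P k)\<^sup>2) / (real K)\<^sup>2"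

definition amplification ::
  "scheme \<Rightarrow> nat \<Rightarrow> nat \<Rightarrow> real \<Rightarrow> (nat \<Rightarrow> real) \<Rightarrow> (nat \<Rightarrow> real) \<Rightarrow> nat \<Rightarrow> real" where
  "amplification u K N G \<beta> P i = \<beta> i * sqrt (tx_power u K G \<beta> P i) / denoising_factor u K N G \<beta> P"

locale power_budget =
  fixes u :: scheme and K M N :: nat and G :: real and \<beta> P :: "nat \<Rightarrow> real"
  assumes K: "1 \<le> K" and N: "1 \<le> N" and G: "0 < G"
    and pos: "\<And>i. i \<in> {1..K+M} \<Longrightarrow> 0 < \<beta> i \<and> 0 < P i"
begin

abbreviation "sw \<equiv> steering_weight u \<beta> P"
abbreviation "W \<equiv> total_weight u K \<beta> P"
abbreviation "dnf \<equiv> denoising_factor u K N G \<beta> P"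

lemma steering_weight_pos: "k \<in> {1..K} \<Longrightarrow> 0 < sw k"
  using pos[of k] by (cases u) (auto simp: weight_def)

lemma total_weight_pos: "0 < W"
  unfolding total_weight_def using K by (intro sum_pos zero_less_power steering_weight_pos) auto

text \<open>Cauchy-Schwarz for the weights and their reciprocals, whose inner product is K.\<close>

lemma imbalance_ge_1: "1 \<le> imbalance u K \<beta> P"
proof -
  have "(\<Sum>k=1..K. sw k * (1 / sw k))\<^sup>2 \<le> (\<Sum>k=1..K. (sw k)\<^sup>2) * (\<Sum>k=1..K. (1 / sw k)\<^sup>2)"
    by (rule Cauchy_Schwarz_ineq_sum)
  moreover have "(\<Sum>k=1..K. sw k * (1 / sw k)) = real K"
  proof -
    have "sw k * (1 / sw k) = 1" if "k \<in> {1..K}" for k using steering_weight_pos[OF that] by simp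
    then show ?thesis by simp
  qed
  ultimately show ?thesis
    using K by (simp add: imbalance_def total_weight_def power_divide)
qed

lemma alpha_pos: "i \<in> {1..K+M} \<Longrightarrow> 0 < alpha \<beta> P i"
  using pos[of i] by (simp add: alpha_def)

lemma min_alpha:
  defines "\<mu> \<equiv> MIN k\<in>{1..K}. sqrt (P k) * \<beta> k"
  shows "0 < \<mu>" "(MIN k\<in>{1..K}. (alpha \<beta> P k)\<^sup>2) = \<mu>\<^sup>2"
proof -
  let ?f = "\<lambda>k. sqrt (P k) * \<beta> k"
  have f: "alpha \<beta> P k = ?f k" for k by (simp add: alpha_def mult.commute)
  have fin: "finite (?f ` {1..K})" "?f ` {1..K} \<noteq> {}" using K by auto
  have "\<mu> \<in> ?f ` {1..K}" unfolding \<mu>_def by (rule Min_in[OF fin])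
  then obtain k0 where k0: "k0 \<in> {1..K}" "\<mu> = ?f k0" by auto
  have le: "\<mu> \<le> ?f k" if "k \<in> {1..K}" for k unfolding \<mu>_def using that fin by (intro Min_le) auto
  show mp: "0 < \<mu>" using alpha_pos[of k0] k0 by (simp add: f)
  show "(MIN k\<in>{1..K}. (alpha \<beta> P k)\<^sup>2) = \<mu>\<^sup>2"
  proof (rule Min_eqI)
    show "\<mu>\<^sup>2 \<le> y" if y: "y \<in> (\<lambda>k. (alpha \<beta> P k)\<^sup>2) ` {1..K}" for y
    proof -
      obtain k where k: "k \<in> {1..K}" "y = (?f k)\<^sup>2" using y by (auto simp: f)
      show ?thesis unfolding k(2) using le[OF k(1)] mp by (intro power_mono) auto
    qed
    show "\<mu>\<^sup>2 \<in> (\<lambda>k. (alpha \<beta> P k)\<^sup>2) ` {1..K}" using k0 by (auto simp: f)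
  qed simp
qed

text \<open>The design condition behind both schemes: the product is the same for all devices. Since
  the mean aligned gain is \<open>N * (pi / 4) * sw k / sqrt W\<close>, this value makes every
  device coefficient average to \<open>1 / K\<close>, that is, the estimate unbiased.\<close>

lemma amplification_device:
  assumes k: "k \<in> {1..K}"
  shows "amplification u K N G \<beta> P k * sw k = 4 * sqrt W / (pi * real N * real K)"
proof (cases u)
  case Scheme_I
  define \<mu> where "\<mu> = (MIN k\<in>{1..K}. sqrt (P k) * \<beta> k)"
  have \<mu>: "0 < \<mu>" using min_alpha(1) by (simp add: \<mu>_def)
  have b: "0 < \<beta> k" using pos[of k] k by auto
  have "sqrt (tx_power u K G \<beta> P k) = inverse (\<beta> k) * (\<mu> / G)"
    using k b \<mu> G by (simp add: Scheme_I \<mu>_def[symmetric] del: One_nat_def)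
  moreover have "dnf = pi * real N * sqrt (real K) * \<mu> / (4 * G)" by (simp add: Scheme_I \<mu>_def)
  ultimately have "amplification u K N G \<beta> P k * sw k = \<beta> k * (inverse (\<beta> k) * (\<mu> / G)) / (pi * real N * sqrt (real K) * \<mu> / (4 * G))"
    by (simp only: amplification_def) (simp add: Scheme_I)
  also have "\<dots> = 4 / (pi * real N * sqrt (real K))"
    using b \<mu> G N K by (simp add: field_simps)
  also have "\<dots> = 4 * sqrt (real K) / (pi * real N * (sqrt (real K) * sqrt (real K)))"
    using K by (simp del: real_sqrt_mult_self)
  also have "\<dots> = 4 * sqrt W / (pi * real N * real K)"
    by (simp add: Scheme_I total_weight_def)
  finally show ?thesis .
next
  case Scheme_II
  have b: "0 < \<beta> k" "0 < P k" using pos[of k] k by auto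
  have "sqrt (tx_power u K G \<beta> P k) = sqrt (P k) / G" using k b G by (simp add: Scheme_II)
  moreover have "dnf = pi * real N * real K / (4 * G * sqrt W)" by (simp add: Scheme_II total_weight_def)
  moreover have "sw k = 1 / (\<beta> k * sqrt (P k))" by (simp add: Scheme_II weight_def)
  ultimately have "amplification u K N G \<beta> P k * sw k =
      \<beta> k * (sqrt (P k) / G) / (pi * real N * real K / (4 * G * sqrt W)) * (1 / (\<beta> k * sqrt (P k)))"
    by (simp only: amplification_def)
  also have "\<dots> = 4 * sqrt W / (pi * real N * real K)"
    using b G N K by (simp add: field_simps)
  finally show ?thesis .
qed

lemma amplification_interferer:
  assumes m: "m \<in> {K+1..K+M}"
  shows "amplification u K N G \<beta> P m = alpha \<beta> P m / dnf"
  using m by (cases u) (auto simp: amplification_def alpha_def)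

section \<open>The terms of the bound in a form common to both schemes\<close>

lemma alpha_powi: "i \<in> {1..K+M} \<Longrightarrow> alpha \<beta> P i powi (-2) = 1 / (alpha \<beta> P i)\<^sup>2"
  by (simp add: power_int_minus divide_inverse)

lemma total_weight_II: "u = Scheme_II \<Longrightarrow> W = (\<Sum>i=1..K. alpha \<beta> P i powi (-2))"
  unfolding total_weight_def
  by (intro sum.cong refl, subst alpha_powi) (auto simp: weight_def alpha_def power_divide)

text \<open>\<open>real N / 2\<close> is the second moment of a gain of weight 0, so this is the
  energy that unit-norm interference adds to the estimate.\<close>

lemma interference_term_eq:
  "interference_term u K M N G (alpha \<beta> P) = (\<Sum>m\<in>{K+1..K+M}. (amplification u K N G \<beta> P m)\<^sup>2 * (real N / 2))"
proof (cases u)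
  case Scheme_I
  define \<mu> where "\<mu> = (MIN k\<in>{1..K}. sqrt (P k) * \<beta> k)"
  have \<mu>: "0 < \<mu>" "(MIN k\<in>{1..K}. (alpha \<beta> P k)\<^sup>2) = \<mu>\<^sup>2" using min_alpha by (simp_all add: \<mu>_def)
  have l: "dnf\<^sup>2 = pi\<^sup>2 * (real N)\<^sup>2 * real K * \<mu>\<^sup>2 / (16 * G\<^sup>2)"
    by (simp add: Scheme_I \<mu>_def power_divide power_mult_distrib)
  show ?thesis
    unfolding Scheme_I interference_term.simps \<mu>(2)
  proof (rule sum.cong[OF refl])
    fix m assume m: "m \<in> {K+1..K+M}"
    show "8 * G\<^sup>2 * (alpha \<beta> P m)\<^sup>2 / (pi\<^sup>2 * real N * real K * \<mu>\<^sup>2) = (amplification Scheme_I K N G \<beta> P m)\<^sup>2 * (real N / 2)"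
    proof -
      have a: "(amplification u K N G \<beta> P m)\<^sup>2 = (alpha \<beta> P m)\<^sup>2 / (pi\<^sup>2 * (real N)\<^sup>2 * real K * \<mu>\<^sup>2 / (16 * G\<^sup>2))"
        unfolding amplification_interferer[OF m] power_divide l ..
      show ?thesis
        unfolding a[unfolded Scheme_I] using \<mu>(1) G N K by (simp add: field_simps power2_eq_square)
    qed
  qed
next
  case Scheme_II
  have l: "dnf\<^sup>2 = pi\<^sup>2 * (real N)\<^sup>2 * (real K)\<^sup>2 / (16 * G\<^sup>2 * W)"
    using total_weight_pos by (simp add: Scheme_II total_weight_def power_divide power_mult_distrib)
  show ?thesis
    unfolding Scheme_II interference_term.simps total_weight_II[OF Scheme_II, symmetric, unfolded Scheme_II]
  proof (rule sum.cong[OF refl])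
    fix m assume m: "m \<in> {K+1..K+M}"
    show "8 * G\<^sup>2 * total_weight Scheme_II K \<beta> P / (pi\<^sup>2 * real N * (real K)\<^sup>2 * alpha \<beta> P m powi (-2)) =
       (amplification Scheme_II K N G \<beta> P m)\<^sup>2 * (real N / 2)"
    proof -
      have a: "(amplification u K N G \<beta> P m)\<^sup>2 = (alpha \<beta> P m)\<^sup>2 / (pi\<^sup>2 * (real N)\<^sup>2 * (real K)\<^sup>2 / (16 * G\<^sup>2 * W))"
        unfolding amplification_interferer[OF m] power_divide l ..
      have p: "alpha \<beta> P m powi (-2) = 1 / (alpha \<beta> P m)\<^sup>2" using m by (intro alpha_powi) auto
      show ?thesis
        unfolding a[unfolded Scheme_II] p
        using total_weight_pos[unfolded Scheme_II] alpha_pos[of m] G N K m by (simp add: field_simps power2_eq_square)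
    qed
  qed
qed

text \<open>The real part of each of the D noise entries has variance \<open>\<sigma>^2 / 2\<close>
  before division by the denoising factor.\<close>

lemma noise_term_eq: "noise_term u K N D G \<sigma> (alpha \<beta> P) = real D * (\<sigma>\<^sup>2 / 2) / dnf\<^sup>2"
proof (cases u)
  case Scheme_I
  define \<mu> where "\<mu> = (MIN k\<in>{1..K}. sqrt (P k) * \<beta> k)"
  have \<mu>: "0 < \<mu>" "(MIN k\<in>{1..K}. (alpha \<beta> P k)\<^sup>2) = \<mu>\<^sup>2" using min_alpha by (simp_all add: \<mu>_def)
  have l: "dnf\<^sup>2 = pi\<^sup>2 * (real N)\<^sup>2 * real K * \<mu>\<^sup>2 / (16 * G\<^sup>2)"
    by (simp add: Scheme_I \<mu>_def power_divide power_mult_distrib)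
  show ?thesis
    unfolding l unfolding Scheme_I noise_term.simps \<mu>(2) using \<mu>(1) G N K by (simp add: field_simps)
next
  case Scheme_II
  have l: "dnf\<^sup>2 = pi\<^sup>2 * (real N)\<^sup>2 * (real K)\<^sup>2 / (16 * G\<^sup>2 * W)"
    using total_weight_pos by (simp add: Scheme_II total_weight_def power_divide power_mult_distrib)
  show ?thesis
    unfolding l unfolding Scheme_II noise_term.simps total_weight_II[OF Scheme_II, symmetric, unfolded Scheme_II]
    using total_weight_pos G N K by (simp add: Scheme_II field_simps)
qed

lemma imbalance_I: "u = Scheme_I \<Longrightarrow> imbalance u K \<beta> P = 1"
  using K by (simp add: imbalance_def total_weight_def power2_eq_square)

lemma imbalance_II:
  "u = Scheme_II \<Longrightarrow> imbalance u K \<beta> P = (\<Sum>i=1..K. (alpha \<beta> P i)\<^sup>2) * (\<Sum>i=1..K. alpha \<beta> P i powi (-2)) / (real K)\<^sup>2"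
proof -
  assume u: "u = Scheme_II"
  then have "1 / (sw k)\<^sup>2 = (alpha \<beta> P k)\<^sup>2" for k by (simp add: weight_def alpha_def power_divide)
  then show ?thesis unfolding imbalance_def total_weight_II[OF u] by simp
qed

lemma scaling_factor_eq:
  "scaling_factor u K N L \<xi> (alpha \<beta> P) = ((8 * imbalance u K \<beta> P + 8 - pi\<^sup>2) / (pi\<^sup>2 * real N) * \<xi>\<^sup>2 + 1) * L"
proof (cases u)
  case Scheme_I
  then show ?thesis using imbalance_I by simp
next
  case Scheme_II
  then show ?thesis using imbalance_II by simp
qed

text \<open>The coefficient of \<open>c^2\<close> is split by origin: the first fraction comes from
  the fluctuation of the individual gains, the second, with the extra factor K below, from averaging
  the gradients.\<close>

lemma bias_term_eq:
  "bias_term u K M N D L G \<sigma> c (alpha \<beta> P) =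
    ((8 * imbalance u K \<beta> P / (pi\<^sup>2 * real N) + (8 + pi\<^sup>2 * (real N - 1)) / (pi\<^sup>2 * real N * real K)) * c\<^sup>2
     + interference_term u K M N G (alpha \<beta> P) + noise_term u K N D G \<sigma> (alpha \<beta> P)) * L"
proof (cases u)
  case Scheme_I
  have "(8 * (real K + 1) + pi\<^sup>2 * (real N - 1)) / (pi\<^sup>2 * real N * real K)
    = 8 * imbalance u K \<beta> P / (pi\<^sup>2 * real N) + (8 + pi\<^sup>2 * (real N - 1)) / (pi\<^sup>2 * real N * real K)"
    using K N by (simp add: imbalance_I[OF Scheme_I] field_simps)
  then show ?thesis by (simp only: Scheme_I bias_term.simps)
next
  case Scheme_II
  let ?S = "(\<Sum>k=1..K. (alpha \<beta> P k)\<^sup>2)" and ?R = "(\<Sum>i=1..K. alpha \<beta> P i powi (-2))"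
  have "(8 / real K * ?S * ?R + 8 + pi\<^sup>2 * (real N - 1)) / (pi\<^sup>2 * real N * real K)
    = 8 * imbalance u K \<beta> P / (pi\<^sup>2 * real N) + (8 + pi\<^sup>2 * (real N - 1)) / (pi\<^sup>2 * real N * real K)"
    using K N unfolding imbalance_II[OF Scheme_II] by (simp add: field_simps power2_eq_square)
  then show ?thesis by (simp only: Scheme_II bias_term.simps)
qed

end

section \<open>One round of aggregation\<close>

lemma borel_measurable_nth_complex:
  fixes f :: "'a \<Rightarrow> complex^'n"
  assumes "f \<in> borel_measurable N"
  shows "(\<lambda>x. f x $ c) \<in> borel_measurable N"
  using assms by (rule measurable_compose) (intro borel_measurable_continuous_onI continuous_intros)

lemma borel_measurable_cnj[measurable (raw)]:
  "f \<in> borel_measurable N \<Longrightarrow> (\<lambda>x. cnj (f x)) \<in> borel_measurable N"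
  by (rule measurable_compose[OF _ borel_measurable_continuous_onI]) (auto intro: continuous_intros)

lemma borel_measurable_ris_gain:
  fixes hp :: "'a \<Rightarrow> complex^'n" and hr :: "nat \<Rightarrow> 'a \<Rightarrow> complex^'n"
  assumes hp: "hp \<in> borel_measurable N" and hr: "\<And>k. k \<in> I \<Longrightarrow> hr k \<in> borel_measurable N" and i: "i \<in> I"
  shows "(\<lambda>x. Re (\<Sum>n\<in>UNIV. cnj (hp x $ n) *
      cis (- Arg (cnj (hp x $ n)) + Arg (\<Sum>k\<in>I. complex_of_real (w k) * cnj (hr k x $ n))) * hr i x $ n))
    \<in> borel_measurable N"
proof -
  have [measurable]: "(\<lambda>x. hp x $ n) \<in> borel_measurable N" for n by (rule borel_measurable_nth_complex[OF hp])
  have [measurable]: "(\<lambda>x. hr k x $ n) \<in> borel_measurable N" if "k \<in> I" for k n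
    by (rule borel_measurable_nth_complex[OF hr[OF that]])
  note i[measurable]
  \<comment> \<open>Reduces the claim to measurability of the phase factor
    \<open>cis (Arg z)\<close>, without treating the argument itself.\<close>
  have c: "cis (- Arg a + Arg b) = cnj (cis (Arg a)) * cis (Arg b)" for a b
    by (simp only: cis_mult[symmetric] cis_cnj)
  have m: "(\<lambda>x. \<Sum>n\<in>UNIV. cnj (hp x $ n) * (cnj (cis (Arg (cnj (hp x $ n)))) *
      cis (Arg (\<Sum>k\<in>I. complex_of_real (w k) * cnj (hr k x $ n)))) * hr i x $ n) \<in> borel_measurable N"
    by (intro borel_measurable_sum borel_measurable_times borel_measurable_cnj measurable_compose[OF _ measurable_cis_Arg]
        borel_measurable_const borel_measurable_nth_complex hp hr i)
  show ?thesis unfolding c using m by (simp add: borel_measurable_complex_iff)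
qed

context power_budget begin

text \<open>Weight 0 for the interferers makes the gains of devices and interferers instances of one formula.\<close>

definition padded_weight :: "nat \<Rightarrow> real" where
  "padded_weight k = (if k \<in> {1..K} then sw k else 0)"

lemma sum_padded_weight: "(\<Sum>k\<in>{1..K+M}. (padded_weight k)\<^sup>2) = W"
  unfolding total_weight_def padded_weight_def by (rule sum.mono_neutral_cong_right) auto

lemma rx_coeff_eq:
  fixes hp :: "complex^'n"
  assumes "N = CARD('n)"
  shows "rx_coeff u K G \<beta> P hp hr i = amplification u K N G \<beta> P i * Re (\<Sum>n\<in>UNIV. cnj (hp $ n) *
      cis (- Arg (cnj (hp $ n)) + Arg (\<Sum>k\<in>{1..K+M}. complex_of_real (padded_weight k) * cnj (hr k $ n))) * hr i $ n)"
proof -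
  have "(\<Sum>k\<in>{1..K+M}. complex_of_real (padded_weight k) * cnj (hr k $ n)) = (\<Sum>k=1..K. complex_of_real (sw k) * cnj (hr k $ n))" for n
    unfolding padded_weight_def by (rule sum.mono_neutral_cong_right) auto
  then have "ris_phase u K \<beta> P hp hr n = - Arg (cnj (hp $ n)) + Arg (\<Sum>k\<in>{1..K+M}. complex_of_real (padded_weight k) * cnj (hr k $ n))" for n
    by (cases u) auto
  then show ?thesis by (simp add: rx_coeff_def amplification_def assms)
qed

text \<open>For two different devices this is \<open>K^2\<close> times the mixed moment of their
  coefficients. It lies below 1: \<open>pi^2 > 8\<close> makes the coefficients negatively
  correlated.\<close>

definition attenuation :: real where "attenuation = (8 + pi\<^sup>2 * (real N - 1)) / (pi\<^sup>2 * real N)"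

lemma attenuation_nonneg: "0 \<le> attenuation"
  using N by (simp add: attenuation_def)

text \<open>The moment matrix is a constant block on the devices plus a diagonal. The block is
  constant because amplification times weight is the same for all devices, and zero weights remove
  the interferers from it.\<close>

lemma gain_second_moment:
  assumes i: "i \<in> {1..K+M}" and k: "k \<in> {1..K+M}"
  shows "amplification u K N G \<beta> P i * amplification u K N G \<beta> P k *
      (real N * ((padded_weight i * padded_weight k / W + of_bool (i = k)) / 2)
      + real N * (real N - 1) * ((pi / 4)\<^sup>2 * (padded_weight i * padded_weight k / W)))
    = (if i \<in> {1..K} \<and> k \<in> {1..K} then attenuation / (real K)\<^sup>2 else 0)
      + (if i = k then (amplification u K N G \<beta> P i)\<^sup>2 * (real N / 2) else 0)" (is "?l = ?r")
proof -
  let ?a = "amplification u K N G \<beta> P" and ?p = padded_weight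
  have "?l = (?a i * ?p i) * (?a k * ?p k) / W * (real N / 2 + real N * (real N - 1) * (pi / 4)\<^sup>2)
    + (if i = k then (?a i)\<^sup>2 * (real N / 2) else 0)"
    by (simp add: algebra_simps add_divide_distrib power2_eq_square)
  moreover have "(?a i * ?p i) * (?a k * ?p k) / W * (real N / 2 + real N * (real N - 1) * (pi / 4)\<^sup>2)
    = (if i \<in> {1..K} \<and> k \<in> {1..K} then attenuation / (real K)\<^sup>2 else 0)"
  proof (cases "i \<in> {1..K} \<and> k \<in> {1..K}")
    case True
    then have "(?a i * ?p i) * (?a k * ?p k) / W = (4 * sqrt W / (pi * real N * real K)) * (4 * sqrt W / (pi * real N * real K)) / W"
      by (simp add: padded_weight_def amplification_device)
    also have "\<dots> = 16 * (sqrt W * sqrt W) / W / (pi\<^sup>2 * (real N)\<^sup>2 * (real K)\<^sup>2)"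
      by (simp only: times_divide_times_eq) (simp add: power2_eq_square mult_ac)
    also have "\<dots> = 16 / (pi\<^sup>2 * (real N)\<^sup>2 * (real K)\<^sup>2)"
      using total_weight_pos by simp
    finally have e: "(?a i * ?p i) * (?a k * ?p k) / W = 16 / (pi\<^sup>2 * (real N)\<^sup>2 * (real K)\<^sup>2)" .
    show ?thesis
      unfolding e attenuation_def using True N K by (simp add: field_simps power2_eq_square)
  next
    case False
    then show ?thesis by (auto simp: padded_weight_def)
  qed
  ultimately show ?thesis by simp
qed

text \<open>The diagonal part over the devices, which multiplies the individual squared gradients:
  this is how the imbalance of the weights enters the bound.\<close>

lemma device_noise_sum:
  "(\<Sum>k=1..K. (amplification u K N G \<beta> P k)\<^sup>2 * (real N / 2)) = 8 * imbalance u K \<beta> P / (pi\<^sup>2 * real N)"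
proof -
  have "(amplification u K N G \<beta> P k)\<^sup>2 * (real N / 2) = 8 / (pi\<^sup>2 * real N * (real K)\<^sup>2) * W * (1 / (sw k)\<^sup>2)"
    if k: "k \<in> {1..K}" for k
  proof -
    have "amplification u K N G \<beta> P k = 4 * sqrt W / (pi * real N * real K) / sw k"
      unfolding eq_divide_eq using amplification_device[OF k] steering_weight_pos[OF k] by simp
    then have "(amplification u K N G \<beta> P k)\<^sup>2 = 16 * W / (pi\<^sup>2 * (real N)\<^sup>2 * (real K)\<^sup>2) / (sw k)\<^sup>2"
      using total_weight_pos by (simp add: power_divide power_mult_distrib)
    then show ?thesis
      using steering_weight_pos[OF k] N K by (simp add: field_simps power2_eq_square)
  qed
  then have "(\<Sum>k=1..K. (amplification u K N G \<beta> P k)\<^sup>2 * (real N / 2)) = 8 / (pi\<^sup>2 * real N * (real K)\<^sup>2) * W * (\<Sum>k=1..K. 1 / (sw k)\<^sup>2)"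
    unfolding sum_distrib_left by (intro sum.cong refl) auto
  then show ?thesis by (simp add: imbalance_def mult_ac)
qed

end

text \<open>The constant block of the moment matrix multiplies the squared sum of the gradients and
  costs \<open>s * X + s / K * v\<close>; the diagonal multiplies individual squared gradients,
  where the dissimilarity bound introduces \<xi>^2. Interference and noise contribute exactly their
  terms in the bias.\<close>

lemma (in prob_space) round_moments:
  fixes u :: scheme and K Q :: nat and hp :: "'a \<Rightarrow> complex^'n" and hr :: "nat \<Rightarrow> 'a \<Rightarrow> complex^'n" and z :: "'a \<Rightarrow> complex^'d"
    and B :: "nat \<Rightarrow> 'a \<Rightarrow> nat set" and w :: "'a \<Rightarrow> real^'d" and g gi :: "nat \<Rightarrow> 'a \<Rightarrow> real^'d"
    and h :: "nat \<Rightarrow> real^'d \<Rightarrow> real^'d" and \<Gamma> :: "nat \<Rightarrow> nat set \<Rightarrow> real^'d \<Rightarrow> real^'d"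
  assumes pb: "power_budget K Q CARD('n) G \<beta> P" and \<sigma>: "0 < \<sigma>"
    and ri: "round_indep M K Q A B hp hr z"
    and A: "space A = space M"
    and w: "w \<in> borel_measurable A" and gi: "\<And>m. m \<in> {K+1..K+Q} \<Longrightarrow> gi m \<in> borel_measurable A"
    and gi1: "\<And>m \<omega>. m \<in> {K+1..K+Q} \<Longrightarrow> \<omega> \<in> space M \<Longrightarrow> norm (gi m \<omega>) = 1"
    and hp: "CN M 1 hp" and hr: "\<And>i. i \<in> {1..K+Q} \<Longrightarrow> CN M 1 (hr i)" and z: "CN M (\<sigma>\<^sup>2) z"
    and CC: "finite CC" "\<And>k \<omega>. k \<in> {1..K} \<Longrightarrow> \<omega> \<in> space M \<Longrightarrow> B k \<omega> \<in> CC"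
    and \<Gamma>: "\<And>k C. k \<in> {1..K} \<Longrightarrow> C \<in> CC \<Longrightarrow> \<Gamma> k C \<in> borel_measurable borel"
    and g: "\<And>k \<omega>. k \<in> {1..K} \<Longrightarrow> \<omega> \<in> space M \<Longrightarrow> g k \<omega> = \<Gamma> k (B k \<omega>) (w \<omega>)"
    and gb: "\<And>k \<omega>. k \<in> {1..K} \<Longrightarrow> \<omega> \<in> space M \<Longrightarrow> norm (g k \<omega>) \<le> G"
    and h: "\<And>k. k \<in> {1..K} \<Longrightarrow> h k \<in> borel_measurable borel"
    and cm: "\<And>k. k \<in> {1..K} \<Longrightarrow> AE \<omega> in M. cond_mean M w (g k) \<omega> = h k (w \<omega>)"
    and cv: "\<And>k. k \<in> {1..K} \<Longrightarrow> AE \<omega> in M. cond_variance M w (g k) \<omega> \<le> v"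
    and hF: "\<And>x. hF x = (\<Sum>k=1..K. h k x) /\<^sub>R real K"
    and \<xi>: "\<And>k x. k \<in> {1..K} \<Longrightarrow> norm (h k x) \<le> \<xi> * norm (hF x)"
  defines "r \<equiv> \<lambda>\<omega>. grad_estimate u K Q G \<beta> P (hp \<omega>) (\<lambda>i. hr i \<omega>) (\<lambda>k. g k \<omega>) (\<lambda>m. gi m \<omega>) (z \<omega>)"
    and "X \<equiv> expectation (\<lambda>\<omega>. (norm (hF (w \<omega>)))\<^sup>2)"
    and "s \<equiv> (8 + pi\<^sup>2 * (real CARD('n) - 1)) / (pi\<^sup>2 * real CARD('n))"
    and "a \<equiv> 8 * imbalance u K \<beta> P / (pi\<^sup>2 * real CARD('n))"
  shows "r \<in> borel_measurable M" and "integrable M (\<lambda>\<omega>. (norm (r \<omega>))\<^sup>2)"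
    and "integrable M (\<lambda>\<omega>. (norm (hF (w \<omega>)))\<^sup>2)"
    and "integrable M (\<lambda>\<omega>. hF (w \<omega>) \<bullet> r \<omega>)"
    and "expectation (\<lambda>\<omega>. hF (w \<omega>) \<bullet> r \<omega>) = X"
    and "expectation (\<lambda>\<omega>. (norm (r \<omega>))\<^sup>2) \<le> (s + a * \<xi>\<^sup>2) * X + (a + s / real K) * v
      + interference_term u K Q CARD('n) G (alpha \<beta> P) + noise_term u K CARD('n) CARD('d) G \<sigma> (alpha \<beta> P)"
proof -
  interpret power_budget u K Q "CARD('n)" G \<beta> P by fact
  let ?I = "{1..K+Q}"
  define E where "E st = (case st of
              Past \<Rightarrow> sets A
            | Batch k \<Rightarrow> sets (vimage_algebra (space M) (B k) (count_space UNIV))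
            | Server_Channel \<Rightarrow> sets (vimage_algebra (space M) hp borel)
            | Device_Channel i \<Rightarrow> sets (vimage_algebra (space M) (hr i) borel)
            | Noise \<Rightarrow> sets (vimage_algebra (space M) z borel))" for st
  define J where "J = {Past, Server_Channel, Noise} \<union> Batch ` {1..K} \<union> Device_Channel ` ?I"
  have ind: "indep_sets E J"
    using ri unfolding round_indep_def E_def[abs_def] J_def .
  have st: "Int_stable (E j)" for j
    by (cases j) (auto simp: E_def Int_stable_def)
  have pw: "E j \<subseteq> Pow (space M)" if "j \<in> J" for j
    using ind that sets.space_closed by (auto simp: indep_sets_def)
  \<comment> \<open>Gradients, model and interference live on \<open>?J1\<close>, gains on
    \<open>?J2\<close>, noise on \<open>?J3\<close>.\<close>
  let ?J1 = "{Past} \<union> Batch ` {1..K}" and ?J2 = "{Server_Channel} \<union> Device_Channel ` ?I" and ?J3 = "{Noise}"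
  have JJ: "?J1 \<subseteq> J" "?J2 \<subseteq> J" "?J3 \<subseteq> J" "?J1 \<inter> ?J2 = {}" "?J1 \<inter> ?J3 = {}" "?J2 \<inter> ?J3 = {}"
    by (auto simp: J_def)
  have past: "x \<in> borel_measurable (joint_algebra M E J')" if "x \<in> borel_measurable A" "Past \<in> J'" "J' \<subseteq> J"
    for x :: "'a \<Rightarrow> real^'d" and J'
  proof (rule measurable_joint_algebraI[OF that(2)])
    show "x -` S \<inter> space M \<in> E Past" if "S \<in> sets borel" for S
      using measurable_sets[OF \<open>x \<in> borel_measurable A\<close> that] by (simp add: E_def A)
    show "E j \<subseteq> Pow (space M)" if "j \<in> J'" for j using that \<open>J' \<subseteq> J\<close> by (intro pw) blast
  qed simp
  have hp2: "hp \<in> borel_measurable (joint_algebra M E ?J2)"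
  proof (rule measurable_joint_algebraI[of Server_Channel])
    show "E j \<subseteq> Pow (space M)" if "j \<in> ?J2" for j using that JJ(2) by (intro pw) blast
  qed (auto simp: E_def in_vimage_algebra)
  have hr2: "hr i \<in> borel_measurable (joint_algebra M E ?J2)" if "i \<in> ?I" for i
  proof (rule measurable_joint_algebraI[of "Device_Channel i"])
    show "E j \<subseteq> Pow (space M)" if "j \<in> ?J2" for j using that JJ(2) by (intro pw) blast
  qed (use that in \<open>auto simp: E_def in_vimage_algebra\<close>)
  have z3: "z \<in> borel_measurable (joint_algebra M E ?J3)"
  proof (rule measurable_joint_algebraI[of Noise])
    show "E j \<subseteq> Pow (space M)" if "j \<in> ?J3" for j using that JJ(3) by (intro pw) blast
  qed (auto simp: E_def in_vimage_algebra)
  have wP: "w \<in> borel_measurable (joint_algebra M E {Past})"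
    by (rule past[OF w]) (auto simp: J_def)

  have b: "\<And>k. k \<in> {1..K} \<Longrightarrow> Batch k \<in> J" "Past \<in> J" "\<And>k. k \<in> {1..K} \<Longrightarrow> Batch k \<noteq> Past" "inj_on Batch {1..K}"
    by (auto simp: J_def inj_on_def)
  have bb: "\<And>k C. k \<in> {1..K} \<Longrightarrow> B k -` {C} \<inter> space M \<in> E (Batch k)"
    by (simp add: E_def in_vimage_algebra)
  have avg: "\<And>k. k \<in> {1..K} \<Longrightarrow> g k \<in> borel_measurable (joint_algebra M E ({Past} \<union> Batch ` {1..K}))"
    "\<And>k. k \<in> {1..K} \<Longrightarrow> integrable M (\<lambda>\<omega>. (norm (g k \<omega>))\<^sup>2)"
    "\<And>k. k \<in> {1..K} \<Longrightarrow> integrable M (\<lambda>\<omega>. (norm (h k (w \<omega>)))\<^sup>2)"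
    "integrable M (\<lambda>\<omega>. (norm (hF (w \<omega>)))\<^sup>2)"
    "(\<Sum>k=1..K. expectation (\<lambda>\<omega>. hF (w \<omega>) \<bullet> g k \<omega>)) = real K * expectation (\<lambda>\<omega>. (norm (hF (w \<omega>)))\<^sup>2)"
    "(\<Sum>i=1..K. \<Sum>k=1..K. expectation (\<lambda>\<omega>. g i \<omega> \<bullet> g k \<omega>))
      \<le> (real K)\<^sup>2 * expectation (\<lambda>\<omega>. (norm (hF (w \<omega>)))\<^sup>2) + real K * v"
    "\<And>k. k \<in> {1..K} \<Longrightarrow> expectation (\<lambda>\<omega>. (norm (g k \<omega>))\<^sup>2) \<le> expectation (\<lambda>\<omega>. (norm (h k (w \<omega>)))\<^sup>2) + v"
    by (rule average_gradient_moments[OF K ind st b bb wP CC \<Gamma> g less_imp_le[OF G] gb h cm cv hF]; assumption)+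
  show "integrable M (\<lambda>\<omega>. (norm (hF (w \<omega>)))\<^sup>2)" by (rule avg(4))

  define gain where "gain i \<omega> = Re (\<Sum>n\<in>UNIV. cnj (hp \<omega> $ n) *
      cis (- Arg (cnj (hp \<omega> $ n)) + Arg (\<Sum>k\<in>?I. complex_of_real (padded_weight k) * cnj (hr k \<omega> $ n))) * hr i \<omega> $ n)" for i \<omega>
  have gain2: "gain i \<in> borel_measurable (joint_algebra M E ?J2)" if "i \<in> ?I" for i
    unfolding gain_def[abs_def] by (rule borel_measurable_ris_gain[OF hp2 hr2 that])
  \<comment> \<open>Users are numbered from 1, so index 0 is free for the server channel.\<close>
  have indc: "indep_sets (\<lambda>j. rv_events M (\<lambda>j. if j = 0 then hp else hr j) j) (insert 0 ?I)"
  proof (rule indep_sets_mono_sets)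
    let ?J = "\<lambda>j. {if j = 0 then Server_Channel else Device_Channel j}"
    show "indep_sets (\<lambda>j. sets (joint_algebra M E (?J j))) (insert 0 ?I)"
      by (rule indep_sets_joint_algebra[OF ind st]) (auto simp: J_def disjoint_family_on_def)
    fix j assume j: "j \<in> insert 0 ?I"
    have "?J j \<subseteq> J" using j by (auto simp: J_def)
    then have "sets (joint_algebra M E (?J j)) = sigma_sets (space M) (E (if j = 0 then Server_Channel else Device_Channel j))"
      using sets_joint_algebra_indep(1)[OF ind] by simp
    moreover have "rv_events M (\<lambda>j. if j = 0 then hp else hr j) j \<subseteq> E (if j = 0 then Server_Channel else Device_Channel j)"
      by (auto simp: rv_events_def E_def in_vimage_algebra)
    ultimately show "rv_events M (\<lambda>j. if j = 0 then hp else hr j) j \<subseteq> sets (joint_algebra M E (?J j))"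
      by (auto intro: sigma_sets.Basic)
  qed
  have W': "0 < (\<Sum>k\<in>?I. (padded_weight k)\<^sup>2)" unfolding sum_padded_weight by (rule total_weight_pos)
  have gm: "\<And>i. i \<in> ?I \<Longrightarrow> gain i \<in> borel_measurable M"
    "\<And>i. i \<in> ?I \<Longrightarrow> integrable M (\<lambda>\<omega>. (gain i \<omega>)\<^sup>2)"
    "\<And>i. i \<in> ?I \<Longrightarrow> expectation (gain i) = real CARD('n) * (pi / 4) * (padded_weight i / sqrt W)"
    "\<And>i k. i \<in> ?I \<Longrightarrow> k \<in> ?I \<Longrightarrow> expectation (\<lambda>\<omega>. gain i \<omega> * gain k \<omega>) =
      real CARD('n) * ((padded_weight i * padded_weight k / W + of_bool (i = k)) / 2)
      + real CARD('n) * (real CARD('n) - 1) * ((pi / 4)\<^sup>2 * (padded_weight i * padded_weight k / W))"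
  proof -
    have I0: "finite ?I" "0 \<notin> ?I" by auto
    note rg = ris_gain_moments[OF I0 indc hp hr W', folded gain_def, unfolded sum_padded_weight]
    show "\<And>i. i \<in> ?I \<Longrightarrow> gain i \<in> borel_measurable M"
      using rv_joint_algebra[OF ind JJ(2) gain2] .
    show "\<And>i. i \<in> ?I \<Longrightarrow> integrable M (\<lambda>\<omega>. (gain i \<omega>)\<^sup>2)" by (rule rg(2))
    show "\<And>i. i \<in> ?I \<Longrightarrow> expectation (gain i) = real CARD('n) * (pi / 4) * (padded_weight i / sqrt W)"
      using rg(3) by (simp add: gain_def[abs_def])
    show "\<And>i k. i \<in> ?I \<Longrightarrow> k \<in> ?I \<Longrightarrow> expectation (\<lambda>\<omega>. gain i \<omega> * gain k \<omega>) =
      real CARD('n) * ((padded_weight i * padded_weight k / W + of_bool (i = k)) / 2)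
      + real CARD('n) * (real CARD('n) - 1) * ((pi / 4)\<^sup>2 * (padded_weight i * padded_weight k / W))"
      by (rule rg(4))
  qed
  let ?amp = "amplification u K CARD('n) G \<beta> P"
  define l where "l i \<omega> = rx_coeff u K G \<beta> P (hp \<omega>) (\<lambda>i. hr i \<omega>) i" for i \<omega>
  have l: "l i \<omega> = ?amp i * gain i \<omega>" for i \<omega>
    unfolding l_def gain_def by (rule rx_coeff_eq[OF refl])
  have lJ: "l i \<in> borel_measurable (joint_algebra M E ?J2)" if "i \<in> ?I" for i
    unfolding l[abs_def] using gain2[OF that] by measurable
  have l2: "integrable M (\<lambda>\<omega>. (l i \<omega>)\<^sup>2)" if "i \<in> ?I" for i
    unfolding l power_mult_distrib using gm(2)[OF that] by simp
  have El: "expectation (l i) = (if i \<in> {1..K} then 1 / real K else 0)" if i: "i \<in> ?I" for i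
  proof -
    \<comment> \<open>The bracket contains the common value of amplification times weight, or 0 for
      an interferer; \<open>4 / (pi * N)\<close> in that value cancels the prefactor.\<close>
    have "expectation (l i) = real CARD('n) * (pi / 4) * (?amp i * padded_weight i / sqrt W)"
      unfolding l[abs_def] using gm(3)[OF i] by simp
    also have "\<dots> = (if i \<in> {1..K} then 1 / real K else 0)"
      using total_weight_pos K amplification_device[of i] by (auto simp: padded_weight_def)
    finally show ?thesis .
  qed
  have Ell: "expectation (\<lambda>\<omega>. l i \<omega> * l k \<omega>) = (if i \<in> {1..K} \<and> k \<in> {1..K} then s / (real K)\<^sup>2 else 0)
      + (if i = k then (?amp i)\<^sup>2 * (real CARD('n) / 2) else 0)" if "i \<in> ?I" "k \<in> ?I" for i k
  proof -
    have "expectation (\<lambda>\<omega>. l i \<omega> * l k \<omega>) = ?amp i * ?amp k * expectation (\<lambda>\<omega>. gain i \<omega> * gain k \<omega>)"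
      unfolding l by (subst Bochner_Integration.integral_mult_right_zero[symmetric]) (simp add: mult_ac)
    then show ?thesis
      unfolding gm(4)[OF that] gain_second_moment[OF that] attenuation_def s_def .
  qed

  define \<nu> where "\<nu> \<omega> = (\<chi> c. Re (z \<omega> $ c)) /\<^sub>R dnf" for \<omega>
  have zc: "(\<lambda>\<omega>. Re (z \<omega> $ c)) \<in> borel_measurable (joint_algebra M E ?J3)" for c
    using borel_measurable_nth_complex[OF z3, of c] by (simp add: borel_measurable_complex_iff)
  have \<nu>3: "\<nu> \<in> borel_measurable (joint_algebra M E ?J3)"
    unfolding borel_measurable_vec_iff \<nu>_def using zc by simp
  have dz: "distributed M lborel (\<lambda>\<omega>. Re (z \<omega> $ c)) (normal_density 0 (sqrt (\<sigma>\<^sup>2 / 2)))" for c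
  proof -
    have "(axis c 1 :: complex^'d) \<in> Basis" by (auto simp: Basis_complex_vec)
    then have "distributed M lborel (\<lambda>\<omega>. z \<omega> \<bullet> axis c 1) (normal_density 0 (sqrt (\<sigma>\<^sup>2 / 2)))"
      using z by (simp add: CN_def)
    then show ?thesis by (simp add: inner_axis inner_complex_def)
  qed
  have s0: "sqrt (\<sigma>\<^sup>2 / 2) > 0" using \<sigma> by simp
  note mz = normal_moments[OF s0 dz]
  have \<nu>0: "expectation (\<lambda>\<omega>. \<nu> \<omega> $ c) = 0" for c using mz(2)[of c] by (simp add: \<nu>_def)
  have n\<nu>: "(norm (\<nu> \<omega>))\<^sup>2 = (\<Sum>c\<in>UNIV. (Re (z \<omega> $ c))\<^sup>2) / dnf\<^sup>2" for \<omega>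
    unfolding power2_norm_eq_inner \<nu>_def
    by (simp add: inner_vec_def power2_eq_square[symmetric] power_mult_distrib divide_inverse mult.commute power_inverse sum_distrib_left) (simp add: sum_distrib_right[symmetric])
  have \<nu>2: "integrable M (\<lambda>\<omega>. (norm (\<nu> \<omega>))\<^sup>2)"
    unfolding n\<nu> using mz(3) by simp
  have E\<nu>: "expectation (\<lambda>\<omega>. (norm (\<nu> \<omega>))\<^sup>2) = noise_term u K CARD('n) CARD('d) G \<sigma> (alpha \<beta> P)"
  proof -
    have "expectation (\<lambda>\<omega>. \<Sum>c\<in>UNIV. (Re (z \<omega> $ c))\<^sup>2) = (\<Sum>c\<in>UNIV. expectation (\<lambda>\<omega>. (Re (z \<omega> $ c))\<^sup>2))"
      by (rule Bochner_Integration.integral_sum) (rule mz(3))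
    also have "\<dots> = real CARD('d) * (\<sigma>\<^sup>2 / 2)"
      unfolding mz(4) by simp
    finally show ?thesis unfolding n\<nu> noise_term_eq by (simp only: Bochner_Integration.integral_divide_zero)
  qed

  \<comment> \<open>Device gradients and interference as one family, so that the estimate is a
    single combination with the coefficients \<open>l i\<close>.\<close>
  define y where "y i = (if i \<in> {1..K} then g i else gi i)" for i
  have yJ: "y i \<in> borel_measurable (joint_algebra M E ?J1)" if "i \<in> ?I" for i
    using avg(1)[of i] past[OF gi, of i ?J1] JJ(1) that by (auto simp: y_def)
  have yi: "(norm (y i \<omega>))\<^sup>2 = 1" if "i \<in> {K+1..K+Q}" "\<omega> \<in> space M" for i \<omega>
    using gi1[OF that] that(1) by (simp add: y_def)
  have y2: "integrable M (\<lambda>\<omega>. (norm (y i \<omega>))\<^sup>2)" if i: "i \<in> ?I" for i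
  proof (cases "i \<in> {1..K}")
    case True
    then show ?thesis using avg(2)[OF True] by (simp add: y_def)
  next
    case False
    then have "i \<in> {K+1..K+Q}" using i by auto
    from yi[OF this] have "integrable M (\<lambda>\<omega>. (norm (y i \<omega>))\<^sup>2) = integrable M (\<lambda>\<omega>. 1 :: real)"
      by (intro Bochner_Integration.integrable_cong) auto
    then show ?thesis by simp
  qed
  have hFP: "(\<lambda>\<omega>. hF (w \<omega>)) \<in> borel_measurable (joint_algebra M E ?J1)"
  proof -
    have wJ: "w \<in> borel_measurable (joint_algebra M E ?J1)" by (rule past[OF w _ JJ(1)]) simp
    show ?thesis unfolding hF
      by (intro borel_measurable_scaleR borel_measurable_const borel_measurable_sum measurable_compose[OF wJ h])
  qed
  have r: "r = (\<lambda>\<omega>. (\<Sum>i\<in>?I. l i \<omega> *\<^sub>R y i \<omega>) + \<nu> \<omega>)"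
  proof
    fix \<omega>
    have "?I = {1..K} \<union> {K+1..K+Q}" by auto
    then have "(\<Sum>i\<in>?I. l i \<omega> *\<^sub>R y i \<omega>) = (\<Sum>i\<in>{1..K}. l i \<omega> *\<^sub>R y i \<omega>) + (\<Sum>i\<in>{K+1..K+Q}. l i \<omega> *\<^sub>R y i \<omega>)"
      by (simp only:) (rule sum.union_disjoint, auto)
    also have "(\<Sum>i\<in>{1..K}. l i \<omega> *\<^sub>R y i \<omega>) = (\<Sum>i\<in>{1..K}. l i \<omega> *\<^sub>R g i \<omega>)"
      by (rule sum.cong) (auto simp: y_def)
    also have "(\<Sum>i\<in>{K+1..K+Q}. l i \<omega> *\<^sub>R y i \<omega>) = (\<Sum>i\<in>{K+1..K+Q}. l i \<omega> *\<^sub>R gi i \<omega>)"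
      by (rule sum.cong) (auto simp: y_def)
    finally show "r \<omega> = (\<Sum>i\<in>?I. l i \<omega> *\<^sub>R y i \<omega>) + \<nu> \<omega>"
      unfolding r_def grad_estimate_def l_def \<nu>_def by simp
  qed
  have fin: "finite ?I" by simp
  note rc = random_combination_moments[OF ind st JJ fin yJ hFP lJ \<nu>3 y2 avg(4) l2 \<nu>2 \<nu>0]
  have Er2: "expectation (\<lambda>\<omega>. (norm (r \<omega>))\<^sup>2) =
      (\<Sum>i\<in>?I. \<Sum>k\<in>?I. expectation (\<lambda>\<omega>. l i \<omega> * l k \<omega>) * expectation (\<lambda>\<omega>. y i \<omega> \<bullet> y k \<omega>))
      + expectation (\<lambda>\<omega>. (norm (\<nu> \<omega>))\<^sup>2)"
    unfolding r by (rule rc(3))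
  show "r \<in> borel_measurable M" unfolding r by (rule rc(1))
  show "integrable M (\<lambda>\<omega>. (norm (r \<omega>))\<^sup>2)" unfolding r by (rule rc(2))
  show "integrable M (\<lambda>\<omega>. hF (w \<omega>) \<bullet> r \<omega>)" unfolding r by (rule rc(4))
  have "expectation (\<lambda>\<omega>. hF (w \<omega>) \<bullet> r \<omega>) = (\<Sum>i\<in>?I. expectation (l i) * expectation (\<lambda>\<omega>. hF (w \<omega>) \<bullet> y i \<omega>))"
    unfolding r by (rule rc(5))
  also have "\<dots> = (\<Sum>k\<in>{1..K}. 1 / real K * expectation (\<lambda>\<omega>. hF (w \<omega>) \<bullet> g k \<omega>))"
    by (rule sum.mono_neutral_cong_right) (auto simp: El y_def)
  also have "\<dots> = X"
    unfolding sum_distrib_left[symmetric] avg(5) X_def using K by simp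
  finally show "expectation (\<lambda>\<omega>. hF (w \<omega>) \<bullet> r \<omega>) = X" .

  let ?e = "\<lambda>i k. expectation (\<lambda>\<omega>. y i \<omega> \<bullet> y k \<omega>)"
  let ?d = "\<lambda>i. (?amp i)\<^sup>2 * (real CARD('n) / 2)"
  \<comment> \<open>The double sum is divided along the block and the diagonal of the moment matrix;
    no product of interference with a gradient survives.\<close>
  have "(\<Sum>i\<in>?I. \<Sum>k\<in>?I. expectation (\<lambda>\<omega>. l i \<omega> * l k \<omega>) * ?e i k) =
     (\<Sum>i\<in>?I. \<Sum>k\<in>?I. (if i \<in> {1..K} \<and> k \<in> {1..K} then s / (real K)\<^sup>2 * ?e i k else 0) + (if i = k then ?d i * ?e i i else 0))"
    by (intro sum.cong refl) (auto simp: Ell distrib_right)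
  also have "\<dots> = (\<Sum>i\<in>?I. \<Sum>k\<in>?I. (if i \<in> {1..K} \<and> k \<in> {1..K} then s / (real K)\<^sup>2 * ?e i k else 0)) + (\<Sum>i\<in>?I. ?d i * ?e i i)"
    by (simp add: sum.distrib)
  also have "(\<Sum>i\<in>?I. \<Sum>k\<in>?I. (if i \<in> {1..K} \<and> k \<in> {1..K} then s / (real K)\<^sup>2 * ?e i k else 0))
      = (\<Sum>i=1..K. \<Sum>k=1..K. s / (real K)\<^sup>2 * expectation (\<lambda>\<omega>. g i \<omega> \<bullet> g k \<omega>))"
  proof (rule sum.mono_neutral_cong_right)
    fix i assume i: "i \<in> {1..K}"
    show "(\<Sum>k\<in>?I. (if i \<in> {1..K} \<and> k \<in> {1..K} then s / (real K)\<^sup>2 * ?e i k else 0))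
        = (\<Sum>k=1..K. s / (real K)\<^sup>2 * expectation (\<lambda>\<omega>. g i \<omega> \<bullet> g k \<omega>))"
      by (rule sum.mono_neutral_cong_right) (use i in \<open>auto simp: y_def\<close>)
  qed auto
  also have "\<dots> = s / (real K)\<^sup>2 * (\<Sum>i=1..K. \<Sum>k=1..K. expectation (\<lambda>\<omega>. g i \<omega> \<bullet> g k \<omega>))"
    by (simp add: sum_distrib_left)
  also have "(\<Sum>i\<in>?I. ?d i * ?e i i) = (\<Sum>k=1..K. ?d k * expectation (\<lambda>\<omega>. (norm (g k \<omega>))\<^sup>2)) + (\<Sum>m\<in>{K+1..K+Q}. ?d m)"
  proof -
    have "?I = {1..K} \<union> {K+1..K+Q}" by auto
    then have "(\<Sum>i\<in>?I. ?d i * ?e i i) = (\<Sum>i\<in>{1..K}. ?d i * ?e i i) + (\<Sum>i\<in>{K+1..K+Q}. ?d i * ?e i i)"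
      by (simp only:) (rule sum.union_disjoint, auto)
    also have "(\<Sum>i\<in>{1..K}. ?d i * ?e i i) = (\<Sum>k=1..K. ?d k * expectation (\<lambda>\<omega>. (norm (g k \<omega>))\<^sup>2))"
      by (rule sum.cong) (auto simp: y_def power2_norm_eq_inner)
    also have "(\<Sum>i\<in>{K+1..K+Q}. ?d i * ?e i i) = (\<Sum>m\<in>{K+1..K+Q}. ?d m)"
    proof (rule sum.cong[OF refl])
      fix m assume m: "m \<in> {K+1..K+Q}"
      have "?e m m = expectation (\<lambda>_. 1)"
        by (rule Bochner_Integration.integral_cong) (use yi[OF m] in \<open>auto simp: power2_norm_eq_inner\<close>)
      then show "?d m * ?e m m = ?d m" by (simp add: prob_space)
    qed
    finally show ?thesis .
  qed
  finally have dbl: "(\<Sum>i\<in>?I. \<Sum>k\<in>?I. expectation (\<lambda>\<omega>. l i \<omega> * l k \<omega>) * ?e i k) =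
     s / (real K)\<^sup>2 * (\<Sum>i=1..K. \<Sum>k=1..K. expectation (\<lambda>\<omega>. g i \<omega> \<bullet> g k \<omega>))
     + ((\<Sum>k=1..K. ?d k * expectation (\<lambda>\<omega>. (norm (g k \<omega>))\<^sup>2)) + (\<Sum>m\<in>{K+1..K+Q}. ?d m))" .
  have s: "0 \<le> s" using attenuation_nonneg by (simp add: s_def attenuation_def)
  have t1: "s / (real K)\<^sup>2 * (\<Sum>i=1..K. \<Sum>k=1..K. expectation (\<lambda>\<omega>. g i \<omega> \<bullet> g k \<omega>)) \<le> s * X + s / real K * v"
  proof -
    have "s / (real K)\<^sup>2 * (\<Sum>i=1..K. \<Sum>k=1..K. expectation (\<lambda>\<omega>. g i \<omega> \<bullet> g k \<omega>)) \<le> s / (real K)\<^sup>2 * ((real K)\<^sup>2 * X + real K * v)"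
      unfolding X_def using avg(6) s by (intro mult_left_mono) auto
    also have "\<dots> = s * X + s / real K * v" using K by (simp add: field_simps power2_eq_square)
    finally show ?thesis .
  qed
  \<comment> \<open>Individual gradients do not average out: each is bounded by its mean square plus
    variance, and the mean by \<xi> times the global gradient.\<close>
  have t2: "(\<Sum>k=1..K. ?d k * expectation (\<lambda>\<omega>. (norm (g k \<omega>))\<^sup>2)) \<le> a * (\<xi>\<^sup>2 * X + v)"
  proof -
    have "expectation (\<lambda>\<omega>. (norm (g k \<omega>))\<^sup>2) \<le> \<xi>\<^sup>2 * X + v" if k: "k \<in> {1..K}" for k
    proof -
      have "(norm (h k x))\<^sup>2 \<le> \<xi>\<^sup>2 * (norm (hF x))\<^sup>2" for x
        using power_mono[OF \<xi>[OF k, of x] norm_ge_zero, of 2] by (simp add: power_mult_distrib)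
      then have "expectation (\<lambda>\<omega>. (norm (h k (w \<omega>)))\<^sup>2) \<le> expectation (\<lambda>\<omega>. \<xi>\<^sup>2 * (norm (hF (w \<omega>)))\<^sup>2)"
        using avg(3)[OF k] avg(4) by (intro integral_mono) auto
      then show ?thesis using avg(7)[OF k] by (simp add: X_def)
    qed
    then have "(\<Sum>k=1..K. ?d k * expectation (\<lambda>\<omega>. (norm (g k \<omega>))\<^sup>2)) \<le> (\<Sum>k=1..K. ?d k * (\<xi>\<^sup>2 * X + v))"
      by (intro sum_mono mult_left_mono) auto
    also have "\<dots> = (\<Sum>k=1..K. ?d k) * (\<xi>\<^sup>2 * X + v)"
      by (rule sum_distrib_right[symmetric])
    also have "(\<Sum>k=1..K. ?d k) = a"
      unfolding a_def by (rule device_noise_sum)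
    finally show ?thesis .
  qed
  have "expectation (\<lambda>\<omega>. (norm (r \<omega>))\<^sup>2) = s / (real K)\<^sup>2 * (\<Sum>i=1..K. \<Sum>k=1..K. expectation (\<lambda>\<omega>. g i \<omega> \<bullet> g k \<omega>))
     + ((\<Sum>k=1..K. ?d k * expectation (\<lambda>\<omega>. (norm (g k \<omega>))\<^sup>2)) + interference_term u K Q CARD('n) G (alpha \<beta> P))
     + noise_term u K CARD('n) CARD('d) G \<sigma> (alpha \<beta> P)"
    unfolding Er2 dbl E\<nu> interference_term_eq ..
  also have "\<dots> \<le> (s * X + s / real K * v) + (a * (\<xi>\<^sup>2 * X + v) + interference_term u K Q CARD('n) G (alpha \<beta> P))
     + noise_term u K CARD('n) CARD('d) G \<sigma> (alpha \<beta> P)"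
    by (intro add_mono t1 t2 order_refl)
  also have "\<dots> = (s + a * \<xi>\<^sup>2) * X + (a + s / real K) * v
      + interference_term u K Q CARD('n) G (alpha \<beta> P) + noise_term u K CARD('n) CARD('d) G \<sigma> (alpha \<beta> P)"
    by (simp add: algebra_simps)
  finally show "expectation (\<lambda>\<omega>. (norm (r \<omega>))\<^sup>2) \<le> (s + a * \<xi>\<^sup>2) * X + (a + s / real K) * v
      + interference_term u K Q CARD('n) G (alpha \<beta> P) + noise_term u K CARD('n) CARD('d) G \<sigma> (alpha \<beta> P)" .
qed

section \<open>The descent recursion\<close>

context power_budget begin

lemma borel_measurable_grad_estimate:
  fixes hp :: "'a \<Rightarrow> complex^'n" and hr :: "nat \<Rightarrow> 'a \<Rightarrow> complex^'n" and z :: "'a \<Rightarrow> complex^'d"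
    and g gi :: "nat \<Rightarrow> 'a \<Rightarrow> real^'d"
  assumes N: "N = CARD('n)" and hp: "hp \<in> borel_measurable A" and z: "z \<in> borel_measurable A"
    and hr: "\<And>i. i \<in> {1..K+M} \<Longrightarrow> hr i \<in> borel_measurable A"
    and g: "\<And>k. k \<in> {1..K} \<Longrightarrow> g k \<in> borel_measurable A"
    and gi: "\<And>m. m \<in> {K+1..K+M} \<Longrightarrow> gi m \<in> borel_measurable A"
  shows "(\<lambda>x. grad_estimate u K M G \<beta> P (hp x) (\<lambda>i. hr i x) (\<lambda>k. g k x) (\<lambda>m. gi m x) (z x)) \<in> borel_measurable A"
proof -
  have rx: "(\<lambda>x. rx_coeff u K G \<beta> P (hp x) (\<lambda>i. hr i x) i) \<in> borel_measurable A" if "i \<in> {1..K+M}" for i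
    unfolding rx_coeff_eq[OF N]
    by (rule borel_measurable_times[OF borel_measurable_const borel_measurable_ris_gain[OF hp hr that]])
  have "(\<lambda>x. Re (z x $ c)) \<in> borel_measurable A" for c
    using borel_measurable_nth_complex[OF z, of c] by (simp add: borel_measurable_complex_iff)
  then have nu: "(\<lambda>x. \<chi> c. Re (z x $ c)) \<in> borel_measurable A"
    unfolding borel_measurable_vec_iff by simp
  show ?thesis
    unfolding grad_estimate_def
    by (intro borel_measurable_add borel_measurable_sum borel_measurable_scaleR rx g gi nu borel_measurable_const) auto
qed

end

text \<open>The descent inequality is averaged round by round and telescoped, the last value being
  bounded below by \<open>Fs\<close>. Integrability of the losses is derived along the way rather
  than assumed.\<close>

lemma (in prob_space) descent_sum:
  fixes F :: "real^'d \<Rightarrow> real" and w r :: "nat \<Rightarrow> 'a \<Rightarrow> real^'d"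
  assumes diff: "\<And>v. F differentiable (at v)" and lip: "L-lipschitz_on UNIV (grad F)" and L: "0 \<le> L"
    and lower: "\<And>v. Fs \<le> F v"
    and w: "\<And>t. t \<le> T \<Longrightarrow> w t \<in> borel_measurable M"
    and w0: "\<And>x. x \<in> space M \<Longrightarrow> w 0 x = w0"
    and step: "\<And>t x. t < T \<Longrightarrow> x \<in> space M \<Longrightarrow> w (Suc t) x = w t x - \<eta> *\<^sub>R r t x"
    and r2: "\<And>t. t < T \<Longrightarrow> integrable M (\<lambda>x. (norm (r t x))\<^sup>2)"
    and dr: "\<And>t. t < T \<Longrightarrow> integrable M (\<lambda>x. grad F (w t x) \<bullet> r t x)"
    and Edr: "\<And>t. t < T \<Longrightarrow> expectation (\<lambda>x. grad F (w t x) \<bullet> r t x) = X t"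
    and Er2: "\<And>t. t < T \<Longrightarrow> expectation (\<lambda>x. (norm (r t x))\<^sup>2) \<le> c * X t + b"
  shows "(\<Sum>t<T. (\<eta> - L * \<eta>\<^sup>2 * c / 2) * X t) \<le> F w0 - Fs + real T * (L * \<eta>\<^sup>2 * b / 2)"
proof -
  have Fm: "F \<in> borel_measurable borel"
    by (intro borel_measurable_continuous_onI continuous_at_imp_continuous_on ballI
        differentiable_imp_continuous_within diff)
  have bound: "F (w (Suc t) x) \<le> F (w t x) - \<eta> * (grad F (w t x) \<bullet> r t x) + L * \<eta>\<^sup>2 / 2 * (norm (r t x))\<^sup>2"
    if "t < T" "x \<in> space M" for t x
    using descent_lemma[OF diff lip, of "w (Suc t) x" "w t x"] step[OF that]
    by (simp add: power_mult_distrib)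
  have int: "integrable M (\<lambda>x. F (w t x))" if "t \<le> T" for t
    using that
  proof (induction t)
    case 0
    have "integrable M (\<lambda>x. F (w 0 x)) \<longleftrightarrow> integrable M (\<lambda>x. F w0)"
      by (rule Bochner_Integration.integrable_cong) (auto simp: w0)
    then show ?case by simp
  next
    case (Suc t)
    let ?R = "\<lambda>x. F (w t x) - \<eta> * (grad F (w t x) \<bullet> r t x) + L * \<eta>\<^sup>2 / 2 * (norm (r t x))\<^sup>2"
    \<comment> \<open>The new loss lies between \<open>Fs\<close> and \<open>?R x\<close>, hence its
      modulus is dominated by this sum.\<close>
    have "integrable M (\<lambda>x. \<bar>?R x\<bar> + \<bar>Fs\<bar>)" using Suc dr[of t] r2[of t] by simp
    then show ?case
    proof (rule Bochner_Integration.integrable_bound)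
      show "(\<lambda>x. F (w (Suc t) x)) \<in> borel_measurable M"
        by (rule measurable_compose[OF w[OF Suc.prems] Fm])
      show "AE x in M. norm (F (w (Suc t) x)) \<le> norm (\<bar>?R x\<bar> + \<bar>Fs\<bar>)"
      proof (rule AE_I2)
        fix x assume "x \<in> space M"
        with bound[of t x] lower[of "w (Suc t) x"] Suc.prems
        show "norm (F (w (Suc t) x)) \<le> norm (\<bar>?R x\<bar> + \<bar>Fs\<bar>)" by simp
      qed
    qed
  qed
  define V where "V t = expectation (\<lambda>x. F (w t x))" for t
  have V: "(\<eta> - L * \<eta>\<^sup>2 * c / 2) * X t \<le> V t - V (Suc t) + L * \<eta>\<^sup>2 * b / 2" if t: "t < T" for t
  proof -
    have "V (Suc t) \<le> expectation (\<lambda>x. F (w t x) - \<eta> * (grad F (w t x) \<bullet> r t x) + L * \<eta>\<^sup>2 / 2 * (norm (r t x))\<^sup>2)"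
      unfolding V_def using t dr r2 int bound
      by (intro integral_mono Bochner_Integration.integrable_add Bochner_Integration.integrable_diff integrable_mult_right) auto
    also have "\<dots> = V t - \<eta> * X t + L * \<eta>\<^sup>2 / 2 * expectation (\<lambda>x. (norm (r t x))\<^sup>2)"
      using t dr r2 int by (simp add: V_def Edr)
    also have "\<dots> \<le> V t - \<eta> * X t + L * \<eta>\<^sup>2 / 2 * (c * X t + b)"
      using Er2[OF t] L by (intro add_left_mono mult_left_mono) auto
    finally show ?thesis by (simp add: algebra_simps add_divide_distrib)
  qed
  have "(\<Sum>t<T. (\<eta> - L * \<eta>\<^sup>2 * c / 2) * X t) \<le> (\<Sum>t<T. V t - V (Suc t) + L * \<eta>\<^sup>2 * b / 2)"
    using V by (intro sum_mono) auto
  also have "\<dots> = V 0 - V T + real T * (L * \<eta>\<^sup>2 * b / 2)"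
    by (simp add: sum.distrib sum_lessThan_telescope')
  also have "V 0 = F w0"
  proof -
    have "V 0 = expectation (\<lambda>_. F w0)"
      unfolding V_def by (rule Bochner_Integration.integral_cong) (auto simp: w0)
    then show ?thesis by (simp add: prob_space)
  qed
  also have "F w0 - V T + real T * (L * \<eta>\<^sup>2 * b / 2) \<le> F w0 - Fs + real T * (L * \<eta>\<^sup>2 * b / 2)"
  proof -
    have "expectation (\<lambda>_. Fs) \<le> V T"
      unfolding V_def using int lower by (intro integral_mono) auto
    then show ?thesis by (simp add: prob_space)
  qed
  finally show ?thesis .
qed

section \<open>From the descent recursion to the rate\<close>

lemma gradient_bound_by_gap:
  assumes diff: "\<And>v. F differentiable (at v)" and lip: "L-lipschitz_on UNIV (grad F)" and L: "0 < L"
    and lower: "\<And>v. Fs \<le> F v"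
  shows "(norm (grad F x))\<^sup>2 \<le> 2 * L * (F x - Fs)"
proof -
  \<comment> \<open>The step of length \<open>1 / L\<close> minimizes the quadratic majorant at
    \<open>x\<close>, and even there the loss stays above \<open>Fs\<close>.\<close>
  have "Fs \<le> F (x - (1 / L) *\<^sub>R grad F x)" by (rule lower)
  also have "\<dots> \<le> F x - (norm (grad F x))\<^sup>2 / L + L / 2 * ((norm (grad F x))\<^sup>2 / L\<^sup>2)"
    using descent_lemma[OF diff lip, of "x - (1 / L) *\<^sub>R grad F x" x] L
    by (simp add: power_mult_distrib power_divide power2_norm_eq_inner)
  also have "\<dots> = F x - (norm (grad F x))\<^sup>2 / (2 * L)"
    using L by (simp add: field_simps power2_eq_square)
  finally show ?thesis using L by (simp add: field_simps)
qed

lemma convergence_rate_arith: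
  fixes X :: "nat \<Rightarrow> real"
  assumes T: "1 \<le> T" and L: "0 < L" "L \<le> x" and c: "c * L \<le> 7 / 5 * x" and e: "0 \<le> e"
    and X: "\<And>t. 0 \<le> X t"
    and rec: "(\<Sum>t<T. (\<eta> - L * \<eta>\<^sup>2 * c / 2) * X t) \<le> \<Delta> + real T * (\<eta>\<^sup>2 * e / 2)"
    and \<eta>: "\<eta> = 1 / (x * sqrt (real T))"
    and X0: "X 0 \<le> 2 * L * \<Delta>"
  shows "1 / real T * (\<Sum>t<T. X t) \<le> 2 * x / sqrt (real T) * (\<Delta> + e / (2 * x\<^sup>2))"
proof -
  have x: "0 < x" using L by simp
  have "0 \<le> 2 * L * \<Delta>" using X[of 0] X0 by linarith
  then have \<Delta>: "0 \<le> \<Delta>" using L by (simp add: zero_le_mult_iff)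
  show ?thesis
  proof (cases "T = 1")
    case True
    \<comment> \<open>For a single round the step size is too large for the recursion when
      \<open>c * L > x\<close>, but only the gradient at the initial model is involved, and
      smoothness alone bounds it.\<close>
    have "X 0 \<le> 2 * x * \<Delta>" using X0 mult_right_mono[OF L(2) \<Delta>] by linarith
    also have "\<dots> \<le> 2 * x * (\<Delta> + e / (2 * x\<^sup>2))" using x e by (intro mult_left_mono) auto
    finally show ?thesis using True by simp
  next
    case False
    define q where "q = sqrt (real T)"
    have q2: "q\<^sup>2 = real T" by (simp add: q_def)
    \<comment> \<open>\<open>49 / 25 < 2 \<le> T\<close>: two rounds suffice for
      \<open>sqrt T\<close> to absorb the excess of \<open>c * L\<close> over
      \<open>x\<close>.\<close>
    have "sqrt ((7 / 5)\<^sup>2) \<le> q" unfolding q_def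
    proof (rule real_sqrt_le_mono)
      have "(2::real) \<le> real T" using T False by simp
      moreover have "(7 / 5 :: real)\<^sup>2 \<le> 2" by (simp add: power2_eq_square)
      ultimately show "(7 / 5)\<^sup>2 \<le> real T" by linarith
    qed
    then have q: "7 / 5 \<le> q" by simp
    then have q0: "0 < q" by linarith
    have \<eta>q: "\<eta> = 1 / (x * q)" by (simp add: \<eta> q_def)
    have \<eta>0: "0 < \<eta>" using x q0 by (simp add: \<eta>q)
    have "c * L \<le> x * q" using c mult_left_mono[OF q, of x] x by linarith
    then have "\<eta> * (c * L) \<le> \<eta> * (x * q)" using \<eta>0 by (intro mult_left_mono) auto
    also have "\<dots> = 1" using x q0 by (simp add: \<eta>q)
    finally have "\<eta> * (\<eta> * (c * L)) \<le> \<eta> * 1" using \<eta>0 by (intro mult_left_mono) auto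
    \<comment> \<open>With \<open>\<eta> * c * L \<le> 1\<close> the quadratic loss consumes at most
      half of the linear gain.\<close>
    then have co: "\<eta> / 2 \<le> \<eta> - L * \<eta>\<^sup>2 * c / 2" by (simp add: power2_eq_square algebra_simps)
    have "\<eta> / 2 * (\<Sum>t<T. X t) \<le> (\<Sum>t<T. (\<eta> - L * \<eta>\<^sup>2 * c / 2) * X t)"
      unfolding sum_distrib_left using co X by (intro sum_mono mult_right_mono) auto
    also note rec
    also have "real T * (\<eta>\<^sup>2 * e / 2) = e / (2 * x\<^sup>2)"
      unfolding q2[symmetric] \<eta>q using q0 x by (simp add: power_divide power_mult_distrib)
    finally have "\<eta> / 2 * (\<Sum>t<T. X t) \<le> \<Delta> + e / (2 * x\<^sup>2)" .
    \<comment> \<open>This multiplier turns \<open>\<eta> / 2\<close> into \<open>1 / q^2\<close>,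
      which is \<open>1 / T\<close>.\<close>
    then have "2 * x / q * (\<eta> / 2 * (\<Sum>t<T. X t)) \<le> 2 * x / q * (\<Delta> + e / (2 * x\<^sup>2))"
      using x q0 by (intro mult_left_mono) auto
    moreover have "2 * x / q * (\<eta> / 2 * (\<Sum>t<T. X t)) = 1 / real T * (\<Sum>t<T. X t)"
      unfolding q2[symmetric] \<eta>q using q0 x by (simp add: power2_eq_square)
    ultimately show ?thesis by (simp add: q_def)
  qed
qed

section \<open>Numerical estimates of the constants\<close>

context power_budget begin

text \<open>The two summands are compared separately: \<open>s \<le> 1\<close> because
  \<open>pi^2 \<ge> 8\<close>, and \<open>a\<close> against the coefficient of \<xi>^2 in the
  scaling factor.\<close>

lemma scaling_factor_bounds:
  assumes L: "0 < L"
  defines "s \<equiv> (8 + pi\<^sup>2 * (real N - 1)) / (pi\<^sup>2 * real N)" and "a \<equiv> 8 * imbalance u K \<beta> P / (pi\<^sup>2 * real N)"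
  shows "L \<le> scaling_factor u K N L \<xi> (alpha \<beta> P)"
    and "(s + a * \<xi>\<^sup>2) * L \<le> 7 / 5 * scaling_factor u K N L \<xi> (alpha \<beta> P)"
proof -
  let ?A = "imbalance u K \<beta> P"
  define p where "p = pi\<^sup>2"
  have p: "8 \<le> p" "p \<le> 10"
  proof -
    have "(3::real)\<^sup>2 \<le> pi\<^sup>2" using pi_approx by (intro power_mono) auto
    then show "8 \<le> p" by (simp add: p_def)
    have "pi\<^sup>2 \<le> (316/100)\<^sup>2" using pi_approx by (intro power_mono) auto
    also have "\<dots> \<le> (10::real)" by (simp add: power2_eq_square)
    finally show "p \<le> 10" by (simp add: p_def)
  qed
  define q where "q = p * real N"
  have q: "0 < q" using p N by (simp add: q_def)
  have A: "1 \<le> ?A" by (rule imbalance_ge_1)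
  have sf: "scaling_factor u K N L \<xi> (alpha \<beta> P) = ((8 * ?A + 8 - p) / q * \<xi>\<^sup>2 + 1) * L"
    unfolding scaling_factor_eq p_def q_def ..
  have "0 \<le> (8 * ?A + 8 - p) / q * \<xi>\<^sup>2" using A p q by simp
  then have "1 * L \<le> ((8 * ?A + 8 - p) / q * \<xi>\<^sup>2 + 1) * L" using L by (intro mult_right_mono) auto
  then show "L \<le> scaling_factor u K N L \<xi> (alpha \<beta> P)" unfolding sf by simp
  have "s = (q + (8 - p)) / q"
    unfolding s_def p_def[symmetric] q_def by (simp add: algebra_simps)
  then have "s = 1 + (8 - p) / q"
    using q by (simp add: add_divide_distrib)
  moreover have "(8 - p) / q \<le> 0" using p q by (simp add: divide_nonpos_pos)
  ultimately have s: "s \<le> 7 / 5" by linarith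
  \<comment> \<open>Equivalent to \<open>7 * (p - 8) \<le> 16 * ?A\<close>. With
    \<open>?A \<ge> 1\<close> the crude bound \<open>p \<le> 10\<close> for \<open>pi^2\<close> is
    enough.\<close>
  have "8 * ?A \<le> 7 / 5 * (8 * ?A + 8 - p)" using A p by (simp add: field_simps)
  then have "8 * ?A / q \<le> 7 / 5 * (8 * ?A + 8 - p) / q" using q by (intro divide_right_mono) auto
  then have "a * \<xi>\<^sup>2 \<le> 7 / 5 * (8 * ?A + 8 - p) / q * \<xi>\<^sup>2"
    unfolding a_def p_def[symmetric] q_def[symmetric] by (intro mult_right_mono) auto
  also have "\<dots> = 7 / 5 * ((8 * ?A + 8 - p) / q * \<xi>\<^sup>2)" by simp
  finally have "s + a * \<xi>\<^sup>2 \<le> 7 / 5 + 7 / 5 * ((8 * ?A + 8 - p) / q * \<xi>\<^sup>2)" using s by (rule add_mono[rotated])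
  also have "\<dots> = 7 / 5 * ((8 * ?A + 8 - p) / q * \<xi>\<^sup>2 + 1)" by (simp only: distrib_left mult_1_right add.commute)
  finally have "s + a * \<xi>\<^sup>2 \<le> 7 / 5 * ((8 * ?A + 8 - p) / q * \<xi>\<^sup>2 + 1)" .
  then have "(s + a * \<xi>\<^sup>2) * L \<le> 7 / 5 * ((8 * ?A + 8 - p) / q * \<xi>\<^sup>2 + 1) * L" using L by (intro mult_right_mono) auto
  then show "(s + a * \<xi>\<^sup>2) * L \<le> 7 / 5 * scaling_factor u K N L \<xi> (alpha \<beta> P)" unfolding sf by (simp only: mult.assoc)
qed

lemma bias_term_nonneg:
  assumes "0 < L" shows "0 \<le> bias_term u K M N D L G \<sigma> c (alpha \<beta> P)"
proof -
  have "0 \<le> interference_term u K M N G (alpha \<beta> P)"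
    unfolding interference_term_eq by (intro sum_nonneg) simp
  moreover have "0 \<le> noise_term u K N D G \<sigma> (alpha \<beta> P)" unfolding noise_term_eq by simp
  moreover have "0 \<le> 8 * imbalance u K \<beta> P / (pi\<^sup>2 * real N) + (8 + pi\<^sup>2 * (real N - 1)) / (pi\<^sup>2 * real N * real K)"
    using imbalance_ge_1 N by (intro add_nonneg_nonneg divide_nonneg_nonneg) auto
  ultimately show ?thesis
    unfolding bias_term_eq using assms
    by (intro mult_nonneg_nonneg[of _ L] add_nonneg_nonneg[of _ "noise_term _ _ _ _ _ _ _"]
        add_nonneg_nonneg[of _ "interference_term _ _ _ _ _ _"] mult_nonneg_nonneg[of _ "c\<^sup>2"]) auto
qed

end

section \<open>Smoothness of the global loss, and the theorem\<close>

lemma global_loss_smooth: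
  fixes f :: "'s \<Rightarrow> real^'d \<Rightarrow> real"
  assumes K: "1 \<le> K"
    and diff: "\<And>k v. k \<in> {1..K} \<Longrightarrow> local_loss f x S k differentiable (at v)"
    and lip: "\<And>k. k \<in> {1..K} \<Longrightarrow> L-lipschitz_on UNIV (grad (local_loss f x S k))"
  shows "\<And>v. global_loss f x S K differentiable (at v)"
    and "\<And>v. grad (global_loss f x S K) v = (\<Sum>k=1..K. grad (local_loss f x S k) v) /\<^sub>R real K"
    and "L-lipschitz_on UNIV (grad (global_loss f x S K))"
proof -
  let ?F = "global_loss f x S K" and ?h = "\<lambda>k. grad (local_loss f x S k)"
  have der: "(?F has_derivative (\<lambda>y. y \<bullet> ((\<Sum>k=1..K. ?h k v) /\<^sub>R real K))) (at v)" for v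
  proof -
    have "(local_loss f x S k has_derivative (\<lambda>y. y \<bullet> ?h k v)) (at v)" if "k \<in> {1..K}" for k
      using GDERIV_grad[OF diff[OF that]] by (simp add: gderiv_def)
    then have "((\<lambda>w. (\<Sum>k=1..K. local_loss f x S k w) / real K) has_derivative (\<lambda>y. (\<Sum>k=1..K. y \<bullet> ?h k v) / real K)) (at v)"
      unfolding divide_inverse by (intro has_derivative_mult_left has_derivative_sum) auto
    then show ?thesis
      unfolding global_loss_def[abs_def] by (rule has_derivative_eq_rhs) (auto simp: inner_sum_right divide_inverse mult.commute)
  qed
  show "?F differentiable (at v)" for v using der[of v] by (auto simp: differentiable_def)
  show gr: "grad ?F v = (\<Sum>k=1..K. ?h k v) /\<^sub>R real K" for v
    by (rule grad_eqI) (simp only: gderiv_def der)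
  show "L-lipschitz_on UNIV (grad ?F)"
  proof (rule lipschitz_onI)
    show "0 \<le> L" using lipschitz_on_nonneg[OF lip[of 1]] K by simp
    fix v y
    have "dist (grad ?F v) (grad ?F y) = norm (\<Sum>k=1..K. ?h k v - ?h k y) / real K"
      using K unfolding dist_norm gr by (simp add: sum_subtractf scaleR_diff_right[symmetric] divide_inverse mult.commute)
    also have "\<dots> \<le> (\<Sum>k=1..K. norm (?h k v - ?h k y)) / real K"
      by (intro divide_right_mono norm_sum) simp
    also have "\<dots> \<le> (\<Sum>k=1..K. L * dist v y) / real K"
      using lipschitz_onD[OF lip] by (intro divide_right_mono sum_mono) (auto simp: dist_norm)
    also have "\<dots> = L * dist v y" using K by simp
    finally show "dist (grad ?F v) (grad ?F y) \<le> L * dist v y" .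
  qed
qed

theorem theorem4:
  fixes u :: scheme
    and K M T S :: nat
    and G L \<xi> \<chi>\<^sub>g \<sigma> varpi \<epsilon> :: real
    and \<beta> P \<eta> :: "nat \<Rightarrow> real"
    and f :: "'s \<Rightarrow> real^'d \<Rightarrow> real"
    and x :: "nat \<Rightarrow> nat \<Rightarrow> 's"
    and Fk :: "nat \<Rightarrow> real^'d \<Rightarrow> real"
    and F :: "real^'d \<Rightarrow> real"
    and w0 wstar :: "real^'d"
    and Pr :: "'w measure"
    and \<F> :: "nat \<Rightarrow> 'w measure"
    and B :: "nat \<Rightarrow> nat \<Rightarrow> 'w \<Rightarrow> nat set"
    and hp :: "nat \<Rightarrow> 'w \<Rightarrow> complex^'n"
    and hr :: "nat \<Rightarrow> nat \<Rightarrow> 'w \<Rightarrow> complex^'n"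
    and z :: "nat \<Rightarrow> 'w \<Rightarrow> complex^'d"
    and w :: "nat \<Rightarrow> 'w \<Rightarrow> real^'d"
    and g gi :: "nat \<Rightarrow> nat \<Rightarrow> 'w \<Rightarrow> real^'d"
  defines "Fk \<equiv> local_loss f x S"
    and "F \<equiv> global_loss f x S K"
    and "varpi \<equiv> scaling_factor u K CARD('n) L \<xi> (alpha \<beta> P)"
    and "\<epsilon> \<equiv> bias_term u K M CARD('n) CARD('d) L G \<sigma> \<chi>\<^sub>g (alpha \<beta> P)"
  assumes "K \<ge> 1" "T \<ge> 1" "S \<ge> 1" "G > 0" "L > 0" "\<sigma> > 0"
    and "\<And>i. i \<in> {1..K+M} \<Longrightarrow> \<beta> i > 0 \<and> P i > 0"
    \<comment> \<open>losses, Assumptions 1 and 3\<close>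
    and "\<And>k j v. k \<in> {1..K} \<Longrightarrow> j < S \<Longrightarrow> f (x k j) differentiable (at v)"
    and "\<And>k v. k \<in> {1..K} \<Longrightarrow> Fk k differentiable (at v)"
    and "\<And>k. k \<in> {1..K} \<Longrightarrow> L-lipschitz_on UNIV (grad (Fk k))"
    and "\<And>k v. k \<in> {1..K} \<Longrightarrow> norm (grad (Fk k) v) \<le> \<xi> * norm (grad F v)"
    and "is_arg_min F (\<lambda>_. True) wstar"
    \<comment> \<open>random quantities\<close>
    and "prob_space Pr"
    and "filtration (space Pr) \<F>"
    and "\<And>t. subalgebra Pr (\<F> t)"
    and "\<And>t k. t < T \<Longrightarrow> k \<in> {1..K} \<Longrightarrow> B t k \<in> measurable (\<F> (Suc t)) (count_space UNIV)"
    and "\<And>t. t < T \<Longrightarrow> hp t \<in> borel_measurable (\<F> (Suc t))"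
    and "\<And>t i. t < T \<Longrightarrow> i \<in> {1..K+M} \<Longrightarrow> hr t i \<in> borel_measurable (\<F> (Suc t))"
    and "\<And>t. t < T \<Longrightarrow> z t \<in> borel_measurable (\<F> (Suc t))"
    and "\<And>t m. t < T \<Longrightarrow> m \<in> {K+1..K+M} \<Longrightarrow> gi t m \<in> borel_measurable (\<F> t)"
    and "\<And>t. t < T \<Longrightarrow> round_indep Pr K M (\<F> t) (B t) (hp t) (hr t) (z t)"
    and "\<And>t. t < T \<Longrightarrow> CN Pr 1 (hp t)"
    and "\<And>t i. t < T \<Longrightarrow> i \<in> {1..K+M} \<Longrightarrow> CN Pr 1 (hr t i)"
    and "\<And>t. t < T \<Longrightarrow> CN Pr (\<sigma>\<^sup>2) (z t)"
    and "\<And>t m \<omega>. t < T \<Longrightarrow> m \<in> {K+1..K+M} \<Longrightarrow> \<omega> \<in> space Pr \<Longrightarrow> norm (gi t m \<omega>) = 1"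
    \<comment> \<open>local gradients, Assumption 2\<close>
    and "\<And>t k \<omega>. t < T \<Longrightarrow> k \<in> {1..K} \<Longrightarrow> \<omega> \<in> space Pr \<Longrightarrow> B t k \<omega> \<noteq> {} \<and> B t k \<omega> \<subseteq> {..<S}"
    and "\<And>t k \<omega>. t < T \<Longrightarrow> k \<in> {1..K} \<Longrightarrow> \<omega> \<in> space Pr \<Longrightarrow>
           g t k \<omega> = minibatch_grad f x k (B t k \<omega>) (w t \<omega>)"
    and "\<And>t k \<omega>. t < T \<Longrightarrow> k \<in> {1..K} \<Longrightarrow> \<omega> \<in> space Pr \<Longrightarrow> norm (g t k \<omega>) \<le> G"
    and "\<And>t k. t < T \<Longrightarrow> k \<in> {1..K} \<Longrightarrow>
           (AE \<omega> in Pr. cond_mean Pr (w t) (g t k) \<omega> = grad (Fk k) (w t \<omega>))"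
    and "\<And>t k. t < T \<Longrightarrow> k \<in> {1..K} \<Longrightarrow>
           (AE \<omega> in Pr. cond_variance Pr (w t) (g t k) \<omega> \<le> \<chi>\<^sub>g\<^sup>2)"
    \<comment> \<open>model updates\<close>
    and "\<And>\<omega>. \<omega> \<in> space Pr \<Longrightarrow> w 0 \<omega> = w0"
    and "\<And>t \<omega>. t < T \<Longrightarrow> \<omega> \<in> space Pr \<Longrightarrow>
           w (Suc t) \<omega> = w t \<omega> - \<eta> t *\<^sub>R
             grad_estimate u K M G \<beta> P (hp t \<omega>) (\<lambda>i. hr t i \<omega>) (\<lambda>k. g t k \<omega>) (\<lambda>m. gi t m \<omega>) (z t \<omega>)"
    and "\<And>t. t < T \<Longrightarrow> \<eta> t = 1 / (varpi * sqrt (real T))"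
  shows "(\<forall>t<T. integrable Pr (\<lambda>\<omega>. (norm (grad F (w t \<omega>)))\<^sup>2)) \<and>
    1 / real T * (\<Sum>t<T. prob_space.expectation Pr (\<lambda>\<omega>. (norm (grad F (w t \<omega>)))\<^sup>2))
      \<le> 2 * varpi / sqrt (real T) *
        (F w0 - prob_space.expectation Pr (\<lambda>_. F wstar) + \<epsilon> / (2 * varpi\<^sup>2))"
proof -
  \<comment> \<open>The first four entries of \<open>assms\<close> are the defining equations of
    \<open>Fk\<close>, \<open>F\<close>, \<open>varpi\<close> and \<open>\<epsilon>\<close>, so the
    numbering restarts at the genuine hypotheses.\<close>
  note prems = assms(5-)
  interpret prob_space Pr by fact
  interpret filtration "space Pr" \<F> by fact
  interpret power_budget u K M "CARD('n)" G \<beta> P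
    using prems(1,4,7) by unfold_locales auto
  note T = prems(2) and L = prems(5) and \<sigma> = prems(6)
  define h where "h k = grad (Fk k)" for k
  define CC where "CC = Pow {..<S}"
  define \<Gamma> where "\<Gamma> k C = minibatch_grad f x k C" for k C
  have Fdiff: "F differentiable (at v)" and hF: "grad F v = (\<Sum>k=1..K. h k v) /\<^sub>R real K" for v
    using global_loss_smooth(1,2)[of K f x S L] prems(1,9,10) by (auto simp: F_def Fk_def h_def)
  have Flip: "L-lipschitz_on UNIV (grad F)"
    using global_loss_smooth(3)[of K f x S L] prems(1,9,10) by (auto simp: F_def Fk_def)
  have Fmin: "F wstar \<le> F v" for v
    using prems(12) by (auto simp: is_arg_min_def not_less)
  have h: "h k \<in> borel_measurable borel" if "k \<in> {1..K}" for k
    unfolding h_def by (rule borel_measurable_grad) (rule prems(9)[OF that])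
  have CC: "finite CC" "\<And>t k \<omega>. t < T \<Longrightarrow> k \<in> {1..K} \<Longrightarrow> \<omega> \<in> space Pr \<Longrightarrow> B t k \<omega> \<in> CC"
    using prems(26) by (auto simp: CC_def)
  have \<Gamma>: "\<Gamma> k C \<in> borel_measurable borel" if k: "k \<in> {1..K}" and C: "C \<in> CC" for k C
    unfolding \<Gamma>_def minibatch_grad_def
  proof (intro borel_measurable_scaleR borel_measurable_const borel_measurable_sum)
    fix j assume "j \<in> C"
    then have j: "j < S" using C by (auto simp: CC_def)
    show "grad (f (x k j)) \<in> borel_measurable borel"
      by (rule borel_measurable_grad) (rule prems(8)[OF k j])
  qed
  have g: "g t k \<omega> = \<Gamma> k (B t k \<omega>) (w t \<omega>)" if "t < T" "k \<in> {1..K}" "\<omega> \<in> space Pr" for t k \<omega>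
    unfolding \<Gamma>_def by (rule prems(27)[OF that])
  define r where "r t \<omega> = grad_estimate u K M G \<beta> P (hp t \<omega>) (\<lambda>i. hr t i \<omega>) (\<lambda>k. g t k \<omega>) (\<lambda>m. gi t m \<omega>) (z t \<omega>)" for t \<omega>
  have mono: "Z \<in> borel_measurable (\<F> (Suc t))" if "Z \<in> borel_measurable (\<F> t)" for Z :: "'w \<Rightarrow> real^'d" and t
    using measurable_sets[OF that] sets_F_mono[of t "Suc t"] by (intro measurableI) (auto simp: space_F)
  \<comment> \<open>The draws of round \<open>t\<close> are measurable one stage later, at
    \<open>Suc t\<close>. Thus \<open>w t\<close> belongs to the past of round \<open>t\<close>,
    from which these draws are independent.\<close>
  have wF: "w t \<in> borel_measurable (\<F> t)" if "t \<le> T" for t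
    using that
  proof (induction t)
    case 0
    have "(\<lambda>_. w0) \<in> borel_measurable (\<F> 0)" by simp
    then show ?case
      by (rule measurable_cong[THEN iffD2, rotated]) (simp add: prems(31) space_F)
  next
    case (Suc t)
    then have t: "t < T" by simp
    have wS: "w t \<in> borel_measurable (\<F> (Suc t))" using Suc by (intro mono) simp
    have gS: "g t k \<in> borel_measurable (\<F> (Suc t))" if k: "k \<in> {1..K}" for k
    proof -
      \<comment> \<open>Restricting the values of the batch to a finite set reduces measurability of
        the gradient to that for each fixed batch.\<close>
      have "B t k \<in> measurable (\<F> (Suc t)) (count_space CC)"
        using measurable_sets[OF prems(16)[OF t k]] CC(2)[OF t k]
        by (intro measurableI) (auto simp: space_F)
      moreover have "(\<lambda>\<omega>. \<Gamma> k C (w t \<omega>)) \<in> borel_measurable (\<F> (Suc t))" if "C \<in> CC" for C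
        by (rule measurable_compose[OF wS \<Gamma>[OF k that]])
      ultimately have "(\<lambda>\<omega>. \<Gamma> k (B t k \<omega>) (w t \<omega>)) \<in> borel_measurable (\<F> (Suc t))"
        using measurable_compose_countable'[of CC "\<lambda>C \<omega>. \<Gamma> k C (w t \<omega>)"] countable_finite[OF CC(1)] by blast
      then show ?thesis
        by (rule measurable_cong[THEN iffD2, rotated]) (simp add: space_F g[OF t k])
    qed
    have "r t \<in> borel_measurable (\<F> (Suc t))"
      unfolding r_def[abs_def]
      by (rule borel_measurable_grad_estimate[OF refl prems(17)[OF t] prems(19)[OF t] prems(18)[OF t] gS mono[OF prems(20)[OF t]]])
    then have "(\<lambda>\<omega>. w t \<omega> - \<eta> t *\<^sub>R r t \<omega>) \<in> borel_measurable (\<F> (Suc t))"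
      using wS by (intro borel_measurable_diff borel_measurable_scaleR borel_measurable_const)
    then show ?case
      by (rule measurable_cong[THEN iffD2, rotated]) (simp add: space_F prems(32)[OF t] r_def)
  qed
  have wM: "w t \<in> borel_measurable Pr" if "t \<le> T" for t
    using measurable_from_subalg[OF prems(15) wF[OF that]] .

  define X where "X t = expectation (\<lambda>\<omega>. (norm (grad F (w t \<omega>)))\<^sup>2)" for t
  define s where "s = (8 + pi\<^sup>2 * (real CARD('n) - 1)) / (pi\<^sup>2 * real CARD('n))"
  define a where "a = 8 * imbalance u K \<beta> P / (pi\<^sup>2 * real CARD('n))"
  define b where "b = (a + s / real K) * \<chi>\<^sub>g\<^sup>2 + interference_term u K M CARD('n) G (alpha \<beta> P)
      + noise_term u K CARD('n) CARD('d) G \<sigma> (alpha \<beta> P)"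
  have rounds: "integrable Pr (\<lambda>\<omega>. (norm (r t \<omega>))\<^sup>2)" "integrable Pr (\<lambda>\<omega>. (norm (grad F (w t \<omega>)))\<^sup>2)"
    "integrable Pr (\<lambda>\<omega>. grad F (w t \<omega>) \<bullet> r t \<omega>)" "expectation (\<lambda>\<omega>. grad F (w t \<omega>) \<bullet> r t \<omega>) = X t"
    "expectation (\<lambda>\<omega>. (norm (r t \<omega>))\<^sup>2) \<le> (s + a * \<xi>\<^sup>2) * X t + b" if t: "t < T" for t
  proof -
    have h\<xi>: "norm (h k v) \<le> \<xi> * norm (grad F v)" if "k \<in> {1..K}" for k v
      unfolding h_def by (rule prems(11)[OF that])
    have cm: "AE \<omega> in Pr. cond_mean Pr (w t) (g t k) \<omega> = h k (w t \<omega>)" if "k \<in> {1..K}" for k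
      unfolding h_def by (rule prems(29)[OF t that])
    note rm = round_moments[OF power_budget_axioms \<sigma> prems(21)[OF t] space_F wF[OF less_imp_le[OF t]]
        prems(20)[OF t] prems(25)[OF t] prems(22)[OF t] prems(23)[OF t] prems(24)[OF t] CC(1) CC(2)[OF t] \<Gamma> g[OF t]
        prems(28)[OF t] h cm prems(30)[OF t] hF h\<xi>]
    show "integrable Pr (\<lambda>\<omega>. (norm (r t \<omega>))\<^sup>2)" unfolding r_def by (rule rm(2))
    show "integrable Pr (\<lambda>\<omega>. (norm (grad F (w t \<omega>)))\<^sup>2)" by (rule rm(3))
    show "integrable Pr (\<lambda>\<omega>. grad F (w t \<omega>) \<bullet> r t \<omega>)" unfolding r_def by (rule rm(4))
    show "expectation (\<lambda>\<omega>. grad F (w t \<omega>) \<bullet> r t \<omega>) = X t" unfolding r_def X_def by (rule rm(5))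
    show "expectation (\<lambda>\<omega>. (norm (r t \<omega>))\<^sup>2) \<le> (s + a * \<xi>\<^sup>2) * X t + b"
      using rm(6) unfolding r_def X_def s_def a_def b_def by (simp add: add.assoc)
  qed
  \<comment> \<open>The step sizes are prescribed for \<open>t < T\<close> only, where they all
    equal this constant.\<close>
  define \<eta>\<^sub>0 where "\<eta>\<^sub>0 = 1 / (varpi * sqrt (real T))"
  have step: "w (Suc t) \<omega> = w t \<omega> - \<eta>\<^sub>0 *\<^sub>R r t \<omega>" if "t < T" "\<omega> \<in> space Pr" for t \<omega>
    using prems(32)[OF that] prems(33)[OF that(1)] by (simp add: r_def \<eta>\<^sub>0_def)
  have eps: "\<epsilon> = L * b"
    unfolding \<epsilon>_def bias_term_eq b_def a_def s_def by (simp add: mult.commute)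
  have "(\<Sum>t<T. (\<eta>\<^sub>0 - L * \<eta>\<^sub>0\<^sup>2 * (s + a * \<xi>\<^sup>2) / 2) * X t) \<le> F w0 - F wstar + real T * (L * \<eta>\<^sub>0\<^sup>2 * b / 2)"
    by (rule descent_sum[OF Fdiff Flip less_imp_le[OF L] Fmin wM prems(31) step rounds(1,3-5)])
  also have "L * \<eta>\<^sub>0\<^sup>2 * b / 2 = \<eta>\<^sub>0\<^sup>2 * \<epsilon> / 2" by (simp add: eps)
  finally have rec: "(\<Sum>t<T. (\<eta>\<^sub>0 - L * \<eta>\<^sub>0\<^sup>2 * (s + a * \<xi>\<^sup>2) / 2) * X t) \<le> F w0 - F wstar + real T * (\<eta>\<^sub>0\<^sup>2 * \<epsilon> / 2)" .
  have X0: "X 0 \<le> 2 * L * (F w0 - F wstar)"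
  proof -
    \<comment> \<open>The initial model is deterministic, so the first gradient is controlled by the
      gap of the loss at \<open>w0\<close> without any recursion.\<close>
    have "X 0 = expectation (\<lambda>_. (norm (grad F w0))\<^sup>2)"
      unfolding X_def by (rule Bochner_Integration.integral_cong) (simp_all add: prems(31))
    then show ?thesis using gradient_bound_by_gap[OF Fdiff Flip L Fmin] by (simp add: prob_space)
  qed
  have "1 / real T * (\<Sum>t<T. X t) \<le> 2 * varpi / sqrt (real T) * (F w0 - F wstar + \<epsilon> / (2 * varpi\<^sup>2))"
  proof (rule convergence_rate_arith[OF T L _ _ _ _ rec \<eta>\<^sub>0_def X0])
    show "L \<le> varpi" "(s + a * \<xi>\<^sup>2) * L \<le> 7 / 5 * varpi"
      unfolding varpi_def s_def a_def by (rule scaling_factor_bounds[OF L])+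
    show "0 \<le> \<epsilon>" unfolding \<epsilon>_def by (rule bias_term_nonneg[OF L])
    show "0 \<le> X t" for t unfolding X_def by simp
  qed
  then show ?thesis using rounds(2) by (simp add: X_def prob_space)
qed

end
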